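(* Let $\prec$ be a term order in $S$ and let $M_{\prec\!\!\prec}$ be the number of the maximal terms in $\mathbf B_{S_m}^{q}\cap\mathbf{Hilb}_{p(t)}^{n}$ with respect to $\prec\!\!\prec$. Then there are at least $M_{\prec\!\!\prec}$ irreducible components in $\mathbf{Hilb}_{p(t)}^{n}$.
   Context: $K$ is an infinite field, $S=K[x_0,\dots,x_n]$ with the standard grading, $S_m$ is its degree $m$ component, a term is a monic monomial; the term order satisfies $x_0\prec\dots\prec x_n$. $\mathbf{Hilb}_{p(t)}^{n}$ is the Hilbert scheme of closed subschemes of $\mathbb P^n_K$ with Hilbert polynomial $p(t)$; $r$ is the Gotzmann number of $p(t)$ (the smallest integer such that the saturated ideals of all such subschemes are $r$-regular). Fix $m\ge r$, $q=\binom{n+m}{n}-p(m)$. $\mathbf{Hilb}_{p(t)}^{n}$ is regarded as a closed subscheme of the Grassmannian $\mathbf{Gr}_{S_m}^{q}$ of $q$-dimensional subspaces of $S_m$ by sending a subscheme with saturated ideal $I$ to $I_m$. $\mathbf T_{S_m}^{q}\subset\wedge^qS_m$ is the set of $\tau_1\wedge\dots\wedge\tau_q$ with $\tau_i$ terms in $S_m$, $\tau_1\succ\dots\succ\tau_q$; for $L=\tau_1\wedge\dots\wedge\tau_q$, $\mathrm{vs}(L)=\langle\tau_1,\dots,\tau_q\rangle$. $\mathrm{GL}=\mathrm{GL}_K(n+1)$ acts on $S$ by $g(f)=f(\sum_j g_{0j}x_j,\dots,\sum_j g_{nj}x_j)$ and on $\wedge^qS_m$ accordingly. $L$ is Borel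 if $g(L)\in\langle L\rangle$ for every upper-triangular $g\in\mathrm{GL}$; $\mathbf B_{S_m}^{q}$ is the set of Borel terms, and $\mathbf B_{S_m}^{q}\cap\mathbf{Hilb}_{p(t)}^{n}$ denotes the set of Borel terms $L$ such that $\mathrm{vs}(L)$ is a point of $\mathbf{Hilb}_{p(t)}^{n}$. Partial order: $\tau_1\wedge\dots\wedge\tau_q\prec\!\!\prec\sigma_1\wedge\dots\wedge\sigma_q$ iff there is a bijection $\omega:\{\tau_1,\dots,\tau_q\}\to\{\sigma_1,\dots,\sigma_q\}$ with $\tau_i\preceq\omega(\tau_i)$ for all $i$. *)

theory Defs
  imports
    "HOL-Analysis.Analysis"
    "HOL-Library.Poly_Mapping"
    "HOL-Computational_Algebra.Polynomial"
    "HOL-Computational_Algebra.Fraction_Field"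
    "HOL-Algebra.Algebraic_Closure_Type"
    "Jordan_Normal_Form.Determinant"
begin

no_notation vec_index (infixl \<open>$\<close> 100)

text \<open>
  Terms are exponent vectors. The polynomial ring in variables \<open>x\<^sub>i\<close>, \<open>i :: 'v\<close>, is
  \<open>('v, 'a) mpol\<close>; for \<open>K[x\<^sub>0, \<dots>, x\<^sub>n]\<close> the index type \<open>'v\<close> is a finite linear order with
  \<open>n + 1\<close> elements.
\<close>

type_synonym 'v trm = "'v \<Rightarrow>\<^sub>0 nat"
type_synonym ('v, 'a) mpol = "'v trm \<Rightarrow>\<^sub>0 'a"

definition deg :: "'v trm \<Rightarrow> nat" where
  "deg t = (\<Sum>i\<in>Poly_Mapping.keys t. Poly_Mapping.lookup t i)"

definition terms :: "nat \<Rightarrow> 'v trm set" where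
  "terms m = {t. deg t = m}"

definition monomial :: "'v trm \<Rightarrow> ('v, 'a::comm_ring_1) mpol" where
  "monomial t = Poly_Mapping.single t 1"

definition var :: "'v \<Rightarrow> ('v, 'a::comm_ring_1) mpol" where
  "var i = monomial (Poly_Mapping.single i 1)"

definition const :: "'a \<Rightarrow> ('v, 'a::comm_ring_1) mpol" where
  "const c = Poly_Mapping.single 0 c"

definition homogeneous :: "nat \<Rightarrow> ('v, 'a::comm_ring_1) mpol \<Rightarrow> bool" where
  "homogeneous d f \<longleftrightarrow> (\<forall>t\<in>Poly_Mapping.keys f. deg t = d)"

definition hcomp :: "nat \<Rightarrow> ('v, 'a::comm_ring_1) mpol \<Rightarrow> ('v, 'a) mpol" where
  "hcomp d f = (\<Sum>t\<in>{t\<in>Poly_Mapping.keys f. deg t = d}. Poly_Mapping.single t (Poly_Mapping.lookup f t))"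

definition forms :: "nat \<Rightarrow> ('v, 'a::comm_ring_1) mpol set" where
  "forms m = {f. homogeneous m f}"

definition scale :: "'a \<Rightarrow> ('v, 'a::comm_ring_1) mpol \<Rightarrow> ('v, 'a) mpol" where
  "scale c f = const c * f"

global_interpretation mp: vector_space "scale :: 'a::field \<Rightarrow> ('v, 'a) mpol \<Rightarrow> ('v, 'a) mpol"
  by unfold_locales
     (simp_all add: scale_def const_def algebra_simps Poly_Mapping.single_add
        Poly_Mapping.mult_single flip: mult.assoc)

text \<open>
  Evaluation of a polynomial at the point \<open>y\<close>, with coefficients mapped by \<open>h\<close>.
\<close>

definition mpeval :: "('a \<Rightarrow> 'b) \<Rightarrow> ('v \<Rightarrow> 'b) \<Rightarrow> ('v, 'a::comm_ring_1) mpol \<Rightarrow> 'b::comm_ring_1" where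
  "mpeval h y f = (\<Sum>t\<in>Poly_Mapping.keys f.
     h (Poly_Mapping.lookup f t) * (\<Prod>i\<in>Poly_Mapping.keys t. y i ^ Poly_Mapping.lookup t i))"

type_synonym ('a, 'v) sq_mat = "'a^'v^'v"

definition act :: "('a, 'v) sq_mat \<Rightarrow> ('v::finite, 'a::comm_ring_1) mpol \<Rightarrow> ('v, 'a) mpol" where
  "act g f = mpeval const (\<lambda>i. \<Sum>j\<in>UNIV. scale (g $ i $ j) (var j)) f"

definition upper_triangular :: "('a::zero, 'v::{finite,linorder}) sq_mat \<Rightarrow> bool" where
  "upper_triangular g \<longleftrightarrow> (\<forall>i j. j < i \<longrightarrow> g $ i $ j = 0)"

text \<open>\<open>tle\<close> is the reflexive version of the term order; the last clause is \<open>x\<^sub>0 \<prec> \<dots> \<prec> x\<^sub>n\<close>.\<close>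

definition term_order :: "('v::linorder trm \<Rightarrow> 'v trm \<Rightarrow> bool) \<Rightarrow> bool" where
  "term_order tle \<longleftrightarrow>
     class.linorder tle (\<lambda>s t. tle s t \<and> s \<noteq> t) \<and>
     (\<forall>t. tle 0 t) \<and>
     (\<forall>s t u. tle s t \<longrightarrow> tle (s + u) (t + u)) \<and>
     (\<forall>i j. i < j \<longrightarrow> tle (Poly_Mapping.single i 1) (Poly_Mapping.single j 1))"

definition homogeneous_ideal :: "('v, 'a::comm_ring_1) mpol set \<Rightarrow> bool" where
  "homogeneous_ideal I \<longleftrightarrow> module.subspace (*) I \<and> (\<forall>f\<in>I. \<forall>d. hcomp d f \<in> I)"

definition saturated :: "('v, 'a::comm_ring_1) mpol set \<Rightarrow> bool" where
  "saturated I \<longleftrightarrow> (\<forall>f k. (\<forall>g\<in>forms k. g * f \<in> I) \<longrightarrow> f \<in> I)"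

text \<open>For large \<open>t\<close>, the dimension of the degree \<open>t\<close> component of the quotient by \<open>I\<close> is \<open>p(t)\<close>.\<close>

definition has_hilbert_polynomial :: "('v, 'a::field) mpol set \<Rightarrow> rat poly \<Rightarrow> bool" where
  "has_hilbert_polynomial I p \<longleftrightarrow>
     (\<forall>\<^sub>F t in sequentially.
        of_nat (mp.dim (forms t :: ('v, 'a) mpol set)) - of_nat (mp.dim (I \<inter> forms t)) = poly p (of_nat t))"

text \<open>
  The saturated ideals of the closed subschemes of \<open>P\<^sup>n\<close> with Hilbert polynomial \<open>p\<close>.
\<close>

definition hilb_ideals :: "rat poly \<Rightarrow> ('v, 'a::field) mpol set set" where
  "hilb_ideals p = {I. homogeneous_ideal I \<and> saturated I \<and> has_hilbert_polynomial I p}"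

text \<open>
  The free module of rank \<open>b\<close> consists of the sequences that vanish from position \<open>b\<close> on.
\<close>

definition free_mod :: "nat \<Rightarrow> (nat \<Rightarrow> ('v, 'a::comm_ring_1) mpol) set" where
  "free_mod b = {v. \<forall>j\<ge>b. v j = 0}"

definition mat_apply ::
  "nat \<Rightarrow> nat \<Rightarrow> (nat \<Rightarrow> nat \<Rightarrow> ('v, 'a::comm_ring_1) mpol) \<Rightarrow> (nat \<Rightarrow> ('v, 'a) mpol) \<Rightarrow> nat \<Rightarrow> ('v, 'a) mpol" where
  "mat_apply r c M v = (\<lambda>k. if k < r then \<Sum>j<c. M k j * v j else 0)"

text \<open>
  A minimal graded free resolution \<open>\<dots> \<rightarrow> F\<^sub>1 \<rightarrow> F\<^sub>0 \<rightarrow> I \<rightarrow> 0\<close>, where \<open>F\<^sub>i\<close> is the sum of the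
  \<open>S(-d i j)\<close> for \<open>j < b i\<close>, the map onto \<open>I\<close> sends the standard basis to \<open>e\<close>, and \<open>M i\<close> is the
  matrix of \<open>F\<^bsub>i+1\<^esub> \<rightarrow> F\<^sub>i\<close>. By Hilbert's syzygy theorem the resolution of an ideal in \<open>n + 1\<close>
  variables has length at most \<open>n\<close>.
\<close>

definition minimal_graded_resolution ::
  "('v::finite, 'a::field) mpol set \<Rightarrow> (nat \<Rightarrow> nat) \<Rightarrow> (nat \<Rightarrow> nat \<Rightarrow> nat) \<Rightarrow> (nat \<Rightarrow> ('v, 'a) mpol)
    \<Rightarrow> (nat \<Rightarrow> nat \<Rightarrow> nat \<Rightarrow> ('v, 'a) mpol) \<Rightarrow> bool" where
  "minimal_graded_resolution I b d e M \<longleftrightarrow>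
     (\<forall>j<b 0. homogeneous (d 0 j) (e j)) \<and>
     (\<forall>i. \<forall>k<b i. \<forall>j<b (Suc i).
        (\<forall>t\<in>Poly_Mapping.keys (M i k j). deg t + d i k = d (Suc i) j) \<and>
        Poly_Mapping.lookup (M i k j) 0 = 0) \<and>
     (\<forall>i\<ge>CARD('v). b i = 0) \<and>
     (\<lambda>v. \<Sum>j<b 0. e j * v j) ` free_mod (b 0) = I \<and>
     {v \<in> free_mod (b 0). (\<Sum>j<b 0. e j * v j) = 0} =
       mat_apply (b 0) (b 1) (M 0) ` free_mod (b 1) \<and>
     (\<forall>i. {v \<in> free_mod (b (Suc i)). mat_apply (b i) (b (Suc i)) (M i) v = (\<lambda>k. 0)} =
       mat_apply (b (Suc i)) (b (Suc (Suc i))) (M (Suc i)) ` free_mod (b (Suc (Suc i))))"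

definition regular :: "nat \<Rightarrow> ('v::finite, 'a::field) mpol set \<Rightarrow> bool" where
  "regular r I \<longleftrightarrow>
     (\<exists>b d e M. minimal_graded_resolution I b d e M \<and> (\<forall>i. \<forall>j<b i. d i j \<le> r + i))"

definition is_gotzmann_number :: "('v::finite, 'a::field) mpol itself \<Rightarrow> rat poly \<Rightarrow> nat \<Rightarrow> bool" where
  "is_gotzmann_number _ p r \<longleftrightarrow>
     (\<forall>I \<in> hilb_ideals p :: ('v, 'a) mpol set set. regular r I) \<and>
     (\<forall>s. (\<forall>I \<in> hilb_ideals p :: ('v, 'a) mpol set set. regular s I) \<longrightarrow> r \<le> s)"

text \<open>\<open>desc tle T i\<close> is the \<open>i\<close>-th element of the finite set \<open>T\<close> in descending order, counted from 0.\<close>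

definition desc :: "('v trm \<Rightarrow> 'v trm \<Rightarrow> bool) \<Rightarrow> 'v trm set \<Rightarrow> nat \<Rightarrow> 'v trm" where
  "desc tle T i = (THE t. t \<in> T \<and> card {s\<in>T. tle t s \<and> s \<noteq> t} = i)"

text \<open>
  The set of terms \<open>\<tau>\<^sub>1 \<and> \<dots> \<and> \<tau>\<^sub>q\<close> with \<open>\<tau>\<^sub>1 \<succ> \<dots> \<succ> \<tau>\<^sub>q\<close> of degree \<open>m\<close> is a basis of the \<open>q\<close>-th exterior
  power of the forms of degree \<open>m\<close>. Such a term is represented by the set \<open>{\<tau>\<^sub>1, \<dots>, \<tau>\<^sub>q}\<close>, and an
  element of the exterior power by its family of coordinates with respect to this basis.
  \<open>wedge tle q m f\<close> is \<open>f 0 \<and> \<dots> \<and> f (q - 1)\<close>.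
\<close>

definition ext_terms :: "nat \<Rightarrow> nat \<Rightarrow> 'v trm set set" where
  "ext_terms m q = {T. T \<subseteq> terms m \<and> card T = q}"

definition wedge ::
  "('v trm \<Rightarrow> 'v trm \<Rightarrow> bool) \<Rightarrow> nat \<Rightarrow> nat \<Rightarrow> (nat \<Rightarrow> ('v, 'a::comm_ring_1) mpol) \<Rightarrow> 'v trm set \<Rightarrow> 'a" where
  "wedge tle q m f = (\<lambda>T. if T \<in> ext_terms m q
     then Determinant.det (Matrix.mat q q (\<lambda>(i, j). Poly_Mapping.lookup (f i) (desc tle T j))) else 0)"

definition vs :: "'v trm set \<Rightarrow> ('v, 'a::field) mpol set" where
  "vs T = mp.span (monomial ` T)"

definition borel_terms ::
  "'a::field itself \<Rightarrow> ('v::{finite,linorder} trm \<Rightarrow> 'v trm \<Rightarrow> bool) \<Rightarrow> nat \<Rightarrow> nat \<Rightarrow> 'v trm set set" where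
  "borel_terms _ tle m q = {T \<in> ext_terms m q.
     \<forall>g::('a, 'v) sq_mat. invertible g \<and> upper_triangular g \<longrightarrow>
       (\<exists>c. \<forall>U. wedge tle q m (\<lambda>i. act g (monomial (desc tle T i))) U
               = c * wedge tle q m (\<lambda>i. monomial (desc tle T i)) U)}"

text \<open>The partial order on terms of the exterior power, in its reflexive form.\<close>

definition ext_le :: "('v trm \<Rightarrow> 'v trm \<Rightarrow> bool) \<Rightarrow> 'v trm set \<Rightarrow> 'v trm set \<Rightarrow> bool" where
  "ext_le tle T U \<longleftrightarrow> (\<exists>\<omega>. bij_betw \<omega> T U \<and> (\<forall>t\<in>T. tle t (\<omega> t)))"

definition grassmannian :: "nat \<Rightarrow> nat \<Rightarrow> ('v, 'a::field) mpol set set" where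
  "grassmannian m q = {V. mp.subspace V \<and> V \<subseteq> forms m \<and> mp.dim V = q}"

text \<open>
  The points of the Hilbert scheme with values in the field \<open>'a\<close>, embedded in the Grassmannian by
  \<open>I \<mapsto> I\<^sub>m\<close>.
\<close>

definition hilb_points :: "rat poly \<Rightarrow> nat \<Rightarrow> nat \<Rightarrow> ('v, 'a::field) mpol set set" where
  "hilb_points p m q = {V \<in> grassmannian m q. \<exists>I \<in> hilb_ideals p. V = I \<inter> forms m}"

text \<open>
  \<open>K\<close> need not be algebraically closed, so the Hilbert scheme has more points than its \<open>K\<close>-points.
  The universal domain \<open>\<Omega>\<close>, the algebraic closure of \<open>K(y\<^sub>0, y\<^sub>1, \<dots>)\<close>, contains a copy over \<open>K\<close> of every
  finitely generated extension field of \<open>K\<close>, in particular of the residue field of every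
  point of a \<open>K\<close>-scheme of finite type. Hence every point of the scheme is the image of a point
  with values in \<open>\<Omega>\<close>.
\<close>

type_synonym 'a univ_dom = "(nat, 'a) mpol fract alg_closure"

definition univ_emb :: "'a::field \<Rightarrow> 'a univ_dom" where
  "univ_emb c = to_ac (Fract (const c) 1)"

text \<open>
  The point of Proj of the polynomial ring in the Pluecker coordinates under the point with
  homogeneous coordinates \<open>y\<close> in \<open>\<Omega>\<close>: the homogeneous prime ideal generated by the forms over \<open>K\<close>
  vanishing at \<open>y\<close>. (There is one variable for each set of terms, but all variables
  not belonging to \<open>ext_terms m q\<close> vanish at every \<open>y\<close> used below.)
\<close>

definition proj_point :: "('i \<Rightarrow> 'a univ_dom) \<Rightarrow> ('i, 'a::field) mpol set" where
  "proj_point y = {F. \<forall>d. mpeval univ_emb y (hcomp d F) = 0}"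

definition is_basis :: "nat \<Rightarrow> (nat \<Rightarrow> ('v, 'a::field) mpol) \<Rightarrow> ('v, 'a) mpol set \<Rightarrow> bool" where
  "is_basis q f V \<longleftrightarrow> inj_on f {..<q} \<and> mp.independent (f ` {..<q}) \<and> mp.span (f ` {..<q}) = V"

text \<open>
  The underlying set of the Hilbert scheme as a subset of Proj: the images of its points with values in
  \<open>\<Omega>\<close>. The order \<open>tle\<close> only affects the signs of the Pluecker coordinates.
\<close>

definition hilb_carrier ::
  "('v::finite trm \<Rightarrow> 'v trm \<Rightarrow> bool) \<Rightarrow> rat poly \<Rightarrow> nat \<Rightarrow> nat \<Rightarrow> ('v trm set, 'a::field) mpol set set" where
  "hilb_carrier tle p m q = {proj_point (wedge tle q m f) | f V.
     V \<in> (hilb_points p m q :: ('v, 'a univ_dom) mpol set set) \<and> is_basis q f V}"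

text \<open>
  The sets generating the topology are the traces on \<open>Y\<close> of the basic open sets \<open>D(F)\<close>. Since \<open>Y\<close> will
  consist of homogeneous ideals, non-homogeneous \<open>F\<close> contribute only unions of sets \<open>D(F\<^sub>d)\<close>.
\<close>

definition zariski :: "('i, 'a::comm_ring_1) mpol set set \<Rightarrow> ('i, 'a) mpol set topology" where
  "zariski Y = topology_generated_by {{P \<in> Y. F \<notin> P} | F. True}"

definition hilb_space ::
  "('v::finite trm \<Rightarrow> 'v trm \<Rightarrow> bool) \<Rightarrow> rat poly \<Rightarrow> nat \<Rightarrow> nat \<Rightarrow> ('v trm set, 'a::field) mpol set topology" where
  "hilb_space tle p m q = zariski (hilb_carrier tle p m q)"

definition irreducible_in :: "'x topology \<Rightarrow> 'x set \<Rightarrow> bool" where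
  "irreducible_in Y Z \<longleftrightarrow> Z \<subseteq> topspace Y \<and> Z \<noteq> {} \<and>
     (\<forall>A B. closedin Y A \<and> closedin Y B \<and> Z \<subseteq> A \<union> B \<longrightarrow> Z \<subseteq> A \<or> Z \<subseteq> B)"

definition irreducible_components :: "'x topology \<Rightarrow> 'x set set" where
  "irreducible_components Y =
     {Z. irreducible_in Y Z \<and> (\<forall>Z'. irreducible_in Y Z' \<and> Z \<subseteq> Z' \<longrightarrow> Z' = Z)}"

definition borel_hilb_terms ::
  "'a::field itself \<Rightarrow> ('v::{finite,linorder} trm \<Rightarrow> 'v trm \<Rightarrow> bool) \<Rightarrow> rat poly \<Rightarrow> nat \<Rightarrow> nat
    \<Rightarrow> 'v trm set set" where
  "borel_hilb_terms _ tle p m q =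
     {T \<in> borel_terms TYPE('a) tle m q. (vs T :: ('v, 'a) mpol set) \<in> hilb_points p m q}"

definition maximal_borel_hilb_terms ::
  "'a::field itself \<Rightarrow> ('v::{finite,linorder} trm \<Rightarrow> 'v trm \<Rightarrow> bool) \<Rightarrow> rat poly \<Rightarrow> nat \<Rightarrow> nat
    \<Rightarrow> 'v trm set set" where
  "maximal_borel_hilb_terms K tle p m q =
     {T \<in> borel_hilb_terms K tle p m q.
        \<forall>U \<in> borel_hilb_terms K tle p m q. ext_le tle T U \<longrightarrow> U = T}"

end

theory Submission
  imports Defs "HOL-Library.Function_Algebras"
begin

text \<open>
  Suppose that an irreducible subset of the Hilbert scheme contains the points of two maximal Borel
  terms \<open>L\<close> and \<open>L'\<close>. The open sets where the Pluecker coordinates of \<open>L\<close> and \<open>L'\<close> do not vanish meet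
  in it, so some point \<open>V = I\<^sub>m\<close> with values in \<open>\<Omega>\<close> has both coordinates nonzero. Let \<open>T\<close> be the set of
  leading terms of \<open>g V\<close> for generic \<open>g \<in> GL(\<Omega>)\<close>. Every Pluecker coordinate that is nonzero on the
  orbit of \<open>V\<close> is \<open>\<preceq>\<close> \<open>T\<close> in the partial order on terms of the exterior power, in particular \<open>L\<close> and
  \<open>L'\<close> are. Moreover \<open>T\<close> is Borel, and it lies in the Hilbert scheme over \<open>K\<close>: the saturation \<open>J\<close> of
  the monomial ideal of leading terms of \<open>g I\<close> has the Hilbert polynomial \<open>p\<close>, so it is \<open>r\<close>-regular,
  and its free resolution gives \<open>dim J\<^sub>m = q\<close>, whence \<open>J\<^sub>m\<close> is spanned by \<open>T\<close>. By maximality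
  \<open>L = T = L'\<close>, so choosing a component through each point is injective.
\<close>

text \<open>The number \<open>r\<close> bounds the regularity of ideals over \<open>K\<close> only,
  while the irreducible set is met in a point over \<Omega>. Monomial ideals bridge the gap: a set
  of exponents defines an ideal over every field, always with the same Hilbert function, so
  dimensions are computed over \<open>K\<close> and used over either field. Genericity of
  \<open>g\<close> is required in degree \<open>m\<close> alone, where there are finitely many
  Pluecker coordinates. An invertible \<open>g\<close> with the largest number of nonzero
  coordinates therefore suffices, and GL carries no topology. That \<open>T\<close> is Borel has to
  hold in every characteristic. If an upper triangular \<open>h\<close> gives the term
  \<open>T\<close> a nonzero coordinate \<open>U\<close>, triangularity yields
  \<open>T \<preceq> U\<close>. Degenerating \<open>g V\<close> to \<open>T\<close> under the torus
  shows that the coordinate \<open>U\<close> is also nonzero somewhere on the orbit of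
  \<open>V\<close>, so \<open>U \<preceq> T\<close>. Hence \<open>h\<close> only rescales
  \<open>T\<close>.\<close>

section \<open>Dimension counting in vector spaces\<close>

text \<open>Gaussian elimination with \<open>D\<close> as the columns, ordered by \<open>rk\<close>.
  Leading coordinates of the family are distinct, so the highest one in a linear relation cannot
  cancel; and an element of \<open>W\<close> is reduced from the top down, where \<open>sep\<close>
  says that the process ends in 0. Coordinates are abstract because they are indexed by terms for
  forms and by pairs of a slot and a term for free modules.\<close>

lemma (in vector_space) triangular_family_basis:
  fixes coord :: "'b \<Rightarrow> 'x \<Rightarrow> 'a" and rk :: "'x \<Rightarrow> nat"
  assumes D: "finite D" "inj_on rk D"
    and add: "\<And>v w x. coord (v + w) x = coord v x + coord w x"
    and scl: "\<And>c v x. coord (scale c v) x = c * coord v x"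
    and W: "subspace W"
    and sep: "\<And>w. w \<in> W \<Longrightarrow> (\<And>x. x \<in> D \<Longrightarrow> coord w x = 0) \<Longrightarrow> w = 0"
    and L: "L = {x \<in> D. \<exists>w\<in>W. coord w x \<noteq> 0 \<and> (\<forall>y\<in>D. rk x < rk y \<longrightarrow> coord w y = 0)}"
    and e: "\<And>x. x \<in> L \<Longrightarrow> e x \<in> W" "\<And>x. x \<in> L \<Longrightarrow> coord (e x) x \<noteq> 0"
      "\<And>x y. x \<in> L \<Longrightarrow> y \<in> D \<Longrightarrow> rk x < rk y \<Longrightarrow> coord (e x) y = 0"
  shows "inj_on e L" "independent (e ` L)" "span (e ` L) = W"
proof -
  have LD: "L \<subseteq> D" and finL: "finite L" using L D by auto
  have coord0: "coord 0 x = 0" for x using scl[of 0 0 x] by simp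
  have coord_sum: "coord (\<Sum>i\<in>I. g i) x = (\<Sum>i\<in>I. coord (g i) x)" if "finite I" for I and g :: "'x \<Rightarrow> 'b" and x
    using that by (induction I rule: finite_induct) (auto simp: coord0 add)
  show inj: "inj_on e L"
  proof (rule inj_onI, rule ccontr)
    fix x y assume xy: "x \<in> L" "y \<in> L" "e x = e y" "x \<noteq> y"
    have "rk x \<noteq> rk y" using xy LD D(2) by (auto dest: inj_onD)
    then show False using xy e(2)[of x] e(2)[of y] e(3)[of x y] e(3)[of y x] LD by (auto simp: linorder_neq_iff)
  qed
  show "independent (e ` L)"
  proof (rule independent_if_scalars_zero)
    show "finite (e ` L)" using finL by simp
  next
    fix u x assume s: "(\<Sum>v\<in>e ` L. scale (u v) v) = 0" and x: "x \<in> e ` L"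
    have s': "(\<Sum>i\<in>L. scale (u (e i)) (e i)) = 0" using s by (simp add: sum.reindex[OF inj] o_def)
    have "\<forall>i\<in>L. u (e i) = 0"
    proof (rule ccontr)
      assume "\<not> ?thesis"
      then have ne: "{i\<in>L. u (e i) \<noteq> 0} \<noteq> {}" by auto
      define k where "k = Max (rk ` {i\<in>L. u (e i) \<noteq> 0})"
      have "k \<in> rk ` {i\<in>L. u (e i) \<noteq> 0}" unfolding k_def using ne finL by (intro Max_in) auto
      then obtain i where i: "i \<in> L" "u (e i) \<noteq> 0" "rk i = k" by auto
      have other: "u (e j) * coord (e j) i = 0" if "j \<in> L - {i}" for j
      proof (cases "u (e j) = 0")
        case False
        then have "rk j \<le> rk i" unfolding i(3) k_def using finL that by (intro Max_ge) auto
        moreover have "rk j \<noteq> rk i" using that i LD D(2) by (auto dest: inj_onD)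
        ultimately show ?thesis using e(3)[of j i] that i LD by auto
      qed simp
      have "0 = (\<Sum>j\<in>L. u (e j) * coord (e j) i)"
        using arg_cong[OF s', of "\<lambda>v. coord v i"] by (simp add: coord_sum finL scl coord0)
      also have "\<dots> = u (e i) * coord (e i) i"
        by (subst sum.remove[OF finL i(1)]) (simp only: sum.neutral[OF ballI, OF other] add_0_right)
      finally show False using i e(2) by simp
    qed
    then show "u x = 0" using x by auto
  qed
  \<comment> \<open>Induction on a bound \<open>n\<close> from which on all coordinates of
    \<open>w\<close> vanish; each step clears one leading coordinate.\<close>
  have "w \<in> span (e ` L)" if "w \<in> W" "\<forall>y\<in>D. n \<le> rk y \<longrightarrow> coord w y = 0" for n w
    using that
  proof (induction n arbitrary: w)
    case 0
    then have "w = 0" using sep by blast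
    then show ?case by (simp add: span_zero)
  next
    case (Suc n)
    show ?case
    proof (cases "\<exists>x\<in>D. rk x = n \<and> coord w x \<noteq> 0")
      case True
      then obtain x where x: "x \<in> D" "rk x = n" "coord w x \<noteq> 0" by auto
      have xL: "x \<in> L" unfolding L using x Suc.prems by (auto intro!: bexI[of _ w])
      define c where "c = - coord w x / coord (e x) x"
      define w' where "w' = w + scale c (e x)"
      have "w' \<in> W" unfolding w'_def using W e(1)[OF xL] Suc.prems(1)
        by (intro subspace_add subspace_scale)
      moreover have "coord w' y = 0" if "y \<in> D" "n \<le> rk y" for y
      proof (cases "y = x")
        case True
        then show ?thesis unfolding w'_def add scl c_def using e(2)[OF xL] by simp
      next
        case False
        then have "rk x \<noteq> rk y" using that x D(2) by (auto dest: inj_onD)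
        then show ?thesis using that x e(3)[OF xL] Suc.prems(2) by (simp add: w'_def add scl)
      qed
      ultimately have "w' \<in> span (e ` L)" using Suc.IH by blast
      then have "w' - scale c (e x) \<in> span (e ` L)"
        using span_diff[OF _ span_scale[OF span_base[OF imageI[OF xL]]]] by blast
      then show ?thesis by (simp add: w'_def)
    next
      case False
      then show ?thesis using Suc by (metis le_antisym not_less_eq_eq)
    qed
  qed
  note * = this
  have "w \<in> span (e ` L)" if "w \<in> W" for w
  proof (rule *[OF that, of "Suc (Max (rk ` D))"], intro ballI impI)
    fix y assume "y \<in> D" "Suc (Max (rk ` D)) \<le> rk y"
    moreover have "rk y \<le> Max (rk ` D)" using D \<open>y \<in> D\<close> by (intro Max_ge) auto
    ultimately show "coord w y = 0" by simp
  qed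
  moreover have "span (e ` L) \<subseteq> W" using e(1) W by (intro span_minimal) auto
  ultimately show "span (e ` L) = W" by blast
qed

text \<open>Every leading position has a witness in \<open>W\<close>, and any choice of witnesses is
  an echelon basis. The second conclusion supplies the finite spanning set that rank-nullity asks
  for inside an infinite-dimensional space.\<close>

lemma (in vector_space) dim_eq_card_leading:
  fixes coord :: "'b \<Rightarrow> 'x \<Rightarrow> 'a" and rk :: "'x \<Rightarrow> nat"
  assumes D: "finite D" "inj_on rk D"
    and add: "\<And>v w x. coord (v + w) x = coord v x + coord w x"
    and scl: "\<And>c v x. coord (scale c v) x = c * coord v x"
    and W: "subspace W"
    and sep: "\<And>w. w \<in> W \<Longrightarrow> (\<And>x. x \<in> D \<Longrightarrow> coord w x = 0) \<Longrightarrow> w = 0"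
  shows "dim W = card {x \<in> D. \<exists>w\<in>W. coord w x \<noteq> 0 \<and> (\<forall>y\<in>D. rk x < rk y \<longrightarrow> coord w y = 0)}"
    (is "_ = card ?L")
    and "\<exists>B. finite B \<and> W \<subseteq> span B"
proof -
  define L where "L = ?L"
  have "\<forall>x\<in>L. \<exists>w. w\<in>W \<and> coord w x \<noteq> 0 \<and> (\<forall>y\<in>D. rk x < rk y \<longrightarrow> coord w y = 0)"
    unfolding L_def by auto
  then obtain e where e: "\<forall>x\<in>L. e x \<in> W \<and> coord (e x) x \<noteq> 0 \<and> (\<forall>y\<in>D. rk x < rk y \<longrightarrow> coord (e x) y = 0)"
    by metis
  have e1: "e x \<in> W" and e2: "coord (e x) x \<noteq> 0" if "x \<in> L" for x using e that by blast+
  have e3: "coord (e x) y = 0" if "x \<in> L" "y \<in> D" "rk x < rk y" for x y using e that by blast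
  note basis = triangular_family_basis[where coord = coord and rk = rk and D = D and e = e and W = W and L = L]
  have inj: "inj_on e L"
    by (rule basis(1)) (fact D add scl W sep L_def e1 e2 e3)+
  have ind: "independent (e ` L)"
    by (rule basis(2)) (fact D add scl W sep L_def e1 e2 e3)+
  have sp: "span (e ` L) = W"
    by (rule basis(3)) (fact D add scl W sep L_def e1 e2 e3)+
  show "dim W = card ?L"
    using dim_span_eq_card_independent[OF ind, unfolded sp] card_image[OF inj] unfolding L_def by (rule trans)
  have "finite L" unfolding L_def using D(1) by simp
  then show "\<exists>B. finite B \<and> W \<subseteq> span B"
    using sp by (intro exI[of _ "e ` L"]) simp
qed

text \<open>Rank-nullity on a subspace of a space that may be infinite-dimensional, such as one
  graded piece of a free module. A basis \<open>A\<close> of the kernel is extended to a basis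
  \<open>C\<close> of \<open>W\<close>, and \<open>f\<close> maps \<open>C - A\<close> bijectively
  to a basis of the image.\<close>

lemma (in vector_space_pair) dim_eq_dim_kernel_plus_dim_image:
  assumes f: "Vector_Spaces.linear s1 s2 f" and W: "vs1.subspace W" and B: "finite B" "W \<subseteq> vs1.span B"
  shows "vs1.dim W = vs1.dim {w \<in> W. f w = 0} + vs2.dim (f ` W)"
proof -
  define N where "N = {w \<in> W. f w = 0}"
  have sN: "vs1.subspace N" unfolding N_def
    using W by (simp add: vs1.subspace_def linear_0[OF f] linear_add[OF f] linear_scale[OF f])
  obtain A where A: "A \<subseteq> N" "vs1.independent A" "N \<subseteq> vs1.span A" "card A = vs1.dim N"
    using vs1.basis_exists by blast
  obtain C where C: "A \<subseteq> C" "C \<subseteq> W" "vs1.independent C" "W \<subseteq> vs1.span C"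
    using vs1.maximal_independent_subset_extend[of A W] A N_def by auto
  have finC: "finite C" using vs1.independent_span_bound[OF B(1) C(3)] C(2) B(2) by blast
  have spC: "vs1.span C = W" using C W by (simp add: vs1.span_subspace)
  have spA: "vs1.span A = N" using A sN by (simp add: vs1.span_subspace)
  have ind: "vs1.span A \<inter> vs1.span (C - A) = {0}"
  proof -
    have "x = 0" if xA: "x \<in> vs1.span A" and xC: "x \<in> vs1.span (C - A)" for x
    proof -
      obtain u where u: "x = (\<Sum>a\<in>A. s1 (u a) a)"
        using xA vs1.span_finite[OF finite_subset[OF C(1) finC]] by auto
      obtain v where v: "x = (\<Sum>a\<in>C - A. s1 (v a) a)"
        using xC vs1.span_finite[of "C - A"] finC by auto
      define w where "w a = (if a \<in> A then u a else - v a)" for a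
      have "(\<Sum>a\<in>C. s1 (w a) a) = (\<Sum>a\<in>C - A. s1 (w a) a) + (\<Sum>a\<in>A. s1 (w a) a)"
        using sum.subset_diff[OF C(1) finC] .
      also have "(\<Sum>a\<in>C - A. s1 (w a) a) = - x"
        unfolding v sum_negf[symmetric] by (intro sum.cong) (auto simp: w_def)
      also have "(\<Sum>a\<in>A. s1 (w a) a) = x"
        unfolding u by (intro sum.cong) (auto simp: w_def)
      finally have "(\<Sum>a\<in>C. s1 (w a) a) = 0" by simp
      then have "\<forall>a\<in>C. w a = 0"
        using C(3) vs1.dependent_finite[OF finC] by blast
      then have "\<forall>a\<in>A. u a = 0" using C(1) by (auto simp: w_def split: if_splits)
      then show ?thesis unfolding u by simp
    qed
    then show ?thesis by (auto simp: vs1.span_zero)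
  qed
  have inj: "inj_on f (vs1.span (C - A))"
  proof (rule inj_onI)
    fix x y assume xy: "x \<in> vs1.span (C - A)" "y \<in> vs1.span (C - A)" "f x = f y"
    then have d: "x - y \<in> vs1.span (C - A)" by (intro vs1.span_diff)
    then have "x - y \<in> W" using vs1.span_mono[of "C - A" C] spC by auto
    then have "x - y \<in> vs1.span A" unfolding spA N_def using xy by (simp add: linear_diff[OF f])
    then have "x - y = 0" using d ind by blast
    then show "x = y" by simp
  qed
  have i2: "vs2.independent (f ` (C - A))"
    using linear_independent_injective_image[OF f _ inj] vs1.independent_mono[OF C(3)] by blast
  have sp2: "vs2.span (f ` (C - A)) = f ` W"
  proof -
    have "f ` W = vs2.span (f ` C)" using linear_span_image[OF f, of C] spC by simp
    also have "\<dots> = vs2.span (f ` (C - A))"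
    proof (rule antisym)
      have "f a \<in> vs2.span (f ` (C - A))" if "a \<in> C" for a
      proof (cases "a \<in> A")
        case True
        then have "f a = 0" using A(1) N_def by auto
        then show ?thesis by (simp add: vs2.span_zero)
      next
        case False
        then show ?thesis using that by (intro vs2.span_base) auto
      qed
      then show "vs2.span (f ` C) \<subseteq> vs2.span (f ` (C - A))"
        by (intro vs2.span_minimal) auto
      show "vs2.span (f ` (C - A)) \<subseteq> vs2.span (f ` C)" by (intro vs2.span_mono) auto
    qed
    finally show ?thesis by simp
  qed
  have "vs2.dim (f ` W) = card (f ` (C - A))"
    using vs2.dim_span_eq_card_independent[OF i2] sp2 by simp
  also have "\<dots> = card (C - A)"
    by (intro card_image inj_on_subset[OF inj]) (auto intro: vs1.span_base)
  finally have "vs2.dim (f ` W) = card C - card A"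
    using C(1) finC by (simp add: card_Diff_subset finite_subset)
  moreover have "card A \<le> card C" using C(1) finC by (intro card_mono)
  moreover have "vs1.dim W = card C"
    using vs1.dim_span_eq_card_independent[OF C(3)] spC by simp
  ultimately show ?thesis using A(4) N_def by simp
qed

lemma (in vector_space_pair) dim_image_eq_of_inj_on:
  assumes f: "Vector_Spaces.linear s1 s2 f" and W: "vs1.subspace W" and inj: "inj_on f W"
  shows "vs2.dim (f ` W) = vs1.dim W"
proof -
  obtain A where A: "A \<subseteq> W" "vs1.independent A" "W \<subseteq> vs1.span A" "card A = vs1.dim W"
    using vs1.basis_exists by blast
  have sp: "vs1.span A = W" using A W by (simp add: vs1.span_subspace)
  have "vs2.independent (f ` A)"
    using linear_independent_injective_image[OF f A(2)] inj sp by simp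
  moreover have "vs2.span (f ` A) = f ` W" using linear_span_image[OF f, of A] sp by simp
  ultimately have "vs2.dim (f ` W) = card (f ` A)"
    using vs2.dim_span_eq_card_independent[of "f ` A"] by simp
  also have "\<dots> = card A" using inj A(1) by (intro card_image) (rule inj_on_subset)
  finally show ?thesis using A(4) by simp
qed

section \<open>Terms, forms and leading terms\<close>

lemma lookup_scale: "Poly_Mapping.lookup (scale c f) t = c * Poly_Mapping.lookup f t"
proof -
  have "scale c f = Poly_Mapping.map ((*) c) f"
    by (simp add: scale_def const_def mult_map_scale_conv_mult)
  then show ?thesis by (simp add: Poly_Mapping.map.rep_eq when_def)
qed

lemma mpol_eq_sum_single:
  "f = (\<Sum>t\<in>Poly_Mapping.keys f. Poly_Mapping.single t (Poly_Mapping.lookup f t))"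
  by (rule poly_mapping_eqI)
     (auto simp: lookup_sum lookup_single when_def sum.delta' in_keys_iff)

lemma mpol_induct [case_names add single]:
  fixes f :: "('v, 'a::comm_ring_1) mpol"
  assumes "\<And>f g. P f \<Longrightarrow> P g \<Longrightarrow> P (f + g)" "\<And>t c. P (Poly_Mapping.single t c)"
  shows "P f"
proof -
  have "P (\<Sum>t\<in>A. Poly_Mapping.single t (g t))" if "finite A" for A and g :: "'v trm \<Rightarrow> 'a"
    using that
  proof (induction A rule: finite_induct)
    case empty
    show ?case using assms(2)[of 0 0] by simp
  qed (simp add: assms)
  from this[of "Poly_Mapping.keys f" "Poly_Mapping.lookup f"] show ?thesis
    using mpol_eq_sum_single[of f] by simp
qed

lemma lookup_monomial: "Poly_Mapping.lookup (monomial s) t = (if t = s then 1 else 0)"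
  by (simp add: monomial_def lookup_single when_def)

lemma keys_monomial: "Poly_Mapping.keys (monomial s :: ('v, 'a::comm_ring_1) mpol) = {s}"
  by (auto simp: in_keys_iff lookup_monomial split: if_splits)

lemma lookup_monomial_times:
  fixes f :: "('v, 'a::comm_ring_1) mpol"
  shows "Poly_Mapping.lookup (monomial s * f) (s + t) = Poly_Mapping.lookup f t"
  by (induction f rule: mpol_induct)
     (simp_all add: distrib_left lookup_add monomial_def mult_single lookup_single when_def)

lemma keys_monomial_times:
  fixes f :: "('v, 'a::comm_ring_1) mpol"
  shows "Poly_Mapping.keys (monomial s * f) = (+) s ` Poly_Mapping.keys f"
proof
  show "Poly_Mapping.keys (monomial s * f) \<subseteq> (+) s ` Poly_Mapping.keys f"
    using keys_mult[of "monomial s" f] by (auto simp: keys_monomial)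
  show "(+) s ` Poly_Mapping.keys f \<subseteq> Poly_Mapping.keys (monomial s * f)"
    by (auto simp: in_keys_iff lookup_monomial_times)
qed

section \<open>Degrees and the number of terms of given degree\<close>

lemma deg_eq_sum: "deg (t :: 'v::finite trm) = (\<Sum>i\<in>UNIV. Poly_Mapping.lookup t i)"
  unfolding deg_def by (rule sum.mono_neutral_left) (auto simp: in_keys_iff)

lemma deg_add: "deg (s + t) = deg s + deg (t :: 'v::finite trm)"
  by (simp add: deg_eq_sum lookup_add sum.distrib)

lemma deg_zero [simp]: "deg 0 = 0"
  by (simp add: deg_def)

lemma deg_single [simp]: "deg (Poly_Mapping.single (i::'v::finite) k) = k"
  by (simp add: deg_eq_sum lookup_single when_def)

text \<open>Reading exponents along an enumeration \<open>h\<close> of the variables reduces the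
  count of terms to stars and bars for lists.\<close>

lemma bij_betw_terms_lists:
  assumes "bij_betw h {..<CARD('v)} (UNIV :: 'v::finite set)"
  shows "bij_betw (\<lambda>t. map (\<lambda>k. Poly_Mapping.lookup t (h k)) [0..<CARD('v)])
           (terms m :: 'v trm set) {l. length l = CARD('v) \<and> sum_list l = m}"
proof (rule bij_betw_byWitness[where f' = "\<lambda>l. Abs_poly_mapping (\<lambda>i. l ! inv_into {..<CARD('v)} h i)"])
  let ?N = "CARD('v)" and ?g = "inv_into {..<CARD('v)} h"
  have gh: "?g (h k) = k" if "k < ?N" for k
    using that assms by (simp add: bij_betw_inv_into_left)
  have hg: "h (?g i) = i" for i
    using assms by (simp add: bij_betw_inv_into_right)
  have g_lt: "?g i < ?N" for i
    using bij_betw_inv_into[OF assms] by (auto simp: bij_betw_def)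
  have lk: "Poly_Mapping.lookup (Abs_poly_mapping f) = f" for f :: "'v \<Rightarrow> nat"
    by (simp add: lookup_Abs_poly_mapping)
  show "\<forall>t\<in>terms m. Abs_poly_mapping (\<lambda>i. map (\<lambda>k. Poly_Mapping.lookup t (h k)) [0..<?N] ! ?g i) = t"
    by (auto intro!: poly_mapping_eqI simp: lk g_lt hg)
  show "\<forall>l\<in>{l. length l = ?N \<and> sum_list l = m}.
      map (\<lambda>k. Poly_Mapping.lookup (Abs_poly_mapping (\<lambda>i. l ! ?g i)) (h k)) [0..<?N] = l"
    by (auto intro!: nth_equalityI simp: lk gh)
  have sum_h: "(\<Sum>k<?N. f (h k)) = (\<Sum>i\<in>UNIV. f i)" for f :: "'v \<Rightarrow> nat"
    by (rule sum.reindex_bij_betw[OF assms])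
  show "(\<lambda>t. map (\<lambda>k. Poly_Mapping.lookup t (h k)) [0..<?N]) ` terms m
      \<subseteq> {l. length l = ?N \<and> sum_list l = m}"
    by (auto simp: terms_def deg_eq_sum sum_list_sum_nth atLeast0LessThan sum_h)
  show "(\<lambda>l. Abs_poly_mapping (\<lambda>i. l ! ?g i)) ` {l. length l = ?N \<and> sum_list l = m} \<subseteq> terms m"
    by (auto simp: terms_def deg_eq_sum lk sum_list_sum_nth atLeast0LessThan gh simp flip: sum_h)
qed

lemma card_terms:
  assumes "CARD('v::finite) = n + 1"
  shows "card (terms m :: 'v trm set) = (n + m) choose n"
proof -
  obtain h where "bij_betw h {..<CARD('v)} (UNIV :: 'v set)"
    using ex_bij_betw_nat_finite[of "UNIV :: 'v set"] by (auto simp: atLeast0LessThan)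
  then have "card (terms m :: 'v trm set) = card {l::nat list. length l = CARD('v) \<and> sum_list l = m}"
    by (rule bij_betw_same_card[OF bij_betw_terms_lists])
  also have "\<dots> = (m + n) choose m"
    unfolding card_length_sum_list using assms by simp
  also have "\<dots> = (n + m) choose n"
    by (subst binomial_symmetric) (simp_all add: add.commute)
  finally show ?thesis .
qed

text \<open>The count just obtained is positive, whereas \<open>card\<close> of an infinite set is
  0.\<close>

lemma finite_terms [simp]: "finite (terms m :: 'v::finite trm set)"
proof -
  have "CARD('v) = (CARD('v) - 1) + 1" using finite_UNIV_card_ge_0[where 'a='v] by simp
  from card_terms[OF this, of m] have "card (terms m :: 'v trm set) > 0" by simp
  then show ?thesis by (rule card_ge_0_finite)
qed

section \<open>Homogeneous polynomials and spans of terms\<close>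

lemma homogeneous_zero [simp]: "homogeneous d 0"
  by (simp add: homogeneous_def)

lemma homogeneous_add: "homogeneous d f \<Longrightarrow> homogeneous d g \<Longrightarrow> homogeneous d (f + g)"
  using keys_add[of f g] by (auto simp: homogeneous_def)

lemma homogeneous_sum: "(\<And>i. i \<in> I \<Longrightarrow> homogeneous d (f i)) \<Longrightarrow> homogeneous d (\<Sum>i\<in>I. f i)"
  by (induction I rule: infinite_finite_induct) (simp_all add: homogeneous_add)

lemma homogeneous_mult:
  fixes f g :: "('v::finite, 'a::comm_ring_1) mpol"
  shows "homogeneous d f \<Longrightarrow> homogeneous e g \<Longrightarrow> homogeneous (d + e) (f * g)"
  using keys_mult[of f g] by (force simp: homogeneous_def deg_add)

lemma homogeneous_one [simp]: "homogeneous 0 1"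
  by (simp add: homogeneous_def)

lemma homogeneous_scale: "homogeneous d f \<Longrightarrow> homogeneous d (scale c f)"
  by (auto simp: homogeneous_def in_keys_iff lookup_scale)

lemma homogeneous_monomial: "homogeneous d (monomial t) \<longleftrightarrow> deg t = d"
  by (simp add: homogeneous_def keys_monomial)

lemma homogeneous_power:
  fixes f :: "('v::finite, 'a::comm_ring_1) mpol"
  shows "homogeneous d f \<Longrightarrow> homogeneous (k * d) (f ^ k)"
  by (induction k) (simp_all add: homogeneous_mult)

lemma homogeneous_prod:
  fixes f :: "'i \<Rightarrow> ('v::finite, 'a::comm_ring_1) mpol"
  shows "(\<And>i. i \<in> I \<Longrightarrow> homogeneous (d i) (f i)) \<Longrightarrow> homogeneous (\<Sum>i\<in>I. d i) (\<Prod>i\<in>I. f i)"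
  by (induction I rule: infinite_finite_induct) (simp_all add: homogeneous_mult)

lemma subspace_forms: "mp.subspace (forms m)"
  by (simp add: mp.subspace_def forms_def homogeneous_add homogeneous_scale)

lemma lookup_hcomp:
  "Poly_Mapping.lookup (hcomp d f) t = (if deg t = d then Poly_Mapping.lookup f t else 0)"
  by (auto simp: hcomp_def lookup_sum lookup_single when_def sum.delta' in_keys_iff)

lemma hcomp_add: "hcomp d (f + g) = hcomp d f + hcomp d g"
  by (rule poly_mapping_eqI) (simp add: lookup_hcomp lookup_add)

lemma homogeneous_hcomp [simp]: "homogeneous d (hcomp d f)"
  by (auto simp: homogeneous_def in_keys_iff lookup_hcomp split: if_splits)

lemma hcomp_homogeneous: "homogeneous e f \<Longrightarrow> hcomp d f = (if d = e then f else 0)"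
  by (rule poly_mapping_eqI) (auto simp: lookup_hcomp homogeneous_def in_keys_iff)

text \<open>\<open>T\<close> may be infinite: for a set \<open>N\<close> of exponents closed under
  multiplication, \<open>vs N\<close> is the monomial ideal itself, so one notation serves graded
  pieces and ideals.\<close>

lemma vs_eq: "vs T = {f. Poly_Mapping.keys f \<subseteq> T}"
proof
  have "mp.subspace {f :: ('a, 'b) mpol. Poly_Mapping.keys f \<subseteq> T}"
    by (simp add: mp.subspace_def subset_iff in_keys_iff lookup_scale lookup_add) (metis add_0)
  then show "vs T \<subseteq> {f :: ('a, 'b) mpol. Poly_Mapping.keys f \<subseteq> T}"
    unfolding vs_def by (intro mp.span_minimal) (auto simp: keys_monomial)
  show "{f :: ('a, 'b) mpol. Poly_Mapping.keys f \<subseteq> T} \<subseteq> vs T"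
  proof
    fix f :: "('a, 'b) mpol" assume f: "f \<in> {f. Poly_Mapping.keys f \<subseteq> T}"
    have "f = (\<Sum>t\<in>Poly_Mapping.keys f. scale (Poly_Mapping.lookup f t) (monomial t))"
      by (subst mpol_eq_sum_single)
         (simp add: scale_def const_def monomial_def mult_single)
    also have "\<dots> \<in> mp.span (monomial ` T)"
      using f by (intro mp.span_sum mp.span_scale mp.span_base) auto
    finally show "f \<in> vs T" by (simp add: vs_def)
  qed
qed

lemma forms_eq_zeroI:
  assumes "w \<in> forms m" "\<And>t. t \<in> terms m \<Longrightarrow> Poly_Mapping.lookup w t = 0"
  shows "w = 0"
proof (rule poly_mapping_eqI)
  fix t
  show "Poly_Mapping.lookup w t = Poly_Mapping.lookup 0 t"
    using assms by (cases "deg t = m") (auto simp: forms_def homogeneous_def terms_def in_keys_iff)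
qed

section \<open>Term orders and leading terms\<close>

locale term_ord =
  fixes tle :: "'v::{finite,linorder} trm \<Rightarrow> 'v trm \<Rightarrow> bool"
  assumes term_order: "term_order tle"
begin

sublocale ord: linorder tle "\<lambda>s t. tle s t \<and> s \<noteq> t"
  using term_order by (simp add: term_order_def)

lemma tle_add_right: "tle s t \<Longrightarrow> tle (s + u) (t + u)"
  using term_order by (simp add: term_order_def)

lemma tle_add_left: "tle s t \<Longrightarrow> tle (u + s) (u + t)"
  using tle_add_right[of s t u] by (simp add: add.commute)

lemma tle_add: "tle s t \<Longrightarrow> tle s' t' \<Longrightarrow> tle (s + s') (t + t')"
  using tle_add_right tle_add_left ord.order_trans by blast

lemma tle_var: "i \<le> j \<Longrightarrow> tle (Poly_Mapping.single i 1) (Poly_Mapping.single j 1)"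
  using term_order by (cases "i = j") (auto simp: term_order_def)

lemma tle_add_eqD:
  assumes "tle s t" "tle s' t'" "s + s' = t + t'"
  shows "s = t" "s' = t'"
proof -
  have "tle (s + s') (t + s')" "tle (t + s') (t + t')"
    by (rule tle_add_right[OF assms(1)], rule tle_add_left[OF assms(2)])
  then have "s + s' = t + s'" using assms(3) ord.order.antisym by metis
  then show "s = t" by simp
  then show "s' = t'" using assms(3) by simp
qed

lemma tle_sum:
  assumes "\<And>i. i \<in> I \<Longrightarrow> tle (f i) (g i)"
  shows "tle (\<Sum>i\<in>I. f i) (\<Sum>i\<in>I. g i)"
  using assms by (induction I rule: infinite_finite_induct) (simp_all add: tle_add)

text \<open>Both the summand \<open>i\<close> and the rest satisfy an inequality, and the two add up
  to an equality, so neither is strict. This later isolates one torus weight.\<close>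

lemma tle_sum_eqD:
  assumes "finite I" "\<And>i. i \<in> I \<Longrightarrow> tle (f i) (g i)" "(\<Sum>i\<in>I. f i) = (\<Sum>i\<in>I. g i)" "i \<in> I"
  shows "f i = g i"
proof (rule tle_add_eqD(1))
  show "tle (f i) (g i)" using assms by simp
  show "tle (\<Sum>j\<in>I - {i}. f j) (\<Sum>j\<in>I - {i}. g j)" using assms by (intro tle_sum) simp
  show "f i + (\<Sum>j\<in>I - {i}. f j) = g i + (\<Sum>j\<in>I - {i}. g j)"
    using assms(3) by (simp only: sum.remove[OF assms(1,4)])
qed

text \<open>A numerical stand-in for \<open>tle\<close> inside one degree, as the elimination lemma
  orders coordinates by natural numbers. Only terms of the same degree are counted, because
  infinitely many terms can lie below \<open>t\<close>, for instance in a lexicographic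
  order.\<close>

definition rank :: "'v trm \<Rightarrow> nat" where
  "rank t = card {s \<in> terms (deg t). tle s t \<and> s \<noteq> t}"

lemma rank_less:
  assumes "deg s = deg t" "tle s t" "s \<noteq> t"
  shows "rank s < rank t"
  unfolding rank_def
proof (rule psubset_card_mono)
  have "s \<in> {u \<in> terms (deg t). tle u t \<and> u \<noteq> t}"
    using assms by (simp add: terms_def)
  moreover have "{u \<in> terms (deg s). tle u s \<and> u \<noteq> s} \<subseteq> {u \<in> terms (deg t). tle u t \<and> u \<noteq> t}"
    using assms ord.order_trans[of _ s t] ord.order.antisym[of s t] by (simp add: subset_iff) blast
  ultimately show "{u \<in> terms (deg s). tle u s \<and> u \<noteq> s} \<subset> {u \<in> terms (deg t). tle u t \<and> u \<noteq> t}"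
    by (intro psubsetI) auto
qed simp

lemma rank_less_iff: "deg s = deg t \<Longrightarrow> rank s < rank t \<longleftrightarrow> tle s t \<and> s \<noteq> t"
  using rank_less[of s t] rank_less[of t s] ord.linear[of s t] by force

lemma rank_le_iff: "deg s = deg t \<Longrightarrow> rank s \<le> rank t \<longleftrightarrow> tle s t"
  using rank_less_iff[of t s] ord.linear[of s t] ord.order.antisym[of s t] by (auto simp: not_less[symmetric])

lemma inj_on_rank: "inj_on rank (terms m)"
  by (rule inj_onI) (metis (mono_tags, lifting) mem_Collect_eq ord.order.antisym order_refl rank_le_iff terms_def)

definition leading :: "('v, 'a::comm_ring_1) mpol set \<Rightarrow> 'v trm set" where
  "leading W = {t. \<exists>f\<in>W. t \<in> Poly_Mapping.keys f \<and> (\<forall>s\<in>Poly_Mapping.keys f. tle s t)}"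

lemma leading_subset_terms: "W \<subseteq> forms m \<Longrightarrow> leading W \<subseteq> terms m"
  by (auto simp: leading_def forms_def homogeneous_def terms_def)

lemma leading_alt:
  assumes "W \<subseteq> forms m"
  shows "leading W = {t \<in> terms m. \<exists>w\<in>W. Poly_Mapping.lookup w t \<noteq> 0 \<and>
           (\<forall>s\<in>terms m. rank t < rank s \<longrightarrow> Poly_Mapping.lookup w s = 0)}"
proof -
  have *: "(\<forall>s\<in>Poly_Mapping.keys w. tle s t) \<longleftrightarrow>
        (\<forall>s\<in>terms m. rank t < rank s \<longrightarrow> Poly_Mapping.lookup w s = 0)"
    if "w \<in> W" "t \<in> terms m" for w t
  proof -
    have "Poly_Mapping.keys w \<subseteq> terms m"
      using that assms by (auto simp: forms_def homogeneous_def terms_def)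
    moreover have "tle s t \<longleftrightarrow> \<not> rank t < rank s" if "s \<in> terms m" for s
      using rank_le_iff[of s t] that \<open>t \<in> terms m\<close> by (auto simp: terms_def)
    ultimately show ?thesis by (meson in_keys_iff subsetD)
  qed
  have "(\<exists>w\<in>W. t \<in> Poly_Mapping.keys w \<and> (\<forall>s\<in>Poly_Mapping.keys w. tle s t)) \<longleftrightarrow>
      (\<exists>w\<in>W. Poly_Mapping.lookup w t \<noteq> 0 \<and>
           (\<forall>s\<in>terms m. rank t < rank s \<longrightarrow> Poly_Mapping.lookup w s = 0))"
    if "t \<in> terms m" for t
    using that by (intro bex_cong refl) (simp add: in_keys_iff *)
  then show ?thesis
    using leading_subset_terms[OF assms] unfolding leading_def by blast
qed

lemma dim_eq_card_leading:
  fixes W :: "('v, 'a::field) mpol set"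
  assumes W: "mp.subspace W" "W \<subseteq> forms m"
  shows "mp.dim W = card (leading W)"
  unfolding leading_alt[OF W(2)]
proof (rule mp.dim_eq_card_leading)
  show "w = 0" if "w \<in> W" "\<And>t. t \<in> terms m \<Longrightarrow> Poly_Mapping.lookup w t = 0" for w
    using forms_eq_zeroI that W(2) by blast
qed (simp_all add: inj_on_rank lookup_add lookup_scale W(1))

lemma leading_basis:
  fixes W :: "('v, 'a::field) mpol set"
  assumes W: "mp.subspace W" "W \<subseteq> forms m"
    and e: "\<And>t. t \<in> leading W \<Longrightarrow> e t \<in> W \<and> t \<in> Poly_Mapping.keys (e t) \<and> (\<forall>s\<in>Poly_Mapping.keys (e t). tle s t)"
  shows "mp.span (e ` leading W) = W"
proof (rule mp.triangular_family_basis(3)[where D = "terms m" and rk = rank and coord = Poly_Mapping.lookup])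
  show "w = 0" if "w \<in> W" "\<And>t. t \<in> terms m \<Longrightarrow> Poly_Mapping.lookup w t = 0" for w
    using forms_eq_zeroI that W(2) by blast
  show "leading W = {t \<in> terms m. \<exists>w\<in>W. Poly_Mapping.lookup w t \<noteq> 0 \<and>
           (\<forall>s\<in>terms m. rank t < rank s \<longrightarrow> Poly_Mapping.lookup w s = 0)}"
    by (rule leading_alt[OF W(2)])
  show "Poly_Mapping.lookup (e t) s = 0" if "t \<in> leading W" "s \<in> terms m" "rank t < rank s" for t s
  proof (rule ccontr)
    assume "Poly_Mapping.lookup (e t) s \<noteq> 0"
    then have "tle s t" using e[OF that(1)] by (simp add: in_keys_iff)
    moreover have "deg s = deg t" using that leading_subset_terms[OF W(2)] by (auto simp: terms_def)
    ultimately show False using rank_le_iff[of s t] that(3) by simp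
  qed
qed (use e in \<open>simp_all add: inj_on_rank lookup_add lookup_scale W(1) in_keys_iff\<close>)

lemma leading_vs: "leading (vs T :: ('v, 'a::field) mpol set) = T"
proof
  show "leading (vs T :: ('v, 'a) mpol set) \<subseteq> T" by (auto simp: leading_def vs_eq)
  show "T \<subseteq> leading (vs T :: ('v, 'a) mpol set)"
    by (auto simp: leading_def vs_eq keys_monomial intro!: exI[of _ "monomial _"])
qed

lemma forms_eq_vs: "forms m = vs (terms m)"
  by (auto simp: forms_def vs_eq homogeneous_def terms_def)

lemma subspace_vs: "mp.subspace (vs T)"
  by (simp add: vs_def)

lemma dim_vs:
  assumes "T \<subseteq> terms m"
  shows "mp.dim (vs T :: ('v, 'a::field) mpol set) = card T"
proof -
  have "vs T \<subseteq> (forms m :: ('v, 'a) mpol set)" using assms by (auto simp: forms_eq_vs vs_eq)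
  from dim_eq_card_leading[OF subspace_vs this] show ?thesis by (simp only: leading_vs)
qed

lemma dim_forms:
  "CARD('v) = n + 1 \<Longrightarrow> mp.dim (forms m :: ('v, 'a::field) mpol set) = (n + m) choose n"
  unfolding forms_eq_vs dim_vs[OF order_refl] by (rule card_terms)

end

section \<open>Monomial ideals and their saturation\<close>

text \<open>Let \<open>B\<close> serve for the coordinates in \<open>A\<close>, and let
  \<open>k\<close> bound its \<open>x\<close>-exponents. Terms with \<open>x\<close>-exponent at
  least \<open>k\<close> are dominated by \<open>B\<close> in \<open>x\<close> as well. The others
  lie in the finitely many slices \<open>N' j\<close> with \<open>j < k\<close>, each of which has
  its own finite set, and inside a slice the \<open>x\<close>-exponents agree.\<close>

lemma dickson_coordinates:
  fixes N :: "('v \<Rightarrow>\<^sub>0 nat) set"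
  assumes "finite A"
  shows "\<exists>B\<subseteq>N. finite B \<and> (\<forall>t\<in>N. \<exists>s\<in>B. \<forall>i\<in>A. Poly_Mapping.lookup s i \<le> Poly_Mapping.lookup t i)"
  using assms
proof (induction A arbitrary: N rule: finite_induct)
  case empty
  show ?case
  proof (cases "N = {}")
    case False
    then obtain s where "s \<in> N" by auto
    then show ?thesis by (intro exI[of _ "{s}"]) auto
  qed auto
next
  case (insert x A)
  obtain B where B: "B \<subseteq> N" "finite B"
    "\<forall>t\<in>N. \<exists>s\<in>B. \<forall>i\<in>A. Poly_Mapping.lookup s i \<le> Poly_Mapping.lookup t i"
    using insert.IH[of N] by auto
  define N' where "N' j = {t\<in>N. Poly_Mapping.lookup t x = j}" for j
  have "\<forall>j. \<exists>C. C \<subseteq> N' j \<and> finite C \<and>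
      (\<forall>t\<in>N' j. \<exists>s\<in>C. \<forall>i\<in>A. Poly_Mapping.lookup s i \<le> Poly_Mapping.lookup t i)"
    using insert.IH by blast
  from choice[OF this] obtain C where "\<forall>j. C j \<subseteq> N' j \<and> finite (C j) \<and>
      (\<forall>t\<in>N' j. \<exists>s\<in>C j. \<forall>i\<in>A. Poly_Mapping.lookup s i \<le> Poly_Mapping.lookup t i)" ..
  then have C: "C j \<subseteq> N' j" "finite (C j)"
    "\<forall>t\<in>N' j. \<exists>s\<in>C j. \<forall>i\<in>A. Poly_Mapping.lookup s i \<le> Poly_Mapping.lookup t i" for j
    by blast+
  define k where "k = Max (insert 0 ((\<lambda>s. Poly_Mapping.lookup s x) ` B))"
  have k: "Poly_Mapping.lookup s x \<le> k" if "s \<in> B" for s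
    unfolding k_def using B(2) that by (intro Max_ge) auto
  show ?case
  proof (intro exI[of _ "B \<union> (\<Union>j<k. C j)"] conjI ballI)
    show "B \<union> (\<Union>j<k. C j) \<subseteq> N" using B(1) C(1) by (auto simp: N'_def)
    show "finite (B \<union> (\<Union>j<k. C j))" using B(2) C(2) by blast
  next
    fix t assume t: "t \<in> N"
    show "\<exists>s\<in>B \<union> (\<Union>j<k. C j). \<forall>i\<in>insert x A. Poly_Mapping.lookup s i \<le> Poly_Mapping.lookup t i"
    proof (cases "k \<le> Poly_Mapping.lookup t x")
      case True
      obtain s where s: "s \<in> B" "\<forall>i\<in>A. Poly_Mapping.lookup s i \<le> Poly_Mapping.lookup t i"
        using B(3) t by blast
      have "\<forall>i\<in>insert x A. Poly_Mapping.lookup s i \<le> Poly_Mapping.lookup t i"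
        using s(2) k[OF s(1)] True by auto
      then show ?thesis using s(1) by blast
    next
      case False
      have "t \<in> N' (Poly_Mapping.lookup t x)" using t by (simp add: N'_def)
      then obtain s where s: "s \<in> C (Poly_Mapping.lookup t x)"
        "\<forall>i\<in>A. Poly_Mapping.lookup s i \<le> Poly_Mapping.lookup t i"
        using C(3) by blast
      have "Poly_Mapping.lookup s x = Poly_Mapping.lookup t x" using C(1) s(1) by (auto simp: N'_def)
      then have "\<forall>i\<in>insert x A. Poly_Mapping.lookup s i \<le> Poly_Mapping.lookup t i" using s(2) by simp
      moreover have "s \<in> (\<Union>j<k. C j)" using s(1) False by auto
      ultimately show ?thesis by blast
    qed
  qed
qed

lemma dickson:
  fixes N :: "'v::finite trm set"
  obtains B where "B \<subseteq> N" "finite B" "\<And>t. t \<in> N \<Longrightarrow> \<exists>s\<in>B. \<exists>u. t = s + u"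
proof -
  obtain B where B: "B \<subseteq> N" "finite B"
    "\<forall>t\<in>N. \<exists>s\<in>B. \<forall>i\<in>UNIV. Poly_Mapping.lookup s i \<le> Poly_Mapping.lookup t i"
    using dickson_coordinates[of "UNIV :: 'v set" N] by auto
  have "t = s + (t - s)" if "\<forall>i. Poly_Mapping.lookup s i \<le> Poly_Mapping.lookup t i" for s t :: "'v trm"
    using that by (intro poly_mapping_eqI) (simp add: lookup_add lookup_minus)
  then show ?thesis using B that by (metis UNIV_I)
qed

lemma trm_split_deg:
  fixes u :: "'v::finite trm"
  assumes "k \<le> deg u"
  obtains v w where "u = v + w" "deg v = k"
  using assms
proof (induction k arbitrary: thesis)
  case 0
  show ?case using "0.prems"(1)[of 0 u] by simp
next
  case (Suc k)
  obtain v w where vw: "u = v + w" "deg v = k"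
    using Suc.IH[OF _ Suc_leD[OF Suc.prems(2)]] by blast
  have "deg w > 0" using vw Suc.prems(2) by (simp add: deg_add)
  then have "\<exists>i. Poly_Mapping.lookup w i \<noteq> 0" by (auto simp: deg_eq_sum intro: ccontr)
  then obtain i where i: "Poly_Mapping.lookup w i > 0" by auto
  define e where "e = (Poly_Mapping.single i 1 :: 'v trm)"
  have "w = e + (w - e)"
    using i by (intro poly_mapping_eqI) (auto simp: e_def lookup_add lookup_minus lookup_single when_def)
  then have "u = (v + e) + (w - e)" using vw by (simp add: add.assoc)
  moreover have "deg (v + e) = Suc k" using vw by (simp add: deg_add e_def)
  ultimately show ?case using Suc.prems(1) by blast
qed

section \<open>Saturation of monomial ideals\<close>

text \<open>The exponent set of a monomial ideal. Kept apart from any coefficients, it can be turned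
  into an ideal over whichever field is at hand.\<close>

definition term_ideal :: "'v trm set \<Rightarrow> bool" where
  "term_ideal N \<longleftrightarrow> (\<forall>s\<in>N. \<forall>u. s + u \<in> N)"

definition saturation :: "'v trm set \<Rightarrow> 'v trm set" where
  "saturation N = {s. \<exists>k. \<forall>u. deg u = k \<longrightarrow> s + u \<in> N}"

lemma term_ideal_addD:
  fixes s :: "'v::finite trm"
  assumes "term_ideal N" "\<And>u. deg u = k \<Longrightarrow> s + u \<in> N" "k \<le> deg u"
  shows "s + u \<in> N"
proof -
  obtain v w where vw: "u = v + w" "deg v = k" using trm_split_deg[OF assms(3)] .
  have "(s + v) + w \<in> N" using assms(1,2) vw(2) by (simp add: term_ideal_def)
  then show ?thesis by (simp add: vw(1) add.assoc)
qed

lemma subset_saturation: "term_ideal N \<Longrightarrow> N \<subseteq> saturation N"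
  by (auto simp: term_ideal_def saturation_def)

lemma term_ideal_saturation: "term_ideal N \<Longrightarrow> term_ideal (saturation N)"
  by (auto simp: term_ideal_def saturation_def) (metis add.assoc add.commute)

text \<open>Only finitely many terms \<open>u\<close> have degree \<open>k\<close>. If
  \<open>l u\<close> is the degree that moves \<open>s + u\<close> into \<open>N\<close> and
  \<open>M\<close> is the largest of these numbers, degree \<open>k + M\<close> moves
  \<open>s\<close> into \<open>N\<close>.\<close>

lemma saturation_saturation:
  fixes N :: "'v::finite trm set"
  assumes N: "term_ideal N"
  shows "saturation (saturation N) \<subseteq> saturation N"
proof
  fix s assume "s \<in> saturation (saturation N)"
  then obtain k where k: "\<And>u. deg u = k \<Longrightarrow> s + u \<in> saturation N" by (auto simp: saturation_def)
  then have "\<forall>u\<in>terms k. \<exists>l. \<forall>v. deg v = l \<longrightarrow> s + u + v \<in> N"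
    by (auto simp: terms_def saturation_def)
  then obtain l where l: "\<And>u v. u \<in> terms k \<Longrightarrow> deg v = l u \<Longrightarrow> s + u + v \<in> N" by metis
  define M where "M = Max (l ` (terms k :: 'v trm set))"
  have "s + w \<in> N" if w: "deg w = k + M" for w
  proof -
    obtain u v where uv: "w = u + v" "deg u = k" using trm_split_deg[of k w] w by auto
    have u: "u \<in> terms k" using uv by (simp add: terms_def)
    then have "l u \<le> M" unfolding M_def by (intro Max_ge) auto
    then have "l u \<le> deg v" using w uv by (simp add: deg_add)
    with N l[OF u] have "s + u + v \<in> N" by (rule term_ideal_addD)
    then show ?thesis by (simp add: uv(1) add.assoc)
  qed
  then show "s \<in> saturation N" by (auto simp: saturation_def)
qed

text \<open>By Dickson's lemma the saturation has finitely many generators, and each enters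
  \<open>N\<close> after multiplication by all terms of some degree \<open>k s\<close>. From the
  largest \<open>deg s + k s\<close> on, nothing is added, so saturating keeps the Hilbert
  polynomial.\<close>

lemma saturation_eventually:
  fixes N :: "'v::finite trm set"
  assumes N: "term_ideal N"
  shows "\<forall>\<^sub>F d in sequentially. saturation N \<inter> terms d = N \<inter> terms d"
proof -
  obtain B where B: "B \<subseteq> saturation N" "finite B" "\<And>t. t \<in> saturation N \<Longrightarrow> \<exists>s\<in>B. \<exists>u. t = s + u"
    using dickson[of "saturation N"] by metis
  have "\<forall>s\<in>B. \<exists>k. \<forall>u. deg u = k \<longrightarrow> s + u \<in> N" using B(1) by (auto simp: saturation_def)
  then obtain k where k: "\<And>s u. s \<in> B \<Longrightarrow> deg u = k s \<Longrightarrow> s + u \<in> N" by metis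
  define D where "D = Max (insert 0 ((\<lambda>s. deg s + k s) ` B))"
  have "t \<in> N" if t: "t \<in> saturation N" "D \<le> deg t" for t
  proof -
    obtain s u where su: "s \<in> B" "t = s + u" using B(3) t by blast
    have "deg s + k s \<le> D" unfolding D_def using B(2) su by (intro Max_ge) auto
    then have "k s \<le> deg u" using t su by (simp add: deg_add)
    with N k[OF su(1)] show ?thesis unfolding su(2) by (rule term_ideal_addD)
  qed
  then show ?thesis unfolding eventually_sequentially
    using subset_saturation[OF N] by (intro exI[of _ D]) (auto simp: terms_def)
qed

lemma module_times: "Modules.module ((*) :: 'r::comm_ring_1 \<Rightarrow> 'r \<Rightarrow> 'r)"
  by unfold_locales (simp_all add: algebra_simps)

lemma homogeneous_ideal_iff:
  "homogeneous_ideal I \<longleftrightarrow> 0 \<in> I \<and> (\<forall>f\<in>I. \<forall>g\<in>I. f + g \<in> I) \<and> (\<forall>c. \<forall>f\<in>I. c * f \<in> I) \<and>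
     (\<forall>f\<in>I. \<forall>d. hcomp d f \<in> I)"
  by (auto simp: homogeneous_ideal_def module.subspace_def[OF module_times])

lemma subspace_homogeneous_ideal: "homogeneous_ideal I \<Longrightarrow> mp.subspace I"
  by (simp add: homogeneous_ideal_iff mp.subspace_def scale_def)

lemma subspace_homogeneous_ideal_forms: "homogeneous_ideal I \<Longrightarrow> mp.subspace (I \<inter> forms d)"
  by (intro mp.subspace_inter subspace_homogeneous_ideal subspace_forms)

lemma homogeneous_ideal_vs:
  fixes N :: "'v::finite trm set"
  assumes "term_ideal N"
  shows "homogeneous_ideal (vs N :: ('v, 'a::field) mpol set)"
  unfolding homogeneous_ideal_iff
proof (intro conjI ballI allI)
  fix f g :: "('v, 'a) mpol" and c d
  assume f: "f \<in> vs N"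
  show "hcomp d f \<in> vs N" using f by (auto simp: vs_eq in_keys_iff lookup_hcomp split: if_splits)
  show "c * f \<in> vs N" using f keys_mult[of c f] assms
    by (fastforce simp: vs_eq term_ideal_def add.commute)
  show "f + g \<in> vs N" if "g \<in> vs N" using f that keys_add[of f g] by (auto simp: vs_eq)
qed (simp add: vs_eq)

text \<open>Terms \<open>u\<close> are sufficient as multipliers: they shift the support of
  \<open>f\<close> without cancellation, so each term of \<open>f\<close> is tested
  separately.\<close>

lemma saturated_vs:
  fixes N :: "'v::finite trm set"
  assumes "saturation N \<subseteq> N"
  shows "saturated (vs N :: ('v, 'a::field) mpol set)"
  unfolding saturated_def
proof (intro allI impI)
  fix f :: "('v, 'a) mpol" and k
  assume f: "\<forall>g\<in>forms k. g * f \<in> vs N"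
  have "t \<in> saturation N" if t: "t \<in> Poly_Mapping.keys f" for t
  proof -
    have "t + u \<in> N" if "deg u = k" for u
    proof -
      have "monomial u * f \<in> vs N" using f that by (auto simp: forms_def homogeneous_monomial)
      then show ?thesis using t by (auto simp: vs_eq keys_monomial_times add.commute)
    qed
    then show ?thesis by (auto simp: saturation_def)
  qed
  then show "f \<in> vs N" using assms by (auto simp: vs_eq)
qed

lemma vs_inter_forms: "vs N \<inter> forms d = vs (N \<inter> terms d)"
  by (auto simp: vs_eq forms_def homogeneous_def terms_def)

context term_ord
begin

text \<open>All conditions are on the exponent set \<open>N\<close>; the field occurs in the
  conclusion only.\<close>

lemma hilb_ideals_vs:
  assumes "term_ideal N" "saturation N \<subseteq> N"
    and "\<forall>\<^sub>F t in sequentially. of_nat (card (terms t :: 'v trm set)) - of_nat (card (N \<inter> terms t)) = poly p (of_nat t)"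
  shows "(vs N :: ('v, 'a::field) mpol set) \<in> hilb_ideals p"
  using assms unfolding hilb_ideals_def has_hilbert_polynomial_def
  by (simp add: homogeneous_ideal_vs saturated_vs vs_inter_forms dim_vs[OF Int_lower2] dim_vs[OF order_refl, folded forms_eq_vs])

section \<open>Initial ideals\<close>

text \<open>Taken degree by degree, so that the elimination lemma, which deals with finitely many
  terms, applies to each piece.\<close>

definition lead_terms :: "('v, 'a::comm_ring_1) mpol set \<Rightarrow> 'v trm set" where
  "lead_terms I = (\<Union>d. leading (I \<inter> forms d))"

lemma lead_terms_inter: "lead_terms I \<inter> terms d = leading (I \<inter> forms d)"
proof -
  have "leading (I \<inter> forms e) \<subseteq> terms e" for e by (rule leading_subset_terms) simp
  then show ?thesis by (fastforce simp: lead_terms_def terms_def)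
qed

lemma term_ideal_lead_terms:
  assumes "homogeneous_ideal I"
  shows "term_ideal (lead_terms I)"
  unfolding term_ideal_def
proof (intro ballI allI)
  fix s u assume "s \<in> lead_terms I"
  then obtain d f where f: "f \<in> I" "homogeneous d f" "s \<in> Poly_Mapping.keys f" "\<forall>t\<in>Poly_Mapping.keys f. tle t s"
    by (auto simp: lead_terms_def leading_def forms_def)
  let ?g = "monomial u * f"
  have "?g \<in> I" using assms f(1) by (simp add: homogeneous_ideal_iff)
  moreover have "homogeneous (deg u + d) ?g"
    using f(2) by (simp add: homogeneous_mult homogeneous_monomial)
  moreover have "s + u \<in> Poly_Mapping.keys ?g" using f(3) by (auto simp: keys_monomial_times add.commute)
  moreover have "\<forall>t\<in>Poly_Mapping.keys ?g. tle t (s + u)"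
    using f(4) by (auto simp: keys_monomial_times add.commute[of s] tle_add_left)
  ultimately have "s + u \<in> leading (I \<inter> forms (deg u + d))" by (auto simp: leading_def forms_def)
  then show "s + u \<in> lead_terms I" by (auto simp: lead_terms_def)
qed

text \<open>Macaulay's observation that an ideal and its initial ideal have the same Hilbert
  function.\<close>

lemma dim_ideal_forms:
  fixes I :: "('v, 'a::field) mpol set"
  shows "homogeneous_ideal I \<Longrightarrow> mp.dim (I \<inter> forms d) = card (lead_terms I \<inter> terms d)"
  unfolding lead_terms_inter by (rule dim_eq_card_leading[where m = d]) (simp_all add: subspace_homogeneous_ideal_forms)

text \<open>The field changes from \<open>'b\<close> to \<open>'a\<close>: passing to leading terms
  preserves the Hilbert function, passing to the saturation preserves it in large degrees, and what
  remains is a count of exponents.\<close>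

lemma hilb_ideals_saturation_lead_terms:
  fixes I :: "('v, 'b::field) mpol set"
  assumes I: "homogeneous_ideal I" "has_hilbert_polynomial I p"
  shows "(vs (saturation (lead_terms I)) :: ('v, 'a::field) mpol set) \<in> hilb_ideals p"
proof (rule hilb_ideals_vs)
  note ti = term_ideal_lead_terms[OF I(1)]
  show "term_ideal (saturation (lead_terms I))" by (rule term_ideal_saturation[OF ti])
  show "saturation (saturation (lead_terms I)) \<subseteq> saturation (lead_terms I)"
    by (rule saturation_saturation[OF ti])
  show "\<forall>\<^sub>F t in sequentially. of_nat (card (terms t :: 'v trm set))
          - of_nat (card (saturation (lead_terms I) \<inter> terms t)) = poly p (of_nat t)"
    using I(2)[unfolded has_hilbert_polynomial_def] saturation_eventually[OF ti]
    by eventually_elim (simp add: dim_ideal_forms[OF I(1)] dim_vs[OF order_refl, folded forms_eq_vs])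
qed

end

section \<open>Hilbert functions of regular ideals\<close>

definition fscale :: "'a \<Rightarrow> (nat \<Rightarrow> ('v, 'a::comm_ring_1) mpol) \<Rightarrow> nat \<Rightarrow> ('v, 'a) mpol" where
  "fscale c v = (\<lambda>j. scale c (v j))"

interpretation fm: vector_space "fscale :: 'a::field \<Rightarrow> (nat \<Rightarrow> ('v, 'a) mpol) \<Rightarrow> _"
  by unfold_locales (simp_all add: fscale_def fun_eq_iff mp.scale_right_distrib mp.scale_left_distrib)

interpretation fm_fm: vector_space_pair "fscale :: 'a::field \<Rightarrow> (nat \<Rightarrow> ('v, 'a) mpol) \<Rightarrow> _"
  "fscale :: 'a::field \<Rightarrow> (nat \<Rightarrow> ('v, 'a) mpol) \<Rightarrow> _"
  by unfold_locales

interpretation fm_mp: vector_space_pair "fscale :: 'a::field \<Rightarrow> (nat \<Rightarrow> ('v, 'a) mpol) \<Rightarrow> _"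
  "scale :: 'a::field \<Rightarrow> ('v, 'a) mpol \<Rightarrow> _"
  by unfold_locales

section \<open>Graded pieces of twisted free modules\<close>

text \<open>The degree \<open>t\<close> part in the twist \<open>S(-a)\<close>. The case distinction
  is needed because truncated subtraction would return the degree 0 part for
  \<open>t < a\<close>.\<close>

definition shifted_comp :: "nat \<Rightarrow> nat \<Rightarrow> ('v, 'a::comm_ring_1) mpol \<Rightarrow> ('v, 'a) mpol" where
  "shifted_comp t a f = (if a \<le> t then hcomp (t - a) f else 0)"

lemma lookup_shifted_comp:
  "Poly_Mapping.lookup (shifted_comp t a f) s = (if deg s + a = t then Poly_Mapping.lookup f s else 0)"
  by (auto simp: shifted_comp_def lookup_hcomp)

lemma keys_shifted_comp: "s \<in> Poly_Mapping.keys (shifted_comp t a f) \<Longrightarrow> deg s + a = t"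
  by (auto simp: in_keys_iff lookup_shifted_comp split: if_splits)

lemma shifted_comp_add: "shifted_comp t a (f + g) = shifted_comp t a f + shifted_comp t a g"
  by (rule poly_mapping_eqI) (simp add: lookup_shifted_comp lookup_add)

lemma shifted_comp_zero [simp]: "shifted_comp t a 0 = 0"
  by (rule poly_mapping_eqI) (simp add: lookup_shifted_comp)

lemma shifted_comp_sum: "shifted_comp t a (\<Sum>i\<in>I. f i) = (\<Sum>i\<in>I. shifted_comp t a (f i))"
  by (induction I rule: infinite_finite_induct) (simp_all add: shifted_comp_add)

lemma shifted_comp_id: "(\<And>s. s \<in> Poly_Mapping.keys f \<Longrightarrow> deg s + a = t) \<Longrightarrow> shifted_comp t a f = f"
  by (rule poly_mapping_eqI) (auto simp: lookup_shifted_comp in_keys_iff)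

lemma shifted_comp_eq_0: "(\<And>s. s \<in> Poly_Mapping.keys f \<Longrightarrow> deg s + a \<noteq> t) \<Longrightarrow> shifted_comp t a f = 0"
  by (rule poly_mapping_eqI) (auto simp: lookup_shifted_comp in_keys_iff)

text \<open>Multiplication by a homogeneous \<open>f\<close> of degree \<open>a' - a\<close> maps
  \<open>S(-a')\<close> to \<open>S(-a)\<close> in a degree-preserving way. The degree condition is
  additive, so that for \<open>a' < a\<close> it forces \<open>f = 0\<close>.\<close>

lemma shifted_comp_mult:
  fixes f g :: "('v::finite, 'a::comm_ring_1) mpol"
  assumes f: "\<And>u. u \<in> Poly_Mapping.keys f \<Longrightarrow> deg u + a = a'"
  shows "shifted_comp t a (f * g) = f * shifted_comp t a' g"
proof (induction g rule: mpol_induct)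
  case (add g h)
  then show ?case by (simp add: distrib_left shifted_comp_add)
next
  case (single s c)
  have *: "deg v + a = deg s + a'" if v: "v \<in> Poly_Mapping.keys (f * Poly_Mapping.single s c)" for v
  proof -
    obtain u where "u \<in> Poly_Mapping.keys f" "v = u + s"
      using v keys_mult[of f "Poly_Mapping.single s c"] by (auto split: if_splits)
    then show ?thesis using f[of u] by (simp add: deg_add)
  qed
  show ?case
  proof (cases "deg s + a' = t")
    case True
    have "shifted_comp t a (f * Poly_Mapping.single s c) = f * Poly_Mapping.single s c"
      by (rule shifted_comp_id) (use * True in simp)
    moreover have "shifted_comp t a' (Poly_Mapping.single s c) = Poly_Mapping.single s c"
      by (rule shifted_comp_id) (use True in \<open>auto split: if_splits\<close>)
    ultimately show ?thesis by simp
  next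
    case False
    have "shifted_comp t a (f * Poly_Mapping.single s c) = 0"
      by (rule shifted_comp_eq_0) (use * False in simp)
    moreover have "shifted_comp t a' (Poly_Mapping.single s c) = 0"
      by (rule shifted_comp_eq_0) (use False in \<open>auto split: if_splits\<close>)
    ultimately show ?thesis by simp
  qed
qed

text \<open>The degree \<open>t\<close> piece of the sum of the modules \<open>S(-d j)\<close>,
  \<open>j < b\<close>; \<open>free_comp\<close> is the projection onto it.\<close>

definition graded_free :: "nat \<Rightarrow> nat \<Rightarrow> (nat \<Rightarrow> nat) \<Rightarrow> (nat \<Rightarrow> ('v, 'a::comm_ring_1) mpol) set" where
  "graded_free t b d = {v \<in> free_mod b. \<forall>j<b. \<forall>s\<in>Poly_Mapping.keys (v j). deg s + d j = t}"

definition free_comp :: "nat \<Rightarrow> (nat \<Rightarrow> nat) \<Rightarrow> (nat \<Rightarrow> ('v, 'a::comm_ring_1) mpol) \<Rightarrow> nat \<Rightarrow> ('v, 'a) mpol" where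
  "free_comp t d v = (\<lambda>j. shifted_comp t (d j) (v j))"

lemma free_comp_in_graded_free: "v \<in> free_mod b \<Longrightarrow> free_comp t d v \<in> graded_free t b d"
  by (auto simp: graded_free_def free_comp_def free_mod_def keys_shifted_comp)

lemma free_comp_graded_free: "v \<in> graded_free t b d \<Longrightarrow> free_comp t d v = v"
proof (rule ext)
  fix j
  assume v: "v \<in> graded_free t b d"
  show "free_comp t d v j = v j"
  proof (cases "j < b")
    case True
    then show ?thesis using v unfolding free_comp_def by (intro shifted_comp_id) (auto simp: graded_free_def)
  next
    case False
    then show ?thesis using v by (simp add: free_comp_def graded_free_def free_mod_def)
  qed
qed

lemma subspace_graded_free: "fm.subspace (graded_free t b d :: (nat \<Rightarrow> ('v, 'a::field) mpol) set)"
proof -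
  have "deg s + d j = t" if "s \<in> Poly_Mapping.keys (v j + w j)"
    "\<And>s. s \<in> Poly_Mapping.keys (v j) \<Longrightarrow> deg s + d j = t"
    "\<And>s. s \<in> Poly_Mapping.keys (w j) \<Longrightarrow> deg s + d j = t" for v w :: "nat \<Rightarrow> ('v, 'a) mpol" and j s
    using that keys_add[of "v j" "w j"] by auto
  moreover have "s \<in> Poly_Mapping.keys f" if "s \<in> Poly_Mapping.keys (scale c f)" for s c and f :: "('v, 'a) mpol"
    using that by (auto simp: in_keys_iff lookup_scale)
  ultimately show ?thesis
    unfolding fm.subspace_def by (auto simp: graded_free_def free_mod_def fscale_def)
qed

lemma graded_free_dim:
  fixes d :: "nat \<Rightarrow> nat" and t b :: nat
  defines "V \<equiv> (graded_free t b d :: (nat \<Rightarrow> ('v::finite, 'a::field) mpol) set)"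
  shows "fm.dim V = (\<Sum>j<b. card {s :: 'v trm. deg s + d j = t})"
    and "\<exists>B. finite B \<and> V \<subseteq> fm.span B"
proof -
  let ?A = "\<lambda>j. {s :: 'v trm. deg s + d j = t}"
  have fin: "finite (?A j)" for j
    by (rule finite_subset[OF _ finite_terms[of "t - d j"]]) (auto simp: terms_def)
  define D where "D = (SIGMA j:{..<b}. ?A j)"
  have finD: "finite D" unfolding D_def using fin by auto
  \<comment> \<open>Any injective ranking will do: the unit vector at \<open>x\<close> has a single
    nonzero coordinate, so every position is a leading one.\<close>
  obtain rk :: "nat \<times> 'v trm \<Rightarrow> nat" where rk: "inj_on rk D"
    using finite_imp_inj_to_nat_seg[OF finD] by blast
  define coord :: "(nat \<Rightarrow> ('v, 'a) mpol) \<Rightarrow> nat \<times> 'v trm \<Rightarrow> 'a"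
    where "coord v x = Poly_Mapping.lookup (v (fst x)) (snd x)" for v x
  have add: "coord (v + w) x = coord v x + coord w x" for v w x by (simp add: coord_def lookup_add)
  have scl: "coord (fscale c v) x = c * coord v x" for c v x by (simp add: coord_def fscale_def lookup_scale)
  have sub: "fm.subspace V" unfolding V_def by (rule subspace_graded_free)
  have sep: "v = 0" if "v \<in> V" "\<And>x. x \<in> D \<Longrightarrow> coord v x = 0" for v
  proof
    fix j
    show "v j = 0 j"
    proof (cases "j < b")
      case True
      show ?thesis
      proof (rule poly_mapping_eqI)
        fix s
        show "Poly_Mapping.lookup (v j) s = Poly_Mapping.lookup (0 j) s"
        proof (cases "deg s + d j = t")
          case t: True
          then show ?thesis using that(2)[of "(j, s)"] True by (simp add: D_def coord_def)
        next
          case False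
          then have "s \<notin> Poly_Mapping.keys (v j)" using that(1) True by (auto simp: V_def graded_free_def)
          then show ?thesis by (simp add: in_keys_iff)
        qed
      qed
    next
      case False
      then show ?thesis using that(1) by (simp add: V_def graded_free_def free_mod_def)
    qed
  qed
  note leads = fm.dim_eq_card_leading[of D rk coord V, OF finD rk add scl sub sep]
  show "\<exists>B. finite B \<and> V \<subseteq> fm.span B" by (rule leads(2))
  have "\<exists>w\<in>V. coord w x \<noteq> 0 \<and> (\<forall>y\<in>D. rk x < rk y \<longrightarrow> coord w y = 0)" if x: "x \<in> D" for x
  proof -
    define w where "w = (\<lambda>k. if k = fst x then monomial (snd x) else (0 :: ('v, 'a) mpol))"
    have "w \<in> V" using x by (auto simp: w_def V_def D_def graded_free_def free_mod_def keys_monomial)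
    moreover have "coord w x \<noteq> 0" by (simp add: w_def coord_def lookup_monomial)
    moreover have "coord w y = 0" if "y \<noteq> x" for y
      using that by (auto simp: w_def coord_def lookup_monomial prod_eq_iff)
    ultimately show ?thesis by (metis less_irrefl)
  qed
  then have "{x \<in> D. \<exists>w\<in>V. coord w x \<noteq> 0 \<and> (\<forall>y\<in>D. rk x < rk y \<longrightarrow> coord w y = 0)} = D" by blast
  then have "fm.dim V = card D" using leads(1) by simp
  also have "\<dots> = (\<Sum>j<b. card (?A j))" unfolding D_def using fin by (simp add: card_SigmaI)
  finally show "fm.dim V = (\<Sum>j<b. card (?A j))" .
qed

lemma linear_mat_apply: "Vector_Spaces.linear fscale fscale (mat_apply r c M)"
  by unfold_locales
     (simp_all add: mat_apply_def fscale_def fun_eq_iff distrib_left sum.distrib scale_def sum_distrib_left mult.left_commute)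

lemma linear_sum_times: "Vector_Spaces.linear fscale scale (\<lambda>v. \<Sum>j<b. e j * v j)"
  by unfold_locales
     (simp_all add: fscale_def distrib_left sum.distrib scale_def sum_distrib_left mult.left_commute)

lemma free_comp_mat_apply:
  fixes M :: "nat \<Rightarrow> nat \<Rightarrow> ('v::finite, 'a::comm_ring_1) mpol"
  assumes "\<And>k j u. k < r \<Longrightarrow> j < c \<Longrightarrow> u \<in> Poly_Mapping.keys (M k j) \<Longrightarrow> deg u + d k = d' j"
  shows "free_comp t d (mat_apply r c M v) = mat_apply r c M (free_comp t d' v)"
  using assms by (auto simp: free_comp_def mat_apply_def fun_eq_iff shifted_comp_sum shifted_comp_mult intro!: sum.cong)

lemma hcomp_sum_times:
  fixes e :: "nat \<Rightarrow> ('v::finite, 'a::comm_ring_1) mpol"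
  assumes "\<And>j. j < b \<Longrightarrow> homogeneous (d j) (e j)"
  shows "hcomp t (\<Sum>j<b. e j * v j) = (\<Sum>j<b. e j * free_comp t d v j)"
proof -
  have "hcomp t f = shifted_comp t 0 f" for f :: "('v, 'a) mpol" by (simp add: shifted_comp_def)
  then show ?thesis using assms
    by (simp add: free_comp_def shifted_comp_sum) (intro sum.cong shifted_comp_mult; auto simp: homogeneous_def)
qed

section \<open>Hilbert functions from resolutions\<close>

text \<open>The polynomial is the binomial coefficient \<open>(t + n - d) choose n\<close>. It is
  correct from \<open>t = d - n\<close> on and not merely from \<open>t = d\<close>, since in
  between both the binomial and the number of terms are 0. These \<open>n\<close> additional degrees
  absorb the summand \<open>i\<close> in the bound \<open>d i j \<le> r + i\<close> on the
  twists.\<close>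

lemma ex_poly_card_shifted_terms:
  assumes "CARD('v::finite) = n + 1"
  shows "\<exists>P :: rat poly. \<forall>t. d \<le> t + n \<longrightarrow> poly P (of_nat t) = of_nat (card {s :: 'v trm. deg s + d = t})"
proof (intro exI allI impI)
  fix t assume d: "d \<le> t + n"
  let ?P = "Polynomial.smult (1 / fact n) (\<Prod>i = 0..<n. [:of_nat n - of_nat d - of_nat i, 1:]) :: rat poly"
  have "poly ?P (of_nat t) = (\<Prod>i = 0..<n. (of_nat (t + n - d) - of_nat i)) / fact n"
    using d by (simp add: poly_prod of_nat_diff algebra_simps)
  also have "\<dots> = of_nat ((t + n - d) choose n)"
    by (simp add: binomial_gbinomial gbinomial_prod_rev)
  also have "(t + n - d) choose n = card {s :: 'v trm. deg s + d = t}"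
  proof (cases "d \<le> t")
    case True
    then have "{s :: 'v trm. deg s + d = t} = terms (t - d)" by (auto simp: terms_def)
    then show ?thesis using True card_terms[OF assms, of "t - d"] by (simp add: add.commute)
  next
    case False
    then have "{s :: 'v trm. deg s + d = t} = {}" by auto
    then show ?thesis using False d by (simp add: binomial_eq_0)
  qed
  finally show "poly ?P (of_nat t) = of_nat (card {s :: 'v trm. deg s + d = t})" .
qed

text \<open>Here \<open>f i\<close> is the dimension of a free module of the resolution and
  \<open>k i\<close> that of a kernel. The recursion is solved for \<open>k i\<close> backwards from
  the end of the resolution, where everything vanishes.\<close>

lemma alternating_polynomial:
  fixes f k :: "nat \<Rightarrow> nat \<Rightarrow> nat"
  assumes rec: "\<And>i t. f (Suc i) t = k (Suc i) t + k i t"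
    and poly: "\<And>i. \<exists>P :: rat poly. \<forall>t\<ge>r. poly P (of_nat t) = of_nat (f i t)"
    and zero: "\<And>i t. N \<le> i \<Longrightarrow> f i t = 0"
  shows "\<exists>P :: rat poly. \<forall>t\<ge>r. poly P (of_nat t) = of_nat (k i t)"
proof (induction "N - i" arbitrary: i)
  case 0
  then have "k i t = 0" for t using rec[of i t] zero[of "Suc i" t] by simp
  then show ?case by (intro exI[of _ 0]) simp
next
  case (Suc x)
  have "x = N - Suc i" using Suc.hyps(2) by simp
  from Suc.hyps(1)[OF this] obtain P :: "rat poly"
    where P: "\<forall>t\<ge>r. poly P (of_nat t) = of_nat (k (Suc i) t)" by blast
  obtain Q :: "rat poly" where Q: "\<forall>t\<ge>r. poly Q (of_nat t) = of_nat (f (Suc i) t)" using poly by blast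
  show ?case using P Q rec by (intro exI[of _ "Q - P"]) simp
qed

text \<open>In degree \<open>t\<close> the resolution is an exact sequence of finite-dimensional
  spaces, so dimensions are additive along it; the bound on the twists makes each free module
  contribute a polynomial already from \<open>t = r\<close> on.\<close>

lemma regular_ideal_polynomial:
  fixes I :: "('v::finite, 'a::field) mpol set"
  assumes v: "CARD('v) = n + 1" and I: "homogeneous_ideal I" and reg: "regular r I"
  shows "\<exists>P :: rat poly. \<forall>t\<ge>r. poly P (of_nat t) = of_nat (mp.dim (I \<inter> forms t))"
proof -
  obtain b d e M where res: "minimal_graded_resolution I b d e M" and d: "\<And>i j. j < b i \<Longrightarrow> d i j \<le> r + i"
    using reg unfolding regular_def by metis
  note res' = res[unfolded minimal_graded_resolution_def]
  have e: "homogeneous (d 0 j) (e j)" if "j < b 0" for j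
    using conjunct1[OF res'] that by simp
  have M: "deg u + d i k = d (Suc i) j"
    if "k < b i" "j < b (Suc i)" "u \<in> Poly_Mapping.keys (M i k j)" for i k j u
    using conjunct1[OF conjunct2[OF res']] that by simp
  have b: "b i = 0" if "CARD('v) \<le> i" for i
    using conjunct1[OF conjunct2[OF conjunct2[OF res']]] that by simp
  have gen: "(\<lambda>v. \<Sum>j<b 0. e j * v j) ` free_mod (b 0) = I"
    and ex0: "{v \<in> free_mod (b 0). (\<Sum>j<b 0. e j * v j) = 0} = mat_apply (b 0) (b 1) (M 0) ` free_mod (b 1)"
    and exact_all: "\<forall>i. {v \<in> free_mod (b (Suc i)). mat_apply (b i) (b (Suc i)) (M i) v = (\<lambda>k. 0)} =
       mat_apply (b (Suc i)) (b (Suc (Suc i))) (M (Suc i)) ` free_mod (b (Suc (Suc i)))"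
    using conjunct2[OF conjunct2[OF conjunct2[OF res']]] by - (elim conjE; assumption)+
  note ex = exact_all[rule_format]
  define \<psi> where "\<psi> v = (\<Sum>j<b 0. e j * v j)" for v :: "nat \<Rightarrow> ('v, 'a) mpol"
  define A where "A i = mat_apply (b i) (b (Suc i)) (M i)" for i
  define F where "F i t = (graded_free t (b i) (d i) :: (nat \<Rightarrow> ('v, 'a) mpol) set)" for i t
  \<comment> \<open>\<open>Z i\<close> is the kernel of the map out of \<open>F i\<close>; the map
    out of \<open>F 0\<close> goes to the ideal, hence the case distinction.\<close>
  define Z where "Z i t = (case i of 0 \<Rightarrow> {v \<in> F 0 t. \<psi> v = 0} | Suc i' \<Rightarrow> {v \<in> F (Suc i') t. A i' v = 0})" for i t
  have F_free: "F i t \<subseteq> free_mod (b i)" for i t by (auto simp: F_def graded_free_def)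
  have compA: "free_comp t (d i) (A i v) = A i (free_comp t (d (Suc i)) v)" for i t v
    unfolding A_def by (rule free_comp_mat_apply) (rule M)
  have comp_F: "free_comp t (d i) v = v" if "v \<in> F i t" for v i t
    using that unfolding F_def by (rule free_comp_graded_free)
  have F_comp: "free_comp t (d i) v \<in> F i t" if "v \<in> free_mod (b i)" for v i t
    using that unfolding F_def by (rule free_comp_in_graded_free)
  have A_free: "A i v \<in> free_mod (b i)" for i v by (simp add: A_def mat_apply_def free_mod_def)
  \<comment> \<open>Exactness is given for whole modules, and a preimage of a homogeneous vector may
    be inhomogeneous. Its degree \<open>t\<close> part is again a preimage, because the maps commute
    with \<open>free_comp\<close>.\<close>
  have exact: "A i ` F (Suc i) t = Z i t" for i t
  proof -
    have ker: "v \<in> Z i t \<longleftrightarrow> v \<in> F i t \<and> v \<in> A i ` free_mod (b (Suc i))" for v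
    proof (cases i)
      case 0
      then show ?thesis using ex0 F_free[of 0 t] by (auto simp: Z_def A_def \<psi>_def)
    next
      case (Suc i')
      have "v \<in> free_mod (b i) \<and> A i' v = 0 \<longleftrightarrow> v \<in> A i ` free_mod (b (Suc i))"
        using ex[of i'] by (auto simp: A_def Suc zero_fun_def)
      then show ?thesis using Suc F_free[of i t] by (auto simp: Z_def)
    qed
    show ?thesis
    proof (intro Set.set_eqI iffI)
      fix v assume "v \<in> A i ` F (Suc i) t"
      then obtain w where w: "w \<in> F (Suc i) t" "v = A i w" by auto
      have "free_comp t (d i) v = v" using w comp_F[OF w(1)] compA by simp
      then have "v \<in> F i t" using F_comp[OF A_free] w(2) by metis
      then show "v \<in> Z i t" using ker w F_free by blast
    next
      fix v assume "v \<in> Z i t"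
      then obtain w where w: "v \<in> F i t" "w \<in> free_mod (b (Suc i))" "v = A i w" using ker by auto
      have "v = A i (free_comp t (d (Suc i)) w)" using comp_F[OF w(1)] w(3) compA by metis
      then show "v \<in> A i ` F (Suc i) t" using F_comp[OF w(2)] by blast
    qed
  qed
  have im0: "\<psi> ` F 0 t = I \<inter> forms t" for t
  proof (intro Set.set_eqI iffI)
    fix f assume "f \<in> \<psi> ` F 0 t"
    then obtain v where v: "v \<in> F 0 t" "f = \<psi> v" by auto
    have "hcomp t f = f" using hcomp_sum_times[OF e, where t = t and v = v] comp_F[OF v(1)] v(2) by (simp add: \<psi>_def)
    then have "f \<in> forms t" using homogeneous_hcomp[of t f] by (simp add: forms_def)
    moreover have "f \<in> I" using v F_free gen by (auto simp: \<psi>_def)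
    ultimately show "f \<in> I \<inter> forms t" by blast
  next
    fix f assume f: "f \<in> I \<inter> forms t"
    then obtain v where v: "v \<in> free_mod (b 0)" "f = \<psi> v" using gen by (auto simp: \<psi>_def)
    have "f = hcomp t f" using f hcomp_homogeneous[of t f t] by (simp add: forms_def)
    also have "\<dots> = \<psi> (free_comp t (d 0) v)"
      unfolding v(2) \<psi>_def by (rule hcomp_sum_times) (rule e)
    finally show "f \<in> \<psi> ` F 0 t" using F_comp[OF v(1)] by blast
  qed
  define f where "f i t = fm.dim (F i t)" for i t
  define k where "k i t = fm.dim (Z i t)" for i t
  have rec0: "f 0 t = k 0 t + mp.dim (I \<inter> forms t)" for t
  proof -
    obtain B where "finite B" "F 0 t \<subseteq> fm.span B" using graded_free_dim(2) unfolding F_def by blast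
    moreover have "fm.subspace (F 0 t)" unfolding F_def by (rule subspace_graded_free)
    moreover have "Vector_Spaces.linear fscale scale \<psi>" unfolding \<psi>_def by (rule linear_sum_times)
    ultimately show ?thesis
      using fm_mp.dim_eq_dim_kernel_plus_dim_image[of \<psi> "F 0 t" B] by (simp add: f_def k_def Z_def im0)
  qed
  have rec: "f (Suc i) t = k (Suc i) t + k i t" for i t
  proof -
    obtain B where "finite B" "F (Suc i) t \<subseteq> fm.span B" using graded_free_dim(2) unfolding F_def by blast
    moreover have "fm.subspace (F (Suc i) t)" unfolding F_def by (rule subspace_graded_free)
    moreover have "Vector_Spaces.linear fscale fscale (A i)" unfolding A_def by (rule linear_mat_apply)
    ultimately show ?thesis
      using fm_fm.dim_eq_dim_kernel_plus_dim_image[of "A i" "F (Suc i) t" B] exact[of i t]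
      by (simp add: f_def k_def) (simp add: Z_def)
  qed
  have f_eq: "f i t = (\<Sum>j<b i. card {s :: 'v trm. deg s + d i j = t})" for i t
    unfolding f_def F_def by (rule graded_free_dim(1))
  have f_poly: "\<exists>P :: rat poly. \<forall>t\<ge>r. poly P (of_nat t) = of_nat (f i t)" for i
  proof (cases "CARD('v) \<le> i")
    case True
    then show ?thesis using b by (intro exI[of _ 0]) (simp add: f_eq)
  next
    case False
    have "\<forall>j. \<exists>P :: rat poly. \<forall>t. d i j \<le> t + n \<longrightarrow> poly P (of_nat t) = of_nat (card {s :: 'v trm. deg s + d i j = t})"
      using ex_poly_card_shifted_terms[OF v] by blast
    then obtain P :: "nat \<Rightarrow> rat poly" where
      P: "\<And>j t. d i j \<le> t + n \<Longrightarrow> poly (P j) (of_nat t) = of_nat (card {s :: 'v trm. deg s + d i j = t})"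
      by metis
    \<comment> \<open>For \<open>i \<le> n\<close> the polynomial vanishes where \<open>t - d i j\<close> is negative, because \<open>t - d i j \<ge> - n\<close>.\<close>
    have "d i j \<le> t + n" if "r \<le> t" "j < b i" for j t using d[OF that(2)] that(1) False v by simp
    then show ?thesis using P by (intro exI[of _ "\<Sum>j<b i. P j"]) (auto simp: poly_sum f_eq intro!: sum.cong)
  qed
  obtain P :: "rat poly" where P: "\<forall>t\<ge>r. poly P (of_nat t) = of_nat (f 0 t)" using f_poly by blast
  have "\<exists>Q :: rat poly. \<forall>t\<ge>r. poly Q (of_nat t) = of_nat (k 0 t)"
    by (rule alternating_polynomial[where N = "CARD('v)" and f = f]) ((fact rec f_poly)+, simp add: f_eq b)
  then obtain Q :: "rat poly" where Q: "\<forall>t\<ge>r. poly Q (of_nat t) = of_nat (k 0 t)" by blast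
  show ?thesis using P Q rec0 by (intro exI[of _ "P - Q"]) simp
qed

lemma poly_eq_if_eventually_eq:
  fixes P Q :: "rat poly"
  assumes "\<forall>\<^sub>F t in sequentially. poly P (of_nat t) = poly Q (of_nat t)"
  shows "P = Q"
proof (rule ccontr)
  assume "P \<noteq> Q"
  then have "finite {x. poly (P - Q) x = 0}" by (intro poly_roots_finite) simp
  moreover obtain T where "\<And>t. T \<le> t \<Longrightarrow> poly P (of_nat t) = poly Q (of_nat t)"
    using assms by (auto simp: eventually_sequentially)
  then have "of_nat ` {T..} \<subseteq> {x. poly (P - Q) x = 0}" by auto
  ultimately have "finite (of_nat ` {T..} :: rat set)" by (rule finite_subset[rotated])
  then show False using infinite_Ici[of T] by (auto dest!: finite_imageD intro: inj_onI)
qed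

context term_ord
begin

text \<open>Regularity yields a polynomial valid from degree \<open>r\<close> on, whereas
  \<open>p\<close> is known to be valid in large degrees only. The two descriptions agree there,
  hence everywhere, and can be evaluated at \<open>m\<close>.\<close>

lemma dim_regular_ideal:
  fixes I :: "('v, 'a::field) mpol set"
  assumes v: "CARD('v) = n + 1" and I: "I \<in> hilb_ideals p" and reg: "regular r I" and "r \<le> m"
  shows "of_nat (mp.dim (I \<inter> forms m)) = of_nat ((n + m) choose n) - poly p (of_nat m)"
proof -
  have hI: "homogeneous_ideal I" "has_hilbert_polynomial I p" using I by (simp_all add: hilb_ideals_def)
  obtain P :: "rat poly" where P: "\<And>t. t \<ge> r \<Longrightarrow> poly P (of_nat t) = of_nat (mp.dim (I \<inter> forms t))"
    using regular_ideal_polynomial[OF v hI(1) reg] by blast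
  obtain Q :: "rat poly" where "\<forall>t. 0 \<le> t + n \<longrightarrow> poly Q (of_nat t) = of_nat (card {s :: 'v trm. deg s + 0 = t})"
    using ex_poly_card_shifted_terms[OF v] by blast
  then have Q: "poly Q (of_nat t) = of_nat ((n + t) choose n)" for t
    using card_terms[OF v, of t] by (simp add: terms_def)
  have "P = Q - p"
  proof (rule poly_eq_if_eventually_eq)
    show "\<forall>\<^sub>F t in sequentially. poly P (of_nat t) = poly (Q - p) (of_nat t)"
      using hI(2)[unfolded has_hilbert_polynomial_def] eventually_ge_at_top[of r]
      by eventually_elim (simp add: P Q dim_forms[OF v] algebra_simps)
  qed
  then show ?thesis using P[OF \<open>r \<le> m\<close>] Q[of m] by simp
qed

text \<open>Three fields occur: the ideal \<open>I\<close> lives over \<open>'b\<close>, regularity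
  is known over \<open>'a\<close>, and the point is wanted over \<open>'c\<close>. The exponent set
  \<open>N\<close> is common to all of them, so the number of its terms of degree \<open>m\<close>
  may be found over \<open>'a\<close>. It equals \<open>q\<close>, the number of leading terms of
  \<open>I\<close> in degree \<open>m\<close>, and an inclusion of finite sets of equal size is an
  equality.\<close>

lemma vs_lead_terms_in_hilb_points:
  fixes I :: "('v, 'b::field) mpol set" and p :: "rat poly"
  assumes v: "CARD('v) = n + 1"
    and gotzmann: "is_gotzmann_number TYPE(('v, 'a::field) mpol) p r" and m: "r \<le> m"
    and q: "of_nat q = of_nat ((n + m) choose n) - poly p (of_nat m)"
    and I: "homogeneous_ideal I" "has_hilbert_polynomial I p" "mp.dim (I \<inter> forms m) = q"
  shows "(vs (leading (I \<inter> forms m)) :: ('v, 'c::field) mpol set) \<in> hilb_points p m q"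
proof -
  define N where "N = saturation (lead_terms I)"
  have idealK: "(vs N :: ('v, 'a) mpol set) \<in> hilb_ideals p"
    unfolding N_def by (rule hilb_ideals_saturation_lead_terms[OF I(1,2)])
  have "(of_nat (card (N \<inter> terms m)) :: rat) = of_nat q"
    using dim_regular_ideal[OF v idealK _ m] gotzmann idealK q
    by (auto simp: is_gotzmann_number_def vs_inter_forms dim_vs[OF Int_lower2])
  then have "card (N \<inter> terms m) = q" by simp
  moreover have "lead_terms I \<inter> terms m \<subseteq> N \<inter> terms m"
    unfolding N_def using subset_saturation[OF term_ideal_lead_terms[OF I(1)]] by blast
  moreover have "card (lead_terms I \<inter> terms m) = q" using I(3) dim_ideal_forms[OF I(1)] by simp
  ultimately have "leading (I \<inter> forms m) = N \<inter> terms m"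
    using card_subset_eq[of "N \<inter> terms m" "lead_terms I \<inter> terms m"] by (simp add: lead_terms_inter)
  moreover have "(vs N :: ('v, 'c) mpol set) \<in> hilb_ideals p"
    unfolding N_def by (rule hilb_ideals_saturation_lead_terms[OF I(1,2)])
  moreover have "vs (N \<inter> terms m) \<subseteq> (forms m :: ('v, 'c) mpol set)" by (auto simp: forms_eq_vs vs_eq)
  moreover have "mp.dim (vs (N \<inter> terms m) :: ('v, 'c) mpol set) = q"
    using \<open>card (N \<inter> terms m) = q\<close> by (simp add: dim_vs[OF Int_lower2])
  ultimately show ?thesis
    unfolding hilb_points_def grassmannian_def
    by (auto simp: subspace_vs intro!: bexI[of _ "vs N"] vs_inter_forms[symmetric])
qed

end

section \<open>The action of the general linear group\<close>

lemma const_add: "const (c + d) = const c + const d"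
  by (simp add: const_def single_add)

lemma const_mult: "const (c * d) = const c * const d"
  by (simp add: const_def mult_single)

lemma const_zero [simp]: "const 0 = 0"
  by (simp add: const_def)

lemma const_one [simp]: "const 1 = 1"
  by (simp add: const_def)

lemma const_sum: "const (\<Sum>i\<in>I. f i) = (\<Sum>i\<in>I. const (f i))"
  by (induction I rule: infinite_finite_induct) (simp_all add: const_add)

lemma const_prod: "const (\<Prod>i\<in>I. f i) = (\<Prod>i\<in>I. const (f i))"
  by (induction I rule: infinite_finite_induct) (simp_all add: const_mult)

lemma const_power: "const (c ^ k) = const c ^ k"
  by (induction k) (simp_all add: const_mult)

lemma single_eq_const_times_monomial: "Poly_Mapping.single t c = const c * monomial t"
  by (simp add: const_def monomial_def mult_single)

lemma monomial_add: "monomial (s + t) = monomial s * monomial t"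
  by (simp add: monomial_def mult_single)

lemma monomial_zero [simp]: "monomial 0 = 1"
  by (simp add: monomial_def)

lemma trm_eq_sum: "(t :: 'v::finite trm) = (\<Sum>i\<in>UNIV. Poly_Mapping.single i (Poly_Mapping.lookup t i))"
  by (rule poly_mapping_eqI) (simp add: lookup_sum lookup_single when_def)

lemma monomial_single_power: "monomial (Poly_Mapping.single i k) = var i ^ k"
proof (induction k)
  case (Suc k)
  have "Poly_Mapping.single i (Suc k) = Poly_Mapping.single i 1 + Poly_Mapping.single i k"
    by (simp flip: single_add)
  then show ?case using Suc by (simp add: monomial_add var_def)
qed simp

lemma monomial_sum: "monomial (\<Sum>i\<in>I. f i) = (\<Prod>i\<in>I. monomial (f i))"
  by (induction I rule: infinite_finite_induct) (simp_all add: monomial_add)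

lemma monomial_eq_prod_var:
  "monomial (t :: 'v::finite trm) = (\<Prod>i\<in>UNIV. var i ^ Poly_Mapping.lookup t i)"
  by (subst trm_eq_sum) (simp add: monomial_sum monomial_single_power)

section \<open>Substitution of linear forms\<close>

definition linform :: "('a::comm_ring_1, 'v::finite) sq_mat \<Rightarrow> 'v \<Rightarrow> ('v, 'a) mpol" where
  "linform g i = (\<Sum>j\<in>UNIV. scale (g $ i $ j) (var j))"

text \<open>The product runs over all variables rather than over the support of \<open>t\<close>,
  which makes multiplicativity in \<open>t\<close> immediate.\<close>

definition monact :: "('a::comm_ring_1, 'v::finite) sq_mat \<Rightarrow> 'v trm \<Rightarrow> ('v, 'a) mpol" where
  "monact g t = (\<Prod>i\<in>UNIV. linform g i ^ Poly_Mapping.lookup t i)"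

lemma act_superset:
  assumes "finite A" "Poly_Mapping.keys f \<subseteq> A"
  shows "act g f = (\<Sum>t\<in>A. const (Poly_Mapping.lookup f t) * monact g t)"
proof -
  have "act g f = (\<Sum>t\<in>Poly_Mapping.keys f. const (Poly_Mapping.lookup f t) * monact g t)"
    unfolding act_def mpeval_def monact_def linform_def[symmetric]
    by (intro sum.cong refl arg_cong[where f = "(*) _"] prod.mono_neutral_left) (auto simp: in_keys_iff)
  also have "\<dots> = (\<Sum>t\<in>A. const (Poly_Mapping.lookup f t) * monact g t)"
    using assms by (intro sum.mono_neutral_left) (auto simp: in_keys_iff)
  finally show ?thesis .
qed

lemma act_add: "act g (f + h) = act g f + act g h"
proof -
  let ?A = "Poly_Mapping.keys f \<union> Poly_Mapping.keys h"
  have "Poly_Mapping.keys (f + h) \<subseteq> ?A" by (rule keys_add)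
  then show ?thesis
    by (simp add: act_superset[of ?A] lookup_add const_add distrib_right sum.distrib)
qed

lemma act_single: "act g (Poly_Mapping.single t c) = const c * monact g t"
  by (subst act_superset[of "{t}"]) auto

lemma act_monomial: "act g (monomial t) = monact g t"
  by (simp add: monomial_def act_single)

lemma act_zero [simp]: "act g 0 = 0"
  using act_single[of g 0 0] by simp

lemma act_const [simp]: "act g (const c) = const c"
  by (simp add: const_def[of c] act_single) (simp add: monact_def const_def)

lemma monact_add: "monact g (s + t) = monact g s * monact g t"
  by (simp add: monact_def lookup_add power_add prod.distrib)

lemma act_mult: "act g (f * h) = act g f * act g h"
proof (induction f rule: mpol_induct)
  case (add f1 f2)
  then show ?case by (simp add: distrib_right act_add)
next
  case (single s c)
  show ?case
  proof (induction h rule: mpol_induct)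
    case (add h1 h2)
    then show ?case by (simp add: distrib_left act_add)
  next
    case (single t d)
    then show ?case by (simp add: mult_single act_single monact_add const_mult mult_ac)
  qed
qed

lemma act_one [simp]: "act g 1 = 1"
  using act_const[of g 1] by simp

lemma act_scale: "act g (scale c f) = scale c (act g f)"
  by (simp add: scale_def act_mult)

lemma act_sum: "act g (\<Sum>i\<in>I. f i) = (\<Sum>i\<in>I. act g (f i))"
  by (induction I rule: infinite_finite_induct) (simp_all add: act_add)

lemma act_prod: "act g (\<Prod>i\<in>I. f i) = (\<Prod>i\<in>I. act g (f i))"
  by (induction I rule: infinite_finite_induct) (simp_all add: act_mult)

lemma act_power: "act g (f ^ k) = act g f ^ k"
  by (induction k) (simp_all add: act_mult)

lemma monact_single: "monact g (Poly_Mapping.single i 1) = linform g i"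
proof -
  have "monact g (Poly_Mapping.single i 1) = (\<Prod>j\<in>UNIV. if j = i then linform g i else 1)"
    unfolding monact_def by (intro prod.cong) (auto simp: lookup_single when_def)
  then show ?thesis by simp
qed

lemma act_var: "act g (var i) = linform g i"
  using monact_single[of g i] by (simp add: var_def act_monomial)

lemma act_linform: "act g (linform h i) = linform (h ** g) i"
proof -
  have "act g (linform h i) = (\<Sum>k\<in>UNIV. \<Sum>j\<in>UNIV. scale (h $ i $ k) (scale (g $ k $ j) (var j)))"
    unfolding linform_def[of h] act_sum act_scale act_var unfolding linform_def scale_def sum_distrib_left ..
  also have "\<dots> = (\<Sum>j\<in>UNIV. \<Sum>k\<in>UNIV. const (h $ i $ k * g $ k $ j) * var j)"
    by (subst sum.swap) (simp add: scale_def const_mult mult.assoc)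
  also have "\<dots> = linform (h ** g) i"
    by (simp add: linform_def matrix_matrix_mult_def scale_def sum_distrib_right const_sum)
  finally show ?thesis .
qed

text \<open>Substituting \<open>g\<close> into the linear forms of \<open>h\<close> multiplies the
  matrices as \<open>h ** g\<close>, so this is a right action. For this reason torus and upper
  triangular factors later stand to the right of the generic matrix.\<close>

lemma act_act: "act g (act h f) = act (h ** g) f"
proof (induction f rule: mpol_induct)
  case (single t c)
  have "act g (monact h t) = monact (h ** g) t"
    by (simp add: monact_def act_prod act_power act_linform)
  then show ?case by (simp add: act_single act_mult)
qed (simp add: act_add)

lemma act_mat_1:
  fixes f :: "('v::finite, 'a::comm_ring_1) mpol"
  shows "act (Finite_Cartesian_Product.mat 1) f = f"
proof (induction f rule: mpol_induct)
  case (single t c)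
  have "linform (Finite_Cartesian_Product.mat 1) i = (var i :: ('v, 'a) mpol)" for i
  proof -
    have "linform (Finite_Cartesian_Product.mat 1) i = (\<Sum>j\<in>UNIV. if j = i then (var i :: ('v, 'a) mpol) else 0)"
      unfolding linform_def by (intro sum.cong) (auto simp: Finite_Cartesian_Product.mat_def scale_def)
    then show ?thesis by simp
  qed
  then have "monact (Finite_Cartesian_Product.mat 1) t = (monomial t :: ('v, 'a) mpol)" by (simp add: monact_def monomial_eq_prod_var)
  then show ?case by (simp add: act_mult act_monomial single_eq_const_times_monomial)
qed (simp add: act_add)

lemma homogeneous_linform: "homogeneous 1 (linform g i)"
  unfolding linform_def
  by (intro homogeneous_sum homogeneous_scale) (simp add: var_def homogeneous_monomial)

lemma homogeneous_monact: "homogeneous (deg t) (monact g t)"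
proof -
  have "homogeneous (\<Sum>i\<in>UNIV. Poly_Mapping.lookup t i * 1) (monact g t)"
    unfolding monact_def by (intro homogeneous_prod homogeneous_power homogeneous_linform)
  then show ?thesis by (simp add: deg_eq_sum)
qed

lemma homogeneous_act: "homogeneous d f \<Longrightarrow> homogeneous d (act g f)"
  unfolding act_superset[OF finite_keys order_refl] scale_def[symmetric]
  by (intro homogeneous_sum homogeneous_scale) (metis homogeneous_def homogeneous_monact)

section \<open>Change of coefficients\<close>

text \<open>Applied to three homomorphisms: constants into univariate polynomials, evaluation of
  such polynomials, and the embedding of \<open>K\<close> into \<Omega>.\<close>

definition mapc :: "('a \<Rightarrow> 'b) \<Rightarrow> ('v, 'a::comm_ring_1) mpol \<Rightarrow> ('v, 'b::comm_ring_1) mpol" where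
  "mapc \<phi> f = Poly_Mapping.map \<phi> f"

context comm_ring_hom
begin

lemma lookup_mapc: "Poly_Mapping.lookup (mapc hom f) t = hom (Poly_Mapping.lookup f t)"
  by (simp add: mapc_def Poly_Mapping.map.rep_eq when_def)

lemma mapc_add: "mapc hom (f + g) = mapc hom f + mapc hom g"
  by (rule poly_mapping_eqI) (simp add: lookup_mapc lookup_add hom_add)

lemma mapc_single: "mapc hom (Poly_Mapping.single t c) = Poly_Mapping.single t (hom c)"
  by (rule poly_mapping_eqI) (simp add: lookup_mapc lookup_single when_def)

lemma mapc_zero [simp]: "mapc hom 0 = 0"
  by (rule poly_mapping_eqI) (simp add: lookup_mapc)

lemma mapc_one [simp]: "mapc hom 1 = 1"
  using mapc_single[of 0 1] by simp

lemma mapc_mult: "mapc hom (f * g) = mapc hom f * mapc hom g"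
proof (induction f rule: mpol_induct)
  case (add f1 f2)
  then show ?case by (simp add: distrib_right mapc_add)
next
  case (single s c)
  show ?case
    by (induction g rule: mpol_induct)
       (simp_all add: distrib_left mapc_add mult_single mapc_single hom_mult)
qed

lemma mapc_sum: "mapc hom (\<Sum>i\<in>I. f i) = (\<Sum>i\<in>I. mapc hom (f i))"
  by (induction I rule: infinite_finite_induct) (simp_all add: mapc_add)

lemma mapc_prod: "mapc hom (\<Prod>i\<in>I. f i) = (\<Prod>i\<in>I. mapc hom (f i))"
  by (induction I rule: infinite_finite_induct) (simp_all add: mapc_mult)

lemma mapc_power: "mapc hom (f ^ k) = mapc hom f ^ k"
  by (induction k) (simp_all add: mapc_mult)

lemma mapc_const: "mapc hom (const c) = const (hom c)"
  by (simp add: const_def mapc_single)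

lemma mapc_monomial: "mapc hom (monomial t) = monomial t"
  by (simp add: monomial_def mapc_single)

lemma mapc_act: "mapc hom (act g f) = act (\<chi> i j. hom (g $ i $ j)) (mapc hom f)"
proof (induction f rule: mpol_induct)
  case (add f g)
  then show ?case by (simp add: mapc_add act_add)
next
  case (single t c)
  have "mapc hom (linform g i) = linform (\<chi> i j. hom (g $ i $ j)) i" for i
    by (simp add: linform_def mapc_sum scale_def mapc_mult mapc_const var_def mapc_monomial)
  then have "mapc hom (monact g t) = monact (\<chi> i j. hom (g $ i $ j)) t"
    by (simp add: monact_def mapc_prod mapc_power)
  then show ?case by (simp add: act_single mapc_mult mapc_const mapc_single)
qed

end

section \<open>The torus and upper triangular matrices\<close>

definition diagonal :: "('v \<Rightarrow> 'a) \<Rightarrow> ('a::zero, 'v::finite) sq_mat" where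
  "diagonal \<delta> = (\<chi> i j. if i = j then \<delta> i else 0)"

lemma monact_diagonal:
  fixes \<delta> :: "'v::finite \<Rightarrow> 'a::comm_ring_1"
  shows "monact (diagonal \<delta>) t = scale (\<Prod>i\<in>UNIV. \<delta> i ^ Poly_Mapping.lookup t i) (monomial t)"
proof -
  have "linform (diagonal \<delta>) i = const (\<delta> i) * var i" for i
  proof -
    have "linform (diagonal \<delta>) i = (\<Sum>j\<in>UNIV. if j = i then const (\<delta> i) * var i else 0)"
      unfolding linform_def by (intro sum.cong) (auto simp: diagonal_def scale_def)
    then show ?thesis by simp
  qed
  then show ?thesis
    by (simp add: monact_def power_mult_distrib prod.distrib scale_def monomial_eq_prod_var const_prod const_power)
qed

lemma invertible_diagonal:
  fixes \<delta> :: "'v::finite \<Rightarrow> 'a::field"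
  assumes "\<And>i. \<delta> i \<noteq> 0"
  shows "invertible (diagonal \<delta>)"
proof -
  have "diagonal \<delta> ** diagonal \<epsilon> = diagonal (\<lambda>i. \<delta> i * \<epsilon> i)" for \<delta> \<epsilon> :: "'v \<Rightarrow> 'a"
  proof -
    have "(\<Sum>k\<in>UNIV. (if i = k then \<delta> i else 0) * (if k = j then \<epsilon> k else 0)) = (if i = j then \<delta> i * \<epsilon> i else 0)" for i j
    proof -
      have "(\<Sum>k\<in>UNIV. (if i = k then \<delta> i else 0) * (if k = j then \<epsilon> k else 0))
          = (\<Sum>k\<in>UNIV. if k = i then \<delta> i * (if i = j then \<epsilon> i else 0) else 0)"
        by (intro sum.cong) auto
      then show ?thesis by simp
    qed
    then show ?thesis by (simp add: diagonal_def matrix_matrix_mult_def vec_eq_iff)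
  qed
  moreover have "diagonal (\<lambda>i. 1) = (Finite_Cartesian_Product.mat 1 :: ('a, 'v) sq_mat)" by (simp add: diagonal_def Finite_Cartesian_Product.mat_def)
  ultimately show ?thesis using assms unfolding invertible_def
    by (intro exI[of _ "diagonal (\<lambda>i. inverse (\<delta> i))"]) simp
qed

text \<open>A variable is sent to a combination of variables with the same or a larger index, which
  are not smaller in the term order. Lower bounds on supports add up in products, whatever
  cancels.\<close>

lemma (in term_ord) keys_monact_upper_triangular:
  fixes g :: "('a::comm_ring_1, 'v) sq_mat"
  assumes g: "upper_triangular g" and u: "u \<in> Poly_Mapping.keys (monact g t)"
  shows "tle t u"
proof -
  define above where "above s f \<longleftrightarrow> (\<forall>u\<in>Poly_Mapping.keys f. tle s u)"
    for s and f :: "('v, 'a) mpol"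
  have above_mult: "above (s + s') (f * f')" if above: "above s f" "above s' f'" for s s' f f'
    unfolding above_def
  proof
    fix u assume "u \<in> Poly_Mapping.keys (f * f')"
    then obtain v w where "u = v + w" "v \<in> Poly_Mapping.keys f" "w \<in> Poly_Mapping.keys f'"
      using keys_mult[of f f'] by auto
    then show "tle (s + s') u" using above by (simp add: above_def tle_add)
  qed
  have above_1: "above 0 1" by (simp add: above_def)
  have "above (Poly_Mapping.single i 1) (linform g i)" for i
    unfolding above_def
  proof
    fix u assume "u \<in> Poly_Mapping.keys (linform g i)"
    then obtain j where j: "g $ i $ j \<noteq> 0" "u = Poly_Mapping.single j 1"
    proof -
      have "(\<Sum>j\<in>UNIV. g $ i $ j * (if u = Poly_Mapping.single j 1 then 1 else 0)) \<noteq> 0"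
        using \<open>u \<in> Poly_Mapping.keys (linform g i)\<close>
        by (simp add: linform_def in_keys_iff lookup_sum lookup_scale var_def lookup_monomial)
      then obtain j where "g $ i $ j * (if u = Poly_Mapping.single j 1 then 1 else 0) \<noteq> 0"
        by (rule sum.not_neutral_contains_not_neutral)
      then show ?thesis using that[of j] by (simp split: if_splits)
    qed
    then have "i \<le> j" using g by (auto simp: upper_triangular_def not_less[symmetric])
    then show "tle (Poly_Mapping.single i 1) u" unfolding j(2) by (rule tle_var)
  qed
  note above_lin = this
  have above_pow: "above (Poly_Mapping.single i k) (linform g i ^ k)" for i k
  proof (induction k)
    case (Suc k)
    have "Poly_Mapping.single i (Suc k) = Poly_Mapping.single i 1 + Poly_Mapping.single i k"
      by (simp flip: single_add)
    then show ?case using above_mult[OF above_lin Suc] by simp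
  qed (simp add: above_1)
  have "above (\<Sum>i\<in>I. Poly_Mapping.single i (Poly_Mapping.lookup t i))
      (\<Prod>i\<in>I. linform g i ^ Poly_Mapping.lookup t i)" for I
    by (induction I rule: infinite_finite_induct) (simp_all add: above_1 above_mult above_pow)
  from this[of UNIV] show ?thesis using u by (simp add: above_def monact_def flip: trm_eq_sum)
qed

section \<open>Pluecker coordinates and generic matrices\<close>

lemma det_mat_eq_sum_permutes:
  "Determinant.det (Matrix.mat q q (\<lambda>(i, j). A i j)) =
    (\<Sum>\<pi>\<in>{\<pi>. \<pi> permutes {0..<q}}. signof \<pi> * (\<Prod>i = 0..<q. A i (\<pi> i)))"
proof -
  have "\<pi> i < q" if "\<pi> permutes {0..<q}" "i < q" for \<pi> i
    using permutes_in_image[OF that(1), of i] that(2) by simp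
  then show ?thesis
    by (subst det_def'[OF mat_carrier]) (auto intro!: sum.cong prod.cong arg_cong[where f = "(*) _"])
qed

text \<open>Multilinearity in the rows, with \<open>\<phi>\<close> choosing a summand from each row.
  Choices with repetitions stay in the sum, so that it can be sorted by torus weight without
  regrouping.\<close>

lemma det_rows_sum_expand:
  fixes a :: "nat \<Rightarrow> 'k \<Rightarrow> 'a::comm_ring_1"
  assumes "finite K"
  shows "Determinant.det (Matrix.mat q q (\<lambda>(i, j). \<Sum>t\<in>K. a i t * l t j)) =
    (\<Sum>\<phi>\<in>PiE {0..<q} (\<lambda>_. K). (\<Prod>i = 0..<q. a i (\<phi> i)) * Determinant.det (Matrix.mat q q (\<lambda>(i, j). l (\<phi> i) j)))"
proof -
  let ?S = "{\<pi>. \<pi> permutes {0..<q}}" and ?F = "PiE {0..<q} (\<lambda>_. K)"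
  have "Determinant.det (Matrix.mat q q (\<lambda>(i, j). \<Sum>t\<in>K. a i t * l t j)) =
      (\<Sum>\<pi>\<in>?S. signof \<pi> * (\<Prod>i = 0..<q. \<Sum>t\<in>K. a i t * l t (\<pi> i)))"
    by (simp only: det_mat_eq_sum_permutes)
  also have "\<dots> = (\<Sum>\<pi>\<in>?S. signof \<pi> * (\<Sum>\<phi>\<in>?F. \<Prod>i = 0..<q. a i (\<phi> i) * l (\<phi> i) (\<pi> i)))"
    using assms by (simp add: prod_sum_PiE)
  also have "\<dots> = (\<Sum>\<phi>\<in>?F. \<Sum>\<pi>\<in>?S. (\<Prod>i = 0..<q. a i (\<phi> i)) * (signof \<pi> * (\<Prod>i = 0..<q. l (\<phi> i) (\<pi> i))))"
    by (simp add: sum_distrib_left prod.distrib mult.left_commute) (rule sum.swap)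
  also have "\<dots> = (\<Sum>\<phi>\<in>?F. (\<Prod>i = 0..<q. a i (\<phi> i)) * Determinant.det (Matrix.mat q q (\<lambda>(i, j). l (\<phi> i) j)))"
    by (simp only: det_mat_eq_sum_permutes sum_distrib_left)
  finally show ?thesis .
qed

lemma det_nonzero_permutes:
  assumes "Determinant.det (Matrix.mat q q (\<lambda>(i, j). A i j)) \<noteq> 0"
  obtains \<pi> where "\<pi> permutes {0..<q}" "\<And>i. i < q \<Longrightarrow> A i (\<pi> i) \<noteq> 0"
proof -
  have "(\<Sum>\<pi>\<in>{\<pi>. \<pi> permutes {0..<q}}. signof \<pi> * (\<Prod>i = 0..<q. A i (\<pi> i))) \<noteq> 0"
    using assms unfolding det_mat_eq_sum_permutes .
  then obtain \<pi> where \<pi>: "\<pi> permutes {0..<q}" "signof \<pi> * (\<Prod>i = 0..<q. A i (\<pi> i)) \<noteq> 0"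
    by (auto elim: sum.not_neutral_contains_not_neutral)
  have "A i (\<pi> i) \<noteq> 0" if "i < q" for i
  proof
    assume "A i (\<pi> i) = 0"
    then have "(\<Prod>i = 0..<q. A i (\<pi> i)) = 0" using that by (intro prod_zero) auto
    then show False using \<pi>(2) by simp
  qed
  then show ?thesis using \<pi>(1) that by blast
qed

lemma ex_nonroot:
  fixes P :: "'a::field poly"
  assumes "infinite (UNIV :: 'a set)" "P \<noteq> 0"
  obtains s where "poly P s \<noteq> 0"
proof -
  have "{s. poly P s = 0} \<noteq> UNIV" using poly_roots_finite[OF assms(2)] assms(1) by metis
  then show ?thesis using that by auto
qed

text \<open>The sum is a polynomial in the numbers \<open>\<delta> i\<close>, and \<open>nz\<close>
  says that its coefficient at the exponent \<open>w0\<close> is nonzero. The variables are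
  specialised one by one: outside \<open>A\<close> the exponents are still pinned to those of
  \<open>w0\<close>. For a further variable \<open>y\<close>, the coefficient of \<open>P\<close> at
  \<open>w0 y\<close> is the nonzero sum already found for \<open>A\<close>.\<close>

lemma ex_nonvanishing_weighted_sum:
  fixes a :: "'n \<Rightarrow> 'a::field" and w :: "'n \<Rightarrow> 'v::finite \<Rightarrow> nat"
  assumes inf: "infinite (UNIV :: 'a set)" and N: "finite N"
    and nz: "(\<Sum>x\<in>{x\<in>N. w x = w0}. a x) \<noteq> 0"
  shows "\<exists>\<delta>. (\<forall>i. \<delta> i \<noteq> 0) \<and> (\<Sum>x\<in>N. a x * (\<Prod>i\<in>UNIV. \<delta> i ^ w x i)) \<noteq> 0"
proof -
  have "\<exists>\<delta>. (\<forall>i. \<delta> i \<noteq> 0) \<and>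
      (\<Sum>x\<in>{x\<in>N. \<forall>i. i \<notin> A \<longrightarrow> w x i = w0 i}. a x * (\<Prod>i\<in>A. \<delta> i ^ w x i)) \<noteq> 0" (is "?P A") for A
    using finite[of A]
  proof (induction A rule: finite_induct)
    case empty
    then show ?case using nz by (intro exI[of _ "\<lambda>_. 1"]) (simp add: fun_eq_iff)
  next
    case (insert y A)
    define NA where "NA = {x\<in>N. \<forall>i. i \<notin> A \<longrightarrow> w x i = w0 i}"
    define NB where "NB = {x\<in>N. \<forall>i. i \<notin> insert y A \<longrightarrow> w x i = w0 i}"
    obtain \<delta> where \<delta>: "\<And>i. \<delta> i \<noteq> 0" "(\<Sum>x\<in>NA. a x * (\<Prod>i\<in>A. \<delta> i ^ w x i)) \<noteq> 0"
      using insert.IH by (auto simp: NA_def)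
    define P where "P = (\<Sum>x\<in>NB. Polynomial.monom (a x * (\<Prod>i\<in>A. \<delta> i ^ w x i)) (w x y))"
    have NA: "NA = {x\<in>NB. w x y = w0 y}" using insert.hyps by (auto simp: NA_def NB_def)
    have finB: "finite NB" using N by (simp add: NB_def)
    have "Polynomial.coeff P (w0 y) = (\<Sum>x\<in>NB. if w x y = w0 y then a x * (\<Prod>i\<in>A. \<delta> i ^ w x i) else 0)"
      by (simp add: P_def coeff_sum)
    also have "\<dots> = (\<Sum>x\<in>NA. a x * (\<Prod>i\<in>A. \<delta> i ^ w x i))"
      unfolding NA using finB by (rule sum.inter_filter[symmetric])
    finally have "P \<noteq> 0" using \<delta>(2) by auto
    \<comment> \<open>The additional factor excludes the value 0, so the new coordinate stays in the
      torus.\<close>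
    then have "P * [:0, 1:] \<noteq> 0" by simp
    then obtain s where "poly (P * [:0, 1:]) s \<noteq> 0" using ex_nonroot[OF inf] by blast
    then have s: "poly P s \<noteq> 0" "s \<noteq> 0" by auto
    have "(\<Prod>i\<in>insert y A. (\<delta>(y := s)) i ^ w x i) = s ^ w x y * (\<Prod>i\<in>A. \<delta> i ^ w x i)" for x
    proof -
      have "(\<Prod>i\<in>A. (\<delta>(y := s)) i ^ w x i) = (\<Prod>i\<in>A. \<delta> i ^ w x i)"
        using insert.hyps(2) by (intro prod.cong) auto
      then show ?thesis using insert.hyps by simp
    qed
    then have "(\<Sum>x\<in>NB. a x * (\<Prod>i\<in>insert y A. (\<delta>(y := s)) i ^ w x i)) = poly P s"
      by (simp add: P_def poly_sum poly_monom mult_ac)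
    then show ?case using s \<delta>(1) unfolding NB_def[symmetric] by (intro exI[of _ "\<delta>(y := s)"]) auto
  qed
  from this[of UNIV] show ?thesis by simp
qed

section \<open>Pluecker coordinates under homomorphisms and changes of basis\<close>

lemma (in comm_ring_hom) hom_det_matrix:
  "Determinants.det (\<chi> i j. hom (A $ i $ j)) = hom (Determinants.det (A :: 'a^'n^'n))"
  unfolding Determinants.det_def by (simp add: hom_distribs)

lemma comm_ring_hom_poly: "comm_ring_hom (\<lambda>P. poly P (s :: 'a::comm_ring_1))"
  by unfold_locales simp_all

lemma (in comm_ring_hom) hom_wedge:
  "wedge tle q m (\<lambda>i. mapc hom (f i)) U = hom (wedge tle q m f U)"
proof -
  have "Matrix.mat q q (\<lambda>(i, j). Poly_Mapping.lookup (mapc hom (f i)) (desc tle U j)) =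
      map_mat hom (Matrix.mat q q (\<lambda>(i, j). Poly_Mapping.lookup (f i) (desc tle U j)))"
    by (intro eq_matI) (auto simp: lookup_mapc)
  then show ?thesis by (simp add: wedge_def)
qed

lemma wedge_eq_0_outside: "U \<notin> ext_terms m q \<Longrightarrow> wedge tle q m f U = 0"
  by (simp add: wedge_def)

lemma wedge_linear_combination:
  assumes "\<And>i. i < q \<Longrightarrow> f i = (\<Sum>j<q. scale (c i j) (f' j))" and "wedge tle q m f U \<noteq> 0"
  shows "wedge tle q m f' U \<noteq> 0"
proof -
  let ?M = "\<lambda>f. Matrix.mat q q (\<lambda>(i, j). Poly_Mapping.lookup (f i) (desc tle U j))"
  have "?M f = Matrix.mat q q (\<lambda>(i, j). c i j) * ?M f'"
    by (intro eq_matI)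
       (simp_all add: assms(1) lookup_sum lookup_scale scalar_prod_def atLeast0LessThan)
  then have "Determinant.det (?M f) = Determinant.det (Matrix.mat q q (\<lambda>(i, j). c i j)) * Determinant.det (?M f')"
    by (simp add: det_mult[where n = q])
  then show ?thesis using assms(2) by (auto simp: wedge_def split: if_splits)
qed

lemma in_span_imageE:
  fixes f :: "nat \<Rightarrow> ('v, 'a::field) mpol"
  assumes "x \<in> mp.span (f ` {..<q})"
  obtains c where "x = (\<Sum>j<q. scale (c j) (f j))"
proof -
  let ?S = "range (\<lambda>c. \<Sum>j<q. scale (c j) (f j))"
  have "mp.subspace ?S"
  proof (rule mp.subspaceI)
    show "0 \<in> ?S" by (rule image_eqI[of _ _ "\<lambda>_. 0"]) simp_all
    show "x + y \<in> ?S" if xy: "x \<in> ?S" "y \<in> ?S" for x y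
    proof -
      obtain c d where "x = (\<Sum>j<q. scale (c j) (f j))" "y = (\<Sum>j<q. scale (d j) (f j))"
        using xy by auto
      then show ?thesis
        by (intro image_eqI[of _ _ "\<lambda>j. c j + d j"]) (simp_all add: mp.scale_left_distrib sum.distrib)
    qed
    show "scale a x \<in> ?S" if x: "x \<in> ?S" for a x
    proof -
      obtain c where "x = (\<Sum>j<q. scale (c j) (f j))" using x by auto
      then show ?thesis
        by (intro image_eqI[of _ _ "\<lambda>j. a * c j"]) (simp_all add: mp.scale_sum_right)
    qed
  qed
  moreover have "f ` {..<q} \<subseteq> ?S"
  proof
    fix y assume "y \<in> f ` {..<q}"
    then obtain k where k: "k < q" "y = f k" by auto
    have "(\<Sum>j<q. scale (if j = k then 1 else 0) (f j)) = (\<Sum>j<q. if j = k then f k else 0)"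
      by (intro sum.cong) auto
    then have "y = (\<Sum>j<q. scale (if j = k then 1 else 0) (f j))" using k by simp
    then show "y \<in> ?S" by (rule range_eqI[of _ _ "\<lambda>j. if j = k then 1 else 0"])
  qed
  ultimately have "mp.span (f ` {..<q}) \<subseteq> ?S" by (intro mp.span_minimal)
  then show ?thesis using assms that by blast
qed

text \<open>A change of spanning family multiplies all Pluecker coordinates by one determinant, so a
  nonvanishing coordinate can be carried over to an echelon basis and back.\<close>

lemma wedge_act_span:
  fixes f f' :: "nat \<Rightarrow> ('v::finite, 'a::field) mpol"
  assumes "\<And>i. i < q \<Longrightarrow> f i \<in> mp.span (f' ` {..<q})" and "wedge tle q m (\<lambda>i. act g (f i)) U \<noteq> 0"
  shows "wedge tle q m (\<lambda>i. act g (f' i)) U \<noteq> 0"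
proof -
  have "\<forall>i. \<exists>c. i < q \<longrightarrow> f i = (\<Sum>j<q. scale (c j) (f' j))"
    using in_span_imageE[OF assms(1)] by metis
  then obtain c where "\<And>i. i < q \<Longrightarrow> f i = (\<Sum>j<q. scale (c i j) (f' j))" by metis
  then have "act g (f i) = (\<Sum>j<q. scale (c i j) (act g (f' j)))" if "i < q" for i
    using that by (simp add: act_sum act_scale)
  then show ?thesis using assms(2) by (rule wedge_linear_combination)
qed

lemma finite_ext_terms: "finite (ext_terms m q :: 'v::finite trm set set)"
  by (rule finite_subset[of _ "Pow (terms m)"]) (auto simp: ext_terms_def)

definition matrix_line :: "('a::comm_ring_1, 'v::finite) sq_mat \<Rightarrow> ('a, 'v) sq_mat \<Rightarrow> 'a \<Rightarrow> ('a, 'v) sq_mat" where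
  "matrix_line g0 g1 s = (\<chi> i j. g0 $ i $ j + s * (g1 $ i $ j - g0 $ i $ j))"

text \<open>The general point \<open>G\<close> of the line is a matrix over the polynomial ring,
  where the coordinates are computed once. Evaluation at \<open>s\<close> is a ring homomorphism and
  thus commutes with the action and with determinants.\<close>

lemma act_line_polynomial:
  fixes g0 g1 :: "('a::field, 'v::finite) sq_mat" and f :: "nat \<Rightarrow> ('v, 'a) mpol"
  defines "line \<equiv> matrix_line g0 g1"
  shows "\<exists>P D. (\<forall>s U. wedge tle q m (\<lambda>i. act (line s) (f i)) U = poly (P U) s) \<and>
    (\<forall>s. Determinants.det (line s) = poly D s)"
proof -
  define G :: "('a poly, 'v) sq_mat" where "G = (\<chi> i j. [:g0 $ i $ j, g1 $ i $ j - g0 $ i $ j:])"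
  interpret c: comm_ring_hom "\<lambda>c::'a. [:c:]" by unfold_locales simp_all
  define P where "P = wedge tle q m (\<lambda>i. act G (mapc (\<lambda>c. [:c:]) (f i)))"
  have line: "(\<chi> i j. poly (G $ i $ j) s) = line s" for s by (simp add: G_def line_def matrix_line_def)
  have "wedge tle q m (\<lambda>i. act (line s) (f i)) U = poly (P U) s" for s U
  proof -
    interpret e: comm_ring_hom "\<lambda>P. poly P s" by (rule comm_ring_hom_poly)
    have "mapc (\<lambda>P. poly P s) (mapc (\<lambda>c. [:c:]) (f i)) = f i" for i
      by (rule poly_mapping_eqI) (simp add: e.lookup_mapc c.lookup_mapc)
    then have "mapc (\<lambda>P. poly P s) (act G (mapc (\<lambda>c. [:c:]) (f i))) = act (line s) (f i)" for i
      by (simp add: e.mapc_act line)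
    then show ?thesis unfolding P_def by (simp flip: e.hom_wedge)
  qed
  moreover have "Determinants.det (line s) = poly (Determinants.det G) s" for s
  proof -
    interpret e: comm_ring_hom "\<lambda>P. poly P s" by (rule comm_ring_hom_poly)
    show ?thesis using e.hom_det_matrix[of G] by (simp add: line)
  qed
  ultimately show ?thesis by blast
qed

text \<open>Genericity as an extremal choice: the number of nonzero Pluecker coordinates is bounded,
  so some invertible matrix attains its maximum.\<close>

lemma ex_generic_matrix:
  fixes f :: "nat \<Rightarrow> ('v::finite, 'a::field) mpol"
  assumes inf: "infinite (UNIV :: 'a set)"
  obtains g0 :: "('a, 'v) sq_mat" where "invertible g0"
    "\<And>g U. invertible g \<Longrightarrow> wedge tle q m (\<lambda>i. act g (f i)) U \<noteq> 0 \<Longrightarrow> wedge tle q m (\<lambda>i. act g0 (f i)) U \<noteq> 0"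
proof -
  define supp where "supp g = {U. wedge tle q m (\<lambda>i. act g (f i)) U \<noteq> 0}" for g
  have supp1: "supp g \<subseteq> ext_terms m q" for g
    unfolding supp_def using wedge_eq_0_outside by blast
  have supp2: "finite (supp g)" for g
    by (rule finite_subset[OF supp1 finite_ext_terms])
  note supp = supp1 supp2
  have bound: "card (supp g) \<le> card (ext_terms m q :: 'v trm set set)" for g
    using supp(1) finite_ext_terms by (intro card_mono)
  have "invertible (Finite_Cartesian_Product.mat 1 :: ('a, 'v) sq_mat)"
    unfolding invertible_def by (rule exI[of _ "Finite_Cartesian_Product.mat 1"]) simp
  moreover have "\<forall>g. invertible g \<longrightarrow> card (supp g) < Suc (card (ext_terms m q :: 'v trm set set))"
    using bound by (simp add: less_Suc_eq_le)
  ultimately have "\<exists>g. invertible g \<and> (\<forall>h. invertible h \<longrightarrow> card (supp h) \<le> card (supp g))"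
    by (rule ex_has_greatest_nat)
  then obtain g0 where g0: "invertible g0" "\<And>g. invertible g \<Longrightarrow> card (supp g) \<le> card (supp g0)"
    by auto
  \<comment> \<open>A point of the line through \<open>g0\<close> and \<open>g1\<close> outside finitely many roots has both supports in its
    own, so a support of maximal size contains all others.\<close>
  have "supp g1 \<subseteq> supp g0" if g1: "invertible g1" for g1
  proof -
    let ?line = "matrix_line g0 g1"
    have line01: "?line 0 = g0" "?line 1 = g1" by (simp_all add: matrix_line_def vec_eq_iff)
    obtain P D where "(\<forall>s U. wedge tle q m (\<lambda>i. act (?line s) (f i)) U = poly (P U) s) \<and>
        (\<forall>s. Determinants.det (?line s) = poly D s)"
      using act_line_polynomial[of tle q m g0 g1 f] by (elim exE)
    then have P: "\<And>s U. wedge tle q m (\<lambda>i. act (?line s) (f i)) U = poly (P U) s"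
      and D: "\<And>s. Determinants.det (?line s) = poly D s" by simp_all
    have "D \<noteq> 0" using g0(1) D[of 0] line01 by (auto simp: invertible_det_nz)
    moreover have "P U \<noteq> 0" if "U \<in> supp g0 \<union> supp g1" for U
      using that P[of 0 U] P[of 1 U] by (auto simp: line01 supp_def)
    ultimately have "D * (\<Prod>U\<in>supp g0 \<union> supp g1. P U) \<noteq> 0" using supp(2) by simp
    then obtain s where "poly (D * (\<Prod>U\<in>supp g0 \<union> supp g1. P U)) s \<noteq> 0" using ex_nonroot[OF inf] by blast
    then have "poly D s \<noteq> 0" "\<And>U. U \<in> supp g0 \<union> supp g1 \<Longrightarrow> poly (P U) s \<noteq> 0"
      using supp(2) by (auto simp: poly_prod)
    then have s: "invertible (?line s)" "supp g0 \<union> supp g1 \<subseteq> supp (?line s)"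
      using D P by (auto simp: invertible_det_nz supp_def)
    then have "supp g0 = supp (?line s)"
      using g0(2)[OF s(1)] supp(2) by (intro card_seteq) auto
    then show ?thesis using s(2) by blast
  qed
  then show ?thesis using that[OF g0(1)] by (auto simp: supp_def)
qed

section \<open>Generic leading terms\<close>

lemma ext_terms_finite: "T \<in> ext_terms m q \<Longrightarrow> finite (T :: 'v::finite trm set)"
  by (auto simp: ext_terms_def intro: finite_subset)

lemma subspace_image_act: "mp.subspace V \<Longrightarrow> mp.subspace (act g ` V)"
  for V :: "('v::finite, 'a::field) mpol set"
  unfolding mp.subspace_def by (auto simp: act_add[symmetric] act_scale[symmetric] intro: image_eqI[of 0 _ 0])

interpretation mp_mp: vector_space_pair "scale :: 'a::field \<Rightarrow> ('v, 'a) mpol \<Rightarrow> _"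
  "scale :: 'a::field \<Rightarrow> ('v, 'a) mpol \<Rightarrow> _"
  by unfold_locales

lemma linear_act: "Vector_Spaces.linear scale scale (act g :: ('v::finite, 'a::field) mpol \<Rightarrow> _)"
  by unfold_locales (simp_all add: act_add act_scale)

lemma act_span: "act g ` mp.span A = mp.span (act g ` A)" for A :: "('v::finite, 'a::field) mpol set"
  by (rule mp_mp.linear_span_image[OF linear_act, symmetric])

lemma ex_act_inverse:
  fixes g :: "('a::field, 'v::finite) sq_mat"
  assumes "invertible g"
  obtains g' where "\<And>f. act g' (act g f) = f" "\<And>f. act g (act g' f) = f"
proof -
  obtain g' where "g ** g' = Finite_Cartesian_Product.mat 1" "g' ** g = Finite_Cartesian_Product.mat 1"
    using assms by (auto simp: invertible_def)
  then show ?thesis using that[of g'] by (simp add: act_act act_mat_1)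
qed

lemma dim_image_act:
  fixes V :: "('v::finite, 'a::field) mpol set"
  assumes "invertible g" "mp.subspace V"
  shows "mp.dim (act g ` V) = mp.dim V"
proof -
  obtain g' where "\<And>f :: ('v, 'a) mpol. act g' (act g f) = f" using ex_act_inverse[OF assms(1)] by metis
  then have "inj_on (act g) V" by (rule inj_on_inverseI)
  then show ?thesis by (rule mp_mp.dim_image_eq_of_inj_on[OF linear_act assms(2)])
qed

context term_ord
begin

section \<open>Comparison of terms of the exterior power\<close>

text \<open>\<open>desc\<close> inverts the map \<open>c\<close> that counts the larger elements of
  \<open>T\<close>. This map is strictly decreasing for the term order and has values below
  \<open>card T\<close>, hence is a bijection onto the positions.\<close>

lemma
  assumes T: "finite T"
  shows bij_betw_desc: "bij_betw (desc tle T) {..<card T} T"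
    and desc_antimono: "i < j \<Longrightarrow> j < card T \<Longrightarrow> tle (desc tle T j) (desc tle T i) \<and> desc tle T j \<noteq> desc tle T i"
proof -
  define c where "c t = card {s\<in>T. tle t s \<and> s \<noteq> t}" for t
  have c_less: "c t < c s" if "s \<in> T" "t \<in> T" "tle s t" "s \<noteq> t" for s t
    unfolding c_def
  proof (rule psubset_card_mono)
    show "finite {u \<in> T. tle s u \<and> u \<noteq> s}" using T by simp
    have "tle s u \<and> u \<noteq> s" if "tle t u" "u \<noteq> t" for u
      using that \<open>tle s t\<close> \<open>s \<noteq> t\<close> ord.order_trans ord.order.antisym by blast
    then show "{u \<in> T. tle t u \<and> u \<noteq> t} \<subset> {u \<in> T. tle s u \<and> u \<noteq> s}"
      using that by (intro psubsetI) auto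
  qed
  have c_iff: "c t < c s \<longleftrightarrow> tle s t \<and> s \<noteq> t" if "s \<in> T" "t \<in> T" for s t
    using c_less[of s t] c_less[of t s] that ord.linear[of s t] by force
  have inj: "inj_on c T"
    by (rule inj_onI) (metis c_iff less_irrefl ord.linear)
  have c_lt: "c t < card T" if "t \<in> T" for t
    unfolding c_def using that T by (intro psubset_card_mono) auto
  have im: "c ` T = {..<card T}"
    using c_lt card_image[OF inj] by (intro card_subset_eq) auto
  have desc_c: "desc tle T (c t) = t" if "t \<in> T" for t
    unfolding desc_def c_def[symmetric] using that inj by (intro the_equality) (auto dest: inj_onD)
  have ex: "\<exists>t\<in>T. c t = i" if "i < card T" for i
    using that im by (metis imageE lessThan_iff)
  have c_desc: "c (desc tle T i) = i" if "i < card T" for i using ex[OF that] desc_c by auto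
  have desc_in: "desc tle T i \<in> T" if "i < card T" for i using ex[OF that] desc_c by auto
  show "bij_betw (desc tle T) {..<card T} T"
    by (rule bij_betw_byWitness[where f' = c]) (auto simp: c_desc desc_c desc_in c_lt)
  show "tle (desc tle T j) (desc tle T i) \<and> desc tle T j \<noteq> desc tle T i" if "i < j" "j < card T"
    using c_iff[of "desc tle T j" "desc tle T i"] that desc_in c_desc by simp
qed

lemma desc_in: "T \<in> ext_terms m q \<Longrightarrow> i < q \<Longrightarrow> desc tle T i \<in> T"
  using bij_betw_desc[OF ext_terms_finite[of T m q]] by (auto simp: ext_terms_def bij_betw_def)

lemma desc_image: "T \<in> ext_terms m q \<Longrightarrow> desc tle T ` {..<q} = T"
  using bij_betw_desc[OF ext_terms_finite[of T m q]] by (auto simp: ext_terms_def bij_betw_def)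

lemma bij_betw_desc_ext_terms: "T \<in> ext_terms m q \<Longrightarrow> bij_betw (desc tle T) {..<q} T"
  using bij_betw_desc[OF ext_terms_finite[of T m q]] by (simp add: ext_terms_def)

lemma ext_le_permutesI:
  assumes T: "T \<in> ext_terms m q" and U: "U \<in> ext_terms m q" and \<pi>: "\<pi> permutes {0..<q}"
    and le: "\<And>i. i < q \<Longrightarrow> tle (desc tle T i) (desc tle U (\<pi> i))"
  shows "ext_le tle T U"
proof -
  have bT: "bij_betw (desc tle T) {..<q} T" and bU: "bij_betw (desc tle U) {..<q} U"
    by (rule bij_betw_desc_ext_terms[OF T], rule bij_betw_desc_ext_terms[OF U])
  let ?c = "inv_into {..<q} (desc tle T)"
  have "bij_betw ?c T {..<q}" using bT by (rule bij_betw_inv_into)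
  moreover have "bij_betw \<pi> {..<q} {..<q}" using permutes_imp_bij[OF \<pi>] by (simp add: atLeast0LessThan)
  ultimately have "bij_betw (desc tle U \<circ> \<pi> \<circ> ?c) T U" using bU by (intro bij_betw_trans)
  moreover have "tle t ((desc tle U \<circ> \<pi> \<circ> ?c) t)" if "t \<in> T" for t
  proof -
    have "?c t < q" "desc tle T (?c t) = t"
      using bT that bij_betw_inv_into[OF bT] by (auto simp: bij_betw_def f_inv_into_f)
    then show ?thesis using le[of "?c t"] by simp
  qed
  ultimately show ?thesis by (auto simp: ext_le_def)
qed

lemma wedge_nonzero_permutes:
  assumes "wedge tle q m f U \<noteq> 0"
  obtains \<pi> where "\<pi> permutes {0..<q}" "\<And>i. i < q \<Longrightarrow> desc tle U (\<pi> i) \<in> Poly_Mapping.keys (f i)"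
proof -
  have "Determinant.det (Matrix.mat q q (\<lambda>(i, j). Poly_Mapping.lookup (f i) (desc tle U j))) \<noteq> 0"
    using assms by (simp add: wedge_def split: if_splits)
  then show ?thesis by (rule det_nonzero_permutes) (use that in \<open>simp add: in_keys_iff\<close>)
qed

text \<open>A nonzero Leibniz summand assigns to each position \<open>i\<close> a term of
  \<open>U\<close> in the support of \<open>f i\<close>; this assignment is the bijection that the
  order asks for.\<close>

lemma ext_le_of_wedge_lower:
  assumes T: "T \<in> ext_terms m q" and nz: "wedge tle q m f U \<noteq> 0"
    and le: "\<And>i u. i < q \<Longrightarrow> u \<in> Poly_Mapping.keys (f i) \<Longrightarrow> tle (desc tle T i) u"
  shows "ext_le tle T U"
proof -
  obtain \<pi> where "\<pi> permutes {0..<q}" "\<And>i. i < q \<Longrightarrow> desc tle U (\<pi> i) \<in> Poly_Mapping.keys (f i)"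
    using wedge_nonzero_permutes[OF nz] by metis
  moreover have "U \<in> ext_terms m q" using nz wedge_eq_0_outside by metis
  ultimately show ?thesis using T le by (intro ext_le_permutesI[of T m q U \<pi>]) auto
qed

lemma ext_le_of_wedge_upper:
  assumes T: "T \<in> ext_terms m q" and nz: "wedge tle q m f U \<noteq> 0"
    and le: "\<And>i u. i < q \<Longrightarrow> u \<in> Poly_Mapping.keys (f i) \<Longrightarrow> tle u (desc tle T i)"
  shows "ext_le tle U T"
proof -
  obtain \<pi> where \<pi>: "\<pi> permutes {0..<q}" "\<And>i. i < q \<Longrightarrow> desc tle U (\<pi> i) \<in> Poly_Mapping.keys (f i)"
    using wedge_nonzero_permutes[OF nz] by metis
  have inv: "Hilbert_Choice.inv \<pi> permutes {0..<q}" using \<pi>(1) by (rule permutes_inv)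
  have U: "U \<in> ext_terms m q" using nz wedge_eq_0_outside by metis
  show ?thesis
  proof (rule ext_le_permutesI[OF U T inv])
    fix i assume "i < q"
    then have "Hilbert_Choice.inv \<pi> i < q" using permutes_in_image[OF inv, of i] by simp
    then show "tle (desc tle U i) (desc tle T (Hilbert_Choice.inv \<pi> i))"
      using \<pi>(2) le permutes_inverses(1)[OF \<pi>(1)] by metis
  qed
qed

text \<open>The total rank cannot drop from \<open>T\<close> to \<open>U\<close> nor from
  \<open>U\<close> to \<open>T\<close>, so it is constant. A single strict increase under
  \<open>\<omega>\<close> would raise it, hence \<open>\<omega>\<close> is the identity.\<close>

lemma ext_le_antisym:
  assumes T: "T \<in> ext_terms m q" and U: "U \<in> ext_terms m q"
    and TU: "ext_le tle T U" and UT: "ext_le tle U T"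
  shows "T = U"
proof -
  obtain \<omega> where \<omega>: "bij_betw \<omega> T U" "\<And>t. t \<in> T \<Longrightarrow> tle t (\<omega> t)" using TU by (auto simp: ext_le_def)
  obtain \<eta> where \<eta>: "bij_betw \<eta> U T" "\<And>t. t \<in> U \<Longrightarrow> tle t (\<eta> t)" using UT by (auto simp: ext_le_def)
  have TUm: "T \<subseteq> terms m" "U \<subseteq> terms m" using T U by (auto simp: ext_terms_def)
  have fin: "finite T" using T by (rule ext_terms_finite)
  have \<omega>U: "\<omega> t \<in> U" if "t \<in> T" for t using \<omega>(1) that by (auto simp: bij_betw_def)
  have \<eta>T: "\<eta> t \<in> T" if "t \<in> U" for t using \<eta>(1) that by (auto simp: bij_betw_def)
  have rank\<omega>: "rank t \<le> rank (\<omega> t)" if "t \<in> T" for t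
    using rank_le_iff[of t "\<omega> t"] \<omega>(2)[OF that] \<omega>U[OF that] that TUm by (auto simp: terms_def)
  have rank\<eta>: "rank t \<le> rank (\<eta> t)" if "t \<in> U" for t
    using rank_le_iff[of t "\<eta> t"] \<eta>(2)[OF that] \<eta>T[OF that] that TUm by (auto simp: terms_def)
  have "(\<Sum>t\<in>T. rank (\<omega> t)) = (\<Sum>t\<in>U. rank t)" by (rule sum.reindex_bij_betw[OF \<omega>(1)])
  also have "\<dots> \<le> (\<Sum>t\<in>U. rank (\<eta> t))" using rank\<eta> by (rule sum_mono)
  also have "\<dots> = (\<Sum>t\<in>T. rank t)" by (rule sum.reindex_bij_betw[OF \<eta>(1)])
  finally have le: "(\<Sum>t\<in>T. rank (\<omega> t)) \<le> (\<Sum>t\<in>T. rank t)" .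
  have "\<omega> t = t" if t: "t \<in> T" for t
  proof (rule ccontr)
    assume "\<omega> t \<noteq> t"
    then have "rank t < rank (\<omega> t)"
      using rank_less[of t "\<omega> t"] \<omega>(2)[OF t] \<omega>U[OF t] t TUm by (auto simp: terms_def)
    then have "(\<Sum>t\<in>T. rank t) < (\<Sum>t\<in>T. rank (\<omega> t))"
      using fin rank\<omega> t by (intro sum_strict_mono_ex1) auto
    then show False using le by simp
  qed
  then have "\<omega> ` T = T" by auto
  then show ?thesis using \<omega>(1) by (simp add: bij_betw_def)
qed

text \<open>Columns are listed in descending order, so left of the diagonal stand coefficients of
  terms larger than the leading term of the row. The matrix is triangular with the leading
  coefficients on its diagonal.\<close>

lemma wedge_leading_nonzero:
  fixes f :: "nat \<Rightarrow> ('v, 'a::field) mpol"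
  assumes T: "T \<in> ext_terms m q"
    and lead: "\<And>i. i < q \<Longrightarrow> desc tle T i \<in> Poly_Mapping.keys (f i)"
    and le: "\<And>i u. i < q \<Longrightarrow> u \<in> Poly_Mapping.keys (f i) \<Longrightarrow> tle u (desc tle T i)"
  shows "wedge tle q m f T = (\<Prod>i<q. Poly_Mapping.lookup (f i) (desc tle T i))"
proof -
  let ?M = "Matrix.mat q q (\<lambda>(i, j). Poly_Mapping.lookup (f i) (desc tle T j))"
  have "Poly_Mapping.lookup (f i) (desc tle T j) = 0" if "i < q" "j < i" for i j
  proof (rule ccontr)
    assume "Poly_Mapping.lookup (f i) (desc tle T j) \<noteq> 0"
    then have "tle (desc tle T j) (desc tle T i)" using le[OF that(1)] by (simp add: in_keys_iff)
    moreover have "tle (desc tle T i) (desc tle T j) \<and> desc tle T i \<noteq> desc tle T j"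
      using desc_antimono[OF ext_terms_finite[OF T] that(2)] that(1) T by (simp add: ext_terms_def)
    ultimately show False using ord.order.antisym by blast
  qed
  then have "Matrix.upper_triangular ?M" by (auto simp: Matrix.upper_triangular_def)
  then have "Determinant.det ?M = prod_list (diag_mat ?M)" by (rule det_upper_triangular[where n = q]) simp
  also have "\<dots> = (\<Prod>i<q. Poly_Mapping.lookup (f i) (desc tle T i))"
    by (simp add: diag_mat_def prod.distinct_set_conv_list[symmetric] atLeast0LessThan)
  finally show ?thesis using T by (simp add: wedge_def)
qed

lemma wedge_monomials:
  assumes T: "T \<in> ext_terms m q"
  shows "wedge tle q m (\<lambda>i. monomial (desc tle T i)) U = (if U = T then 1 else 0 :: 'a::field)"
proof (cases "U = T")
  case True
  have "wedge tle q m (\<lambda>i. monomial (desc tle T i) :: ('v, 'a) mpol) T =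
      (\<Prod>i<q. Poly_Mapping.lookup (monomial (desc tle T i) :: ('v, 'a) mpol) (desc tle T i))"
    using T by (intro wedge_leading_nonzero) (auto simp: keys_monomial)
  then show ?thesis using True by (simp add: lookup_monomial)
next
  case False
  have "wedge tle q m (\<lambda>i. monomial (desc tle T i) :: ('v, 'a) mpol) U = 0"
  proof (rule ccontr)
    assume nz: "\<not> ?thesis"
    have "ext_le tle T U" by (rule ext_le_of_wedge_lower[OF T nz]) (simp add: keys_monomial)
    moreover have "ext_le tle U T" by (rule ext_le_of_wedge_upper[OF T nz]) (simp add: keys_monomial)
    moreover have "U \<in> ext_terms m q" using nz wedge_eq_0_outside by metis
    ultimately show False using ext_le_antisym[OF T] False by metis
  qed
  then show ?thesis using False by simp
qed

section \<open>Degeneration to the leading terms\<close>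

text \<open>An algebraic substitute for the limit of the torus orbit of the family at the monomial
  space of \<open>T\<close>: a coordinate that is nonzero for \<open>h\<close> applied to the limit
  is nonzero for \<open>h\<close> applied to some point of the orbit. The full torus is used, so the
  term order need not be represented by a weight vector.\<close>

lemma ex_torus_nonvanishing:
  fixes f :: "nat \<Rightarrow> ('v, 'a::field) mpol" and h :: "('a, 'v) sq_mat"
  assumes inf: "infinite (UNIV :: 'a set)" and T: "T \<in> ext_terms m q"
    and forms: "\<And>i. i < q \<Longrightarrow> f i \<in> forms m"
    and lead: "\<And>i. i < q \<Longrightarrow> desc tle T i \<in> Poly_Mapping.keys (f i)"
    and le: "\<And>i u. i < q \<Longrightarrow> u \<in> Poly_Mapping.keys (f i) \<Longrightarrow> tle u (desc tle T i)"
    and nz: "wedge tle q m (\<lambda>i. act h (monomial (desc tle T i))) U \<noteq> 0"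
  obtains \<delta> where "\<And>i. \<delta> i \<noteq> 0" "wedge tle q m (\<lambda>i. act h (act (diagonal \<delta>) (f i))) U \<noteq> 0"
proof -
  have U: "U \<in> ext_terms m q" using nz wedge_eq_0_outside by metis
  define l where "l t j = Poly_Mapping.lookup (monact h t) (desc tle U j)" for t j
  define d where "d \<phi> = Determinant.det (Matrix.mat q q (\<lambda>(i, j). l (\<phi> i) j))" for \<phi>
  \<comment> \<open>A choice \<open>\<phi>\<close> takes one term from each row. In the expansion of
    the coordinate \<open>U\<close>, \<open>a \<phi>\<close> is its coefficient and
    \<open>w \<phi>\<close> the exponent of its torus character; \<open>\<tau>\<close> chooses the
    leading terms.\<close>
  define N where "N = PiE {0..<q} (\<lambda>_. terms m :: 'v trm set)"
  define a where "a \<phi> = (\<Prod>i = 0..<q. Poly_Mapping.lookup (f i) (\<phi> i)) * d \<phi>" for \<phi>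
  define w where "w \<phi> = Poly_Mapping.lookup (\<Sum>i = 0..<q. \<phi> i)" for \<phi> :: "nat \<Rightarrow> 'v trm"
  define \<tau> where "\<tau> = restrict (desc tle T) {0..<q}"
  have finN: "finite N" unfolding N_def by (intro finite_PiE) auto
  have "desc tle T i \<in> terms m" if "i < q" for i using desc_in[OF T that] T by (auto simp: ext_terms_def)
  then have \<tau>N: "\<tau> \<in> N" by (auto simp: \<tau>_def N_def)
  have d\<tau>: "d \<tau> \<noteq> 0"
  proof -
    have "Matrix.mat q q (\<lambda>(i, j). l (\<tau> i) j) =
        Matrix.mat q q (\<lambda>(i, j). Poly_Mapping.lookup (act h (monomial (desc tle T i))) (desc tle U j))"
      by (intro eq_matI) (auto simp: l_def \<tau>_def act_monomial)
    then show ?thesis using nz U by (simp add: d_def wedge_def)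
  qed
  have a\<tau>: "a \<tau> \<noteq> 0" using lead d\<tau> by (simp add: a_def \<tau>_def in_keys_iff)
  \<comment> \<open>The torus weight of \<open>\<tau>\<close> occurs only once: terms \<open>\<phi> i \<preceq> \<tau> i\<close> with the same sum agree.\<close>
  have a0: "a \<phi> = 0" if \<phi>: "\<phi> \<in> N" "w \<phi> = w \<tau>" "\<phi> \<noteq> \<tau>" for \<phi>
  proof (rule ccontr)
    assume "a \<phi> \<noteq> 0"
    then have "(\<Prod>i = 0..<q. Poly_Mapping.lookup (f i) (\<phi> i)) \<noteq> 0" by (auto simp: a_def)
    then have keys: "\<phi> i \<in> Poly_Mapping.keys (f i)" if "i < q" for i using that by (simp add: in_keys_iff)
    have le\<tau>: "tle (\<phi> i) (\<tau> i)" if "i \<in> {0..<q}" for i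
      using that le[OF _ keys, of i] by (simp add: \<tau>_def)
    have sums: "(\<Sum>i = 0..<q. \<phi> i) = (\<Sum>i = 0..<q. \<tau> i)"
      using \<phi>(2) unfolding w_def poly_mapping.lookup_inject .
    have "\<phi> i = \<tau> i" if "i \<in> {0..<q}" for i
      by (rule tle_sum_eqD[OF finite_atLeastLessThan le\<tau> sums that])
    then have "\<phi> = \<tau>" using \<phi>(1) \<tau>N unfolding N_def by (intro PiE_ext) auto
    then show False using \<phi>(3) by simp
  qed
  have "(\<Sum>\<phi>\<in>{\<phi>\<in>N. w \<phi> = w \<tau>}. a \<phi>) = (\<Sum>\<phi>\<in>{\<tau>}. a \<phi>)"
    by (rule sum.mono_neutral_right) (use finN \<tau>N a0 in auto)
  then have "(\<Sum>\<phi>\<in>{\<phi>\<in>N. w \<phi> = w \<tau>}. a \<phi>) \<noteq> 0" using a\<tau> by simp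
  from ex_nonvanishing_weighted_sum[OF inf finN this]
  obtain \<delta> where \<delta>: "\<forall>i. \<delta> i \<noteq> 0" "(\<Sum>\<phi>\<in>N. a \<phi> * (\<Prod>v\<in>UNIV. \<delta> v ^ w \<phi> v)) \<noteq> 0" by auto
  define \<delta>t where "\<delta>t t = (\<Prod>v\<in>UNIV. \<delta> v ^ Poly_Mapping.lookup t v)" for t
  have \<delta>t_sum: "\<delta>t (\<Sum>i\<in>I. g i) = (\<Prod>i\<in>I. \<delta>t (g i))" for I and g :: "nat \<Rightarrow> 'v trm"
    by (induction I rule: infinite_finite_induct)
       (simp_all add: \<delta>t_def lookup_add power_add prod.distrib)
  have "wedge tle q m (\<lambda>i. act h (act (diagonal \<delta>) (f i))) U =
      Determinant.det (Matrix.mat q q (\<lambda>(i, j). \<Sum>t\<in>terms m. (Poly_Mapping.lookup (f i) t * \<delta>t t) * l t j))"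
  proof -
    have "Poly_Mapping.lookup (act h (act (diagonal \<delta>) (f i))) (desc tle U j) =
        (\<Sum>t\<in>terms m. (Poly_Mapping.lookup (f i) t * \<delta>t t) * l t j)" if "i < q" for i j
    proof -
      have "Poly_Mapping.keys (f i) \<subseteq> terms m"
        using forms[OF that] by (auto simp: forms_def homogeneous_def terms_def)
      then have "act (diagonal \<delta>) (f i) = (\<Sum>t\<in>terms m. const (Poly_Mapping.lookup (f i) t * \<delta>t t) * monomial t)"
        by (simp add: act_superset[of "terms m"] monact_diagonal scale_def const_mult \<delta>t_def mult.assoc)
      then have "act h (act (diagonal \<delta>) (f i)) = (\<Sum>t\<in>terms m. scale (Poly_Mapping.lookup (f i) t * \<delta>t t) (monact h t))"
        by (simp add: act_sum act_mult act_monomial scale_def)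
      then show ?thesis by (simp add: lookup_sum lookup_scale l_def)
    qed
    then show ?thesis using U by (auto simp: wedge_def intro!: arg_cong[where f = Determinant.det] eq_matI)
  qed
  also have "\<dots> = (\<Sum>\<phi>\<in>N. a \<phi> * (\<Prod>v\<in>UNIV. \<delta> v ^ w \<phi> v))"
    unfolding det_rows_sum_expand[OF finite_terms] N_def[symmetric]
    by (intro sum.cong refl) (simp add: prod.distrib a_def d_def w_def \<delta>t_def[symmetric] \<delta>t_sum mult_ac)
  finally show ?thesis using that \<delta> by metis
qed

lemma ex_generic_leading_term:
  fixes f :: "nat \<Rightarrow> ('v, 'a::field) mpol"
  assumes inf: "infinite (UNIV :: 'a set)"
    and V: "mp.subspace V" "V \<subseteq> forms m" "mp.dim V = q" "mp.span (f ` {..<q}) = V"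
  obtains g T where "invertible g" "T = leading (act g ` V)" "T \<in> ext_terms m q"
    "\<And>U. wedge tle q m f U \<noteq> 0 \<Longrightarrow> ext_le tle U T"
    "\<And>(h :: ('a, 'v) sq_mat) U. invertible h \<Longrightarrow> upper_triangular h \<Longrightarrow>
       wedge tle q m (\<lambda>i. act h (monomial (desc tle T i))) U \<noteq> 0 \<Longrightarrow> U = T"
proof -
  obtain g :: "('a, 'v) sq_mat" where g: "invertible g"
    "\<And>h U. invertible h \<Longrightarrow> wedge tle q m (\<lambda>i. act h (f i)) U \<noteq> 0 \<Longrightarrow> wedge tle q m (\<lambda>i. act g (f i)) U \<noteq> 0"
    using ex_generic_matrix[OF inf, of tle q m f] by metis
  define W where "W = act g ` V"
  define T where "T = leading W"
  have W: "mp.subspace W" "W \<subseteq> forms m" "mp.dim W = q"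
    unfolding W_def using V dim_image_act[OF g(1) V(1)] subspace_image_act[OF V(1)]
    by (auto simp: forms_def intro: homogeneous_act)
  have T: "T \<in> ext_terms m q"
    using dim_eq_card_leading[OF W(1,2)] leading_subset_terms[OF W(2)] W(3) by (simp add: ext_terms_def T_def)
  have "\<forall>t\<in>T. \<exists>e. e \<in> W \<and> t \<in> Poly_Mapping.keys e \<and> (\<forall>s\<in>Poly_Mapping.keys e. tle s t)"
    by (auto simp: T_def leading_def)
  then obtain e where e: "\<And>t. t \<in> T \<Longrightarrow> e t \<in> W \<and> t \<in> Poly_Mapping.keys (e t) \<and> (\<forall>s\<in>Poly_Mapping.keys (e t). tle s t)"
    by metis
  define f' where "f' i = e (desc tle T i)" for i
  have f': "f' i \<in> W" "desc tle T i \<in> Poly_Mapping.keys (f' i)"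
    "\<And>u. u \<in> Poly_Mapping.keys (f' i) \<Longrightarrow> tle u (desc tle T i)" if "i < q" for i
    using e[OF desc_in[OF T that]] by (auto simp: f'_def)
  have "f' ` {..<q} = e ` T" using desc_image[OF T] by (auto simp: f'_def image_image[symmetric])
  then have span': "mp.span (f' ` {..<q}) = W"
    using leading_basis[OF W(1,2), folded T_def, OF e] by simp
  have "W = act g ` mp.span (f ` {..<q})" by (simp add: W_def V(4))
  also have "\<dots> = mp.span ((\<lambda>i. act g (f i)) ` {..<q})" by (simp add: act_span image_image)
  finally have span: "mp.span ((\<lambda>i. act g (f i)) ` {..<q}) = W" by simp
  have fW: "act g (f i) \<in> W" if "i < q" for i unfolding span[symmetric] by (rule mp.span_base) (use that in simp)
  have upper: "ext_le tle U T" if h: "invertible h" "wedge tle q m (\<lambda>i. act h (f i)) U \<noteq> 0" for h U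
  proof -
    have "wedge tle q m (\<lambda>i. act g (f i)) U \<noteq> 0" using g(2)[OF h] .
    \<comment> \<open>The identity matrix brings the family into the shape of
      \<open>wedge_act_span\<close>, which replaces it by the echelon basis \<open>f'\<close> of the
      same space.\<close>
    then have "wedge tle q m (\<lambda>i. act (Finite_Cartesian_Product.mat 1) (act g (f i))) U \<noteq> 0"
      by (simp only: act_mat_1 not_False_eq_True)
    then have "wedge tle q m (\<lambda>i. act (Finite_Cartesian_Product.mat 1) (f' i)) U \<noteq> 0"
      by (rule wedge_act_span[rotated]) (simp add: span' fW)
    then have "wedge tle q m f' U \<noteq> 0" by (simp only: act_mat_1 not_False_eq_True)
    then show ?thesis by (rule ext_le_of_wedge_upper[OF T]) (rule f'(3))
  qed
  have inv1: "invertible (Finite_Cartesian_Product.mat 1 :: ('a, 'v) sq_mat)"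
    unfolding invertible_def by (rule exI[of _ "Finite_Cartesian_Product.mat 1"]) simp
  show ?thesis
  proof (rule that[OF g(1)])
    show "T = leading (act g ` V)" by (simp add: T_def W_def)
    show "T \<in> ext_terms m q" by (rule T)
    show "ext_le tle U T" if "wedge tle q m f U \<noteq> 0" for U
      using upper[OF inv1, of U] that by (simp add: act_mat_1)
  next
    fix h :: "('a, 'v) sq_mat" and U
    assume h: "invertible h" "upper_triangular h"
      and nz: "wedge tle q m (\<lambda>i. act h (monomial (desc tle T i))) U \<noteq> 0"
    have "f' i \<in> forms m" if "i < q" for i using f'(1)[OF that] W(2) by blast
    then obtain \<delta> where \<delta>: "\<And>i. \<delta> i \<noteq> 0" "wedge tle q m (\<lambda>i. act h (act (diagonal \<delta>) (f' i))) U \<noteq> 0"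
      using ex_torus_nonvanishing[OF inf T _ f'(2) f'(3) nz] by metis
    have "wedge tle q m (\<lambda>i. act (diagonal \<delta> ** h) (f' i)) U \<noteq> 0" using \<delta>(2) by (simp add: act_act)
    then have "wedge tle q m (\<lambda>i. act (diagonal \<delta> ** h) (act g (f i))) U \<noteq> 0"
      by (rule wedge_act_span[rotated]) (simp add: span f'(1))
    \<comment> \<open>The torus element and \<open>h\<close> are merged with \<open>g\<close> into
      one matrix, so \<open>upper\<close> applies to the original family \<open>f\<close>.\<close>
    then have "wedge tle q m (\<lambda>i. act (g ** (diagonal \<delta> ** h)) (f i)) U \<noteq> 0" by (simp add: act_act)
    moreover have "invertible (g ** (diagonal \<delta> ** h))"
      by (intro invertible_mult g(1) invertible_diagonal \<delta>(1) h(1))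
    ultimately have UT: "ext_le tle U T" by (rule upper[rotated])
    have "ext_le tle T U"
      by (rule ext_le_of_wedge_lower[OF T nz]) (use keys_monact_upper_triangular[OF h(2)] in \<open>simp add: act_monomial\<close>)
    moreover have "U \<in> ext_terms m q" using nz wedge_eq_0_outside by metis
    ultimately show "U = T" using ext_le_antisym[OF T] UT by metis
  qed
qed

end

section \<open>Components of the Hilbert scheme\<close>

lemma irreducible_in_meets:
  assumes Z: "irreducible_in S Z" and U: "openin S U" "x \<in> Z" "x \<in> U" and V: "openin S V" "y \<in> Z" "y \<in> V"
  obtains z where "z \<in> Z" "z \<in> U" "z \<in> V"
proof -
  have sub: "Z \<subseteq> topspace S" using Z by (simp add: irreducible_in_def)
  have "\<not> Z \<subseteq> (topspace S - U) \<union> (topspace S - V)"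
  proof
    assume "Z \<subseteq> (topspace S - U) \<union> (topspace S - V)"
    moreover have "closedin S (topspace S - U)" "closedin S (topspace S - V)" using U V by auto
    ultimately have "Z \<subseteq> topspace S - U \<or> Z \<subseteq> topspace S - V" using Z unfolding irreducible_in_def by blast
    then show False using U V by blast
  qed
  then show ?thesis using sub that by blast
qed

lemma irreducible_in_singleton: "x \<in> topspace S \<Longrightarrow> irreducible_in S {x}"
  by (auto simp: irreducible_in_def)

text \<open>A member \<open>Z0\<close> not contained in \<open>A\<close> is contained in
  \<open>B\<close>. Smaller members follow it into \<open>B\<close>; larger ones are not contained
  in \<open>A\<close> either, hence lie in \<open>B\<close> too.\<close>

lemma irreducible_in_Union_chain:
  assumes ne: "C \<noteq> {}" and irr: "\<And>Z. Z \<in> C \<Longrightarrow> irreducible_in S Z"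
    and chain: "\<And>Z Z'. Z \<in> C \<Longrightarrow> Z' \<in> C \<Longrightarrow> Z \<subseteq> Z' \<or> Z' \<subseteq> Z"
  shows "irreducible_in S (\<Union>C)"
  unfolding irreducible_in_def
proof (intro conjI allI impI)
  show "\<Union>C \<subseteq> topspace S" using irr by (auto simp: irreducible_in_def)
  show "\<Union>C \<noteq> {}" using ne irr by (auto simp: irreducible_in_def)
next
  fix A B assume AB: "closedin S A \<and> closedin S B \<and> \<Union>C \<subseteq> A \<union> B"
  have split: "Z \<subseteq> A \<or> Z \<subseteq> B" if "Z \<in> C" for Z
  proof -
    have "Z \<subseteq> A \<union> B" using AB that by blast
    then show ?thesis using AB irr[OF that] unfolding irreducible_in_def by blast
  qed
  show "\<Union>C \<subseteq> A \<or> \<Union>C \<subseteq> B"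
  proof (cases "\<exists>Z0\<in>C. \<not> Z0 \<subseteq> A")
    case True
    then obtain Z0 where Z0: "Z0 \<in> C" "\<not> Z0 \<subseteq> A" by blast
    then have "Z0 \<subseteq> B" using split by blast
    have "Z \<subseteq> B" if "Z \<in> C" for Z
      using chain[OF that Z0(1)] split[OF that] Z0(2) \<open>Z0 \<subseteq> B\<close> by blast
    then show ?thesis by blast
  qed blast
qed

text \<open>Zorn's lemma on the irreducible sets through \<open>x\<close>. A set that is maximal
  among these is maximal among all, since every larger set contains \<open>x\<close>.\<close>

lemma ex_irreducible_component:
  assumes "x \<in> topspace S"
  shows "\<exists>Z\<in>irreducible_components S. x \<in> Z"
proof -
  define F where "F = {Z. irreducible_in S Z \<and> x \<in> Z}"
  have "{x} \<in> F" using irreducible_in_singleton[OF assms] by (simp add: F_def)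
  then have "F \<noteq> {}" by blast
  moreover have "\<Union>C \<in> F" if C: "C \<noteq> {}" "subset.chain F C" for C
  proof -
    have CF: "C \<subseteq> F" and ch: "\<And>Z Z'. Z \<in> C \<Longrightarrow> Z' \<in> C \<Longrightarrow> Z \<subseteq> Z' \<or> Z' \<subseteq> Z"
      using C(2) by (auto simp: subset_chain_def)
    have "irreducible_in S (\<Union>C)"
      by (rule irreducible_in_Union_chain[OF C(1) _ ch]) (use CF in \<open>auto simp: F_def\<close>)
    moreover have "x \<in> \<Union>C" using C(1) CF by (auto simp: F_def)
    ultimately show ?thesis by (simp add: F_def)
  qed
  ultimately obtain M where M: "M \<in> F" "\<forall>Z\<in>F. M \<subseteq> Z \<longrightarrow> Z = M" using subset_Zorn_nonempty[of F] by blast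
  then have "M \<in> irreducible_components S" by (auto simp: F_def irreducible_components_def)
  then show ?thesis using M(1) by (auto simp: F_def)
qed

section \<open>The Zariski topology and the universal domain\<close>

lemma openin_zariski: "openin (zariski Y) {P \<in> Y. F \<notin> P}"
  unfolding zariski_def by (rule topology_generated_by_Basis) blast

text \<open>The space of a generated topology is the union of its generators, so a point of
  \<open>Y\<close> needs a witness \<open>F\<close> outside the ideal.\<close>

lemma in_topspace_zariski: "P \<in> Y \<Longrightarrow> F \<notin> P \<Longrightarrow> P \<in> topspace (zariski Y)"
  using openin_subset[OF openin_zariski[of Y F]] by blast

lemma comm_ring_hom_univ_emb: "comm_ring_hom (univ_emb :: 'a::field \<Rightarrow> 'a univ_dom)"
  by unfold_locales
     (simp_all add: univ_emb_def const_add const_mult flip: Zero_fract_def One_fract_def to_ac_add to_ac_mult)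

lemma univ_emb_eq_iff: "univ_emb c = univ_emb d \<longleftrightarrow> c = d"
  by (auto simp: univ_emb_def eq_fract const_def) (metis lookup_single_eq)

lemma infinite_univ_dom:
  assumes "infinite (UNIV :: 'a::field set)"
  shows "infinite (UNIV :: 'a univ_dom set)"
proof
  assume "finite (UNIV :: 'a univ_dom set)"
  then have "finite (range (univ_emb :: 'a \<Rightarrow> 'a univ_dom))" by (rule rev_finite_subset) simp
  moreover have "inj (univ_emb :: 'a \<Rightarrow> 'a univ_dom)" by (rule injI) (simp only: univ_emb_eq_iff)
  ultimately show False using assms by (rule finite_imageD[THEN notE[rotated]])
qed

text \<open>The link between topology and linear algebra: the basic open set of the variable
  \<open>U\<close> is the locus where the Pluecker coordinate \<open>U\<close> does not
  vanish.\<close>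

lemma var_in_proj_point_iff: "var i \<in> proj_point y \<longleftrightarrow> y i = 0"
  for y :: "'i \<Rightarrow> 'a::field univ_dom"
proof -
  interpret comm_ring_hom "univ_emb :: 'a \<Rightarrow> _" by (rule comm_ring_hom_univ_emb)
  have "homogeneous 1 (var i :: ('i, 'a) mpol)"
    by (simp add: homogeneous_def var_def keys_monomial deg_def)
  then have "hcomp d (var i) = (if d = 1 then var i else (0 :: ('i, 'a) mpol))" for d
    by (rule hcomp_homogeneous)
  moreover have "mpeval univ_emb y (var i) = y i"
    by (simp add: mpeval_def var_def keys_monomial lookup_monomial)
  moreover have "mpeval univ_emb y 0 = 0" by (simp add: mpeval_def)
  ultimately show ?thesis by (simp add: proj_point_def)
qed

section \<open>Transformed ideals and monomial bases\<close>

lemma hcomp_act: "hcomp d (act g f) = act g (hcomp d f)"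
proof (induction f rule: mpol_induct)
  case (single t c)
  have "homogeneous (deg t) (Poly_Mapping.single t c)" by (auto simp: homogeneous_def split: if_splits)
  then show ?case by (simp add: hcomp_homogeneous[OF homogeneous_act] hcomp_homogeneous)
qed (simp add: act_add hcomp_add)

lemma image_act_inter_forms:
  fixes I :: "('v::finite, 'a::field) mpol set"
  assumes "invertible g"
  shows "act g ` I \<inter> forms d = act g ` (I \<inter> forms d)"
proof -
  obtain g' where g': "\<And>f :: ('v, 'a) mpol. act g' (act g f) = f" using ex_act_inverse[OF assms] by metis
  have "homogeneous d (act g f) \<longleftrightarrow> homogeneous d f" for f :: "('v, 'a) mpol"
    using homogeneous_act[of d "act g f" g'] homogeneous_act[of d f g] g' by auto
  then show ?thesis by (auto simp: forms_def)
qed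

lemma homogeneous_ideal_image_act:
  fixes I :: "('v::finite, 'a::field) mpol set"
  assumes g: "invertible g" and I: "homogeneous_ideal I"
  shows "homogeneous_ideal (act g ` I)"
proof -
  obtain g' where g': "\<And>f :: ('v, 'a) mpol. act g (act g' f) = f" using ex_act_inverse[OF g] by metis
  have "c * act g f = act g (act g' c * f)" for c f by (simp add: act_mult g')
  then show ?thesis using I unfolding homogeneous_ideal_iff
    by (auto simp: hcomp_act act_add[symmetric] intro: image_eqI[of 0 _ 0])
qed

lemma has_hilbert_polynomial_image_act:
  fixes I :: "('v::finite, 'a::field) mpol set"
  assumes "invertible g" "homogeneous_ideal I" "has_hilbert_polynomial I p"
  shows "has_hilbert_polynomial (act g ` I) p"
proof -
  have "mp.dim (act g ` I \<inter> forms d) = mp.dim (I \<inter> forms d)" for d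
    unfolding image_act_inter_forms[OF assms(1)]
    by (rule dim_image_act[OF assms(1) subspace_homogeneous_ideal_forms[OF assms(2)]])
  then show ?thesis using assms(3) by (simp add: has_hilbert_polynomial_def)
qed

lemma inj_monomial: "inj (monomial :: 'v trm \<Rightarrow> ('v, 'a::field) mpol)"
  by (rule injI) (metis keys_monomial singleton_inject)

lemma independent_monomials:
  fixes T :: "'v trm set"
  assumes "finite T"
  shows "mp.independent (monomial ` T :: ('v, 'a::field) mpol set)"
proof (rule mp.independent_if_scalars_zero)
  fix u :: "('v, 'a) mpol \<Rightarrow> 'a" and x :: "('v, 'a) mpol"
  assume s: "(\<Sum>v\<in>monomial ` T. scale (u v) v) = 0" and x: "x \<in> monomial ` T"
  obtain t where t: "t \<in> T" "x = monomial t" using x by blast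
  have "0 = (\<Sum>s\<in>T. u (monomial s) * Poly_Mapping.lookup (monomial s :: ('v, 'a) mpol) t)"
    using arg_cong[OF s, of "\<lambda>f. Poly_Mapping.lookup f t"]
    by (simp add: sum.reindex[OF inj_on_subset[OF inj_monomial]] lookup_sum lookup_scale)
  also have "\<dots> = (\<Sum>s\<in>T. if s = t then u x else 0)"
    by (intro sum.cong) (auto simp: lookup_monomial t(2))
  also have "\<dots> = u x" using assms t(1) by simp
  finally show "u x = 0" by simp
qed (use assms in simp)

context term_ord
begin

lemma is_basis_monomials:
  assumes T: "T \<in> ext_terms m q"
  shows "is_basis q (\<lambda>i. monomial (desc tle T i)) (vs T :: ('v, 'a::field) mpol set)"
proof -
  have im: "(\<lambda>i. monomial (desc tle T i)) ` {..<q} = (monomial ` T :: ('v, 'a) mpol set)"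
    using desc_image[OF T] by (metis image_image)
  have "inj_on (desc tle T) {..<q}" using bij_betw_desc_ext_terms[OF T] by (simp add: bij_betw_def)
  then have "inj_on (\<lambda>i. monomial (desc tle T i) :: ('v, 'a) mpol) {..<q}"
    using inj_monomial by (auto simp: inj_on_def)
  then show ?thesis
    unfolding is_basis_def im using independent_monomials ext_terms_finite[OF T] by (simp add: vs_def)
qed

text \<open>Upper triangular matrices over the small field are such matrices over the large one, and
  the embedding reflects vanishing of coordinates. So invariance over \<Omega> descends to
  \<open>K\<close>.\<close>

lemma borel_termsI:
  fixes hom :: "'a::field \<Rightarrow> 'b::field"
  assumes hom: "comm_ring_hom hom" "\<And>c. hom c = 0 \<Longrightarrow> c = 0"
    and T: "T \<in> ext_terms m q"
    and fixed: "\<And>(h :: ('b, 'v) sq_mat) U. invertible h \<Longrightarrow> upper_triangular h \<Longrightarrow>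
       wedge tle q m (\<lambda>i. act h (monomial (desc tle T i))) U \<noteq> 0 \<Longrightarrow> U = T"
  shows "T \<in> borel_terms TYPE('a) tle m q"
  unfolding borel_terms_def
proof (intro CollectI conjI T allI impI)
  interpret comm_ring_hom hom by (rule hom(1))
  fix g :: "('a, 'v) sq_mat"
  assume g: "invertible g \<and> upper_triangular g"
  let ?h = "\<chi> i j. hom (g $ i $ j)"
  have "Determinants.det ?h \<noteq> 0" using g hom(2) by (auto simp: hom_det_matrix invertible_det_nz)
  then have h: "invertible ?h" by (simp add: invertible_det_nz)
  have ut: "upper_triangular ?h" using g by (simp add: upper_triangular_def)
  have "wedge tle q m (\<lambda>i. act g (monomial (desc tle T i))) U = 0" if "U \<noteq> T" for U
  proof -
    have "wedge tle q m (\<lambda>i. act ?h (monomial (desc tle T i))) U = 0" using fixed[OF h ut] that by blast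
    then show ?thesis using hom(2) by (simp flip: hom_wedge add: mapc_act mapc_monomial)
  qed
  then show "\<exists>c. \<forall>U. wedge tle q m (\<lambda>i. act g (monomial (desc tle T i))) U =
      c * wedge tle q m (\<lambda>i. monomial (desc tle T i)) U"
    \<comment> \<open>The scalar is the coordinate at \<open>T\<close> itself, because the
      untransformed term has coordinate 1 there and 0 elsewhere.\<close>
    by (intro exI[of _ "wedge tle q m (\<lambda>i. act g (monomial (desc tle T i))) T"])
       (simp add: wedge_monomials[OF T])
qed

text \<open>The matrix \<open>g\<close> is generic for the degree \<open>m\<close> piece only, yet
  the Hilbert polynomial concerns all degrees. Both are served by \<open>act g\<close>
  I\<open>, whose degree\<close>m\<open>piece is\<close>act g \<open>V\<close>.\<close>

lemma ex_borel_hilb_term_above: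
  fixes f :: "nat \<Rightarrow> ('v, 'b::field) mpol" and hom :: "'a::field \<Rightarrow> 'b"
  assumes v: "CARD('v) = n + 1"
    and gotzmann: "is_gotzmann_number TYPE(('v, 'a) mpol) p r" and m: "r \<le> m"
    and q: "of_nat q = of_nat ((n + m) choose n) - poly p (of_nat m)"
    and inf: "infinite (UNIV :: 'b set)"
    and hom: "comm_ring_hom hom" "\<And>c. hom c = 0 \<Longrightarrow> c = 0"
    and V: "V \<in> hilb_points p m q" "is_basis q f V"
  obtains T where "T \<in> borel_hilb_terms TYPE('a) tle p m q"
    "\<And>U. wedge tle q m f U \<noteq> 0 \<Longrightarrow> ext_le tle U T"
proof -
  obtain I where I: "I \<in> hilb_ideals p" "V = I \<inter> forms m" using V(1) by (auto simp: hilb_points_def)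
  have V': "mp.subspace V" "V \<subseteq> forms m" "mp.dim V = q" using V(1) by (auto simp: hilb_points_def grassmannian_def)
  have hI: "homogeneous_ideal I" "has_hilbert_polynomial I p" using I(1) by (auto simp: hilb_ideals_def)
  have span: "mp.span (f ` {..<q}) = V" using V(2) by (simp add: is_basis_def)
  obtain g T where gT: "invertible g" "T = leading (act g ` V)" "T \<in> ext_terms m q"
    "\<And>U. wedge tle q m f U \<noteq> 0 \<Longrightarrow> ext_le tle U T"
    "\<And>(h :: ('b, 'v) sq_mat) U. invertible h \<Longrightarrow> upper_triangular h \<Longrightarrow>
       wedge tle q m (\<lambda>i. act h (monomial (desc tle T i))) U \<noteq> 0 \<Longrightarrow> U = T"
    using ex_generic_leading_term[OF inf V' span] by metis
  have gV: "act g ` I \<inter> forms m = act g ` V" using image_act_inter_forms[OF gT(1)] I(2) by simp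
  have "mp.dim (act g ` I \<inter> forms m) = q" using dim_image_act[OF gT(1) V'(1)] V'(3) gV by simp
  from vs_lead_terms_in_hilb_points[OF v gotzmann m q homogeneous_ideal_image_act[OF gT(1) hI(1)]
      has_hilbert_polynomial_image_act[OF gT(1) hI] this]
  have "(vs T :: ('v, 'a) mpol set) \<in> hilb_points p m q" by (simp add: gT(2) gV)
  moreover have "T \<in> borel_terms TYPE('a) tle m q" by (rule borel_termsI[OF hom gT(3) gT(5)])
  ultimately have "T \<in> borel_hilb_terms TYPE('a) tle p m q" by (simp add: borel_hilb_terms_def)
  then show ?thesis using that gT(4) by blast
qed

text \<open>Maximal Borel terms are given as points over \<open>K\<close>, but the carrier of the
  Hilbert scheme is built from points over \<Omega>. As \<open>T\<close> is the set of leading terms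
  of \<open>vs T\<close>, the ideal over the new field comes from the saturated initial ideal
  instead of an extension of scalars of \<open>I\<close>.\<close>

lemma hilb_points_vs_base_change:
  assumes v: "CARD('v) = n + 1"
    and gotzmann: "is_gotzmann_number TYPE(('v, 'a::field) mpol) p r" and m: "r \<le> m"
    and q: "of_nat q = of_nat ((n + m) choose n) - poly p (of_nat m)"
    and T: "(vs T :: ('v, 'a) mpol set) \<in> hilb_points p m q"
  shows "(vs T :: ('v, 'b::field) mpol set) \<in> hilb_points p m q"
proof -
  obtain I :: "('v, 'a) mpol set" where I: "I \<in> hilb_ideals p" "vs T = I \<inter> forms m"
    using T by (auto simp: hilb_points_def)
  have hI: "homogeneous_ideal I" "has_hilbert_polynomial I p" using I(1) by (auto simp: hilb_ideals_def)
  have "mp.dim (I \<inter> forms m) = q" using T by (simp add: hilb_points_def grassmannian_def I(2))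
  from vs_lead_terms_in_hilb_points[OF v gotzmann m q hI this]
  show ?thesis unfolding I(2)[symmetric] leading_vs .
qed

end

theorem proposition6p2:
  fixes tle :: "'v::{finite,linorder} trm \<Rightarrow> 'v trm \<Rightarrow> bool"
    and p :: "rat poly" and n r m q :: nat
  assumes "infinite (UNIV :: 'a::field set)"
    and "CARD('v) = n + 1"
    and "term_order tle"
    and "is_gotzmann_number TYPE(('v, 'a) mpol) p r"
    and "r \<le> m"
    and "of_nat q = of_nat ((n + m) choose n) - poly p (of_nat m)"
  shows "\<exists>C \<subseteq> irreducible_components
            (hilb_space tle p m q :: ('v trm set, 'a) mpol set topology).
           finite C \<and> card C = card (maximal_borel_hilb_terms TYPE('a) tle p m q)"
proof -
  interpret term_ord tle by unfold_locales (fact assms(3))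
  let ?Y = "hilb_carrier tle p m q :: ('v trm set, 'a) mpol set set"
  let ?S = "hilb_space tle p m q :: ('v trm set, 'a) mpol set topology"
  let ?M = "maximal_borel_hilb_terms TYPE('a) tle p m q"
  have S: "?S = zariski ?Y" by (simp add: hilb_space_def)
  \<comment> \<open>The only nonzero Pluecker coordinate of this point is the one at
    \<open>L\<close>, so \<open>var L\<close> is a form not vanishing at it.\<close>
  define pt :: "'v trm set \<Rightarrow> ('v trm set, 'a) mpol set" where
    "pt L = proj_point (wedge tle q m (\<lambda>i. monomial (desc tle L i)))" for L
  have ext: "L \<in> ext_terms m q" and hilb: "(vs L :: ('v, 'a) mpol set) \<in> hilb_points p m q" if "L \<in> ?M" for L
    using that by (auto simp: maximal_borel_hilb_terms_def borel_hilb_terms_def borel_terms_def)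
  have pt: "pt L \<in> ?Y" "var L \<notin> pt L" if L: "L \<in> ?M" for L
  proof -
    have "(vs L :: ('v, 'a univ_dom) mpol set) \<in> hilb_points p m q"
      by (rule hilb_points_vs_base_change[OF assms(2,4,5,6) hilb[OF L]])
    then show "pt L \<in> ?Y"
      using is_basis_monomials[OF ext[OF L]] unfolding hilb_carrier_def pt_def by blast
    show "var L \<notin> pt L" by (simp add: pt_def var_in_proj_point_iff wedge_monomials[OF ext[OF L]])
  qed
  have "\<forall>L\<in>?M. \<exists>Z. Z \<in> irreducible_components ?S \<and> pt L \<in> Z"
  proof
    fix L assume "L \<in> ?M"
    then have "pt L \<in> topspace ?S" unfolding S by (intro in_topspace_zariski[OF pt])
    from ex_irreducible_component[OF this]
    show "\<exists>Z. Z \<in> irreducible_components ?S \<and> pt L \<in> Z" by (simp only: Bex_def)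
  qed
  from bchoice[OF this] obtain comp
    where comp: "\<And>L. L \<in> ?M \<Longrightarrow> comp L \<in> irreducible_components ?S \<and> pt L \<in> comp L" by auto
  have "inj_on comp ?M"
  proof (rule inj_onI)
    fix L L' assume L: "L \<in> ?M" and L': "L' \<in> ?M" and eq: "comp L = comp L'"
    have irr: "irreducible_in (zariski ?Y) (comp L)" using comp[OF L] by (simp add: irreducible_components_def S)
    have meets: "pt L \<in> comp L" "pt L \<in> {P \<in> ?Y. var L \<notin> P}" "pt L' \<in> comp L" "pt L' \<in> {P \<in> ?Y. var L' \<notin> P}"
      using comp[OF L] comp[OF L'] pt[OF L] pt[OF L'] eq by simp_all
    obtain P where P: "P \<in> comp L" "P \<in> {P \<in> ?Y. var L \<notin> P}" "P \<in> {P \<in> ?Y. var L' \<notin> P}"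
      by (rule irreducible_in_meets[OF irr openin_zariski meets(1,2) openin_zariski meets(3,4)])
    then obtain f and V :: "('v, 'a univ_dom) mpol set" where
      fV: "V \<in> hilb_points p m q" "is_basis q f V" "P = proj_point (wedge tle q m f)"
      by (auto simp: hilb_carrier_def)
    have emb: "c = 0" if "univ_emb c = 0" for c :: 'a
    proof -
      interpret comm_ring_hom "univ_emb :: 'a \<Rightarrow> _" by (rule comm_ring_hom_univ_emb)
      show ?thesis using that univ_emb_eq_iff[of c 0] by simp
    qed
    obtain T where T: "T \<in> borel_hilb_terms TYPE('a) tle p m q"
      "\<And>U. wedge tle q m f U \<noteq> 0 \<Longrightarrow> ext_le tle U T"
      using ex_borel_hilb_term_above[OF assms(2,4,5,6) infinite_univ_dom[OF assms(1)]
          comm_ring_hom_univ_emb emb fV(1,2)] by metis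
    have "wedge tle q m f L \<noteq> 0" "wedge tle q m f L' \<noteq> 0"
      using P(2,3) by (simp_all add: fV(3) var_in_proj_point_iff)
    then have "T = L" "T = L'" using T L L' by (auto simp: maximal_borel_hilb_terms_def)
    then show "L = L'" by simp
  qed
  \<comment> \<open>There are finitely many sets of \<open>q\<close> terms of degree
    \<open>m\<close>, so the cardinality in the conclusion is a genuine count.\<close>
  moreover have "finite ?M"
    by (rule finite_subset[OF _ finite_ext_terms[of m q]]) (use ext in blast)
  ultimately show ?thesis
    using comp by (intro exI[of _ "comp ` ?M"]) (auto simp: card_image)
qed

end
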